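(* Let $m\ge1$, $T\subseteq\{0,\ldots,m-1\}$, $s=|T|$, let $W\ge1$ be the machine-word width and $n=\lceil m/W\rceil$. Consider Frobenius-factorized reduction modulo $g=x^m+\sum_{t\in T}x^t\in\mathbb{F}_2[x]$, as described in the context. Excluding the caller-owned input and output, the in-place scalar reduction can be performed with one $m$-bit state. The implementation evaluated in the paper (described in the context) allocates exactly $n+1$ plan-owned scratch-array words: $n$ state words and one zero sentinel. An explicit reusable plan stores $r$ stage records, $S_{\mathrm{fb}}$ feedback-shift records and $s$ assembly-shift records, in addition to constant-size metadata. Such a plan can be constructed in $O(s+r+S_{\mathrm{fb}})$ word-RAM operations and the same asymptotic number of records. Alternatively, the factors can be generated online with no persistent feedback or assembly schedule. This realization uses $n+1$ state words and $s$ reusable descriptor records, hence $O(n+s)$ workspace, and performs $O(s+r+S_{\mathrm{fb}})$ additional scalar descriptor-generation operations per reduction.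
   Context: The support $T$ is given as a duplicate-free list of exponents in strictly increasing order. For $t\in T$ put $\Delta_t=m-t$. For $d\ge 0$, $N^d$ is the truncated right shift on $\mathbb{F}_2^m$: $(N^dy)_i=y_{i+d}$ if $0\le i<m-d$ and $(N^dy)_i=0$ if $m-d\le i<m$; $N^d=0$ for $d\ge m$. Put $V(Y)=\sum_{t\in T}(x^tY\bmod x^m)$ for $\deg Y<m$. If $T\subseteq\{0\}$ set $r=0$; otherwise $r=\lceil\log_2(m/\Delta_{\min})\rceil$ with $\Delta_{\min}=\min\{\Delta_t:t\in T\}$. For $k\ge0$, $T_k=\{t\in T:2^k\Delta_t<m\}$, and $S_{\mathrm{fb}}=\sum_{k=0}^{r-1}|T_k|$. Frobenius-factorized reduction on input $A=L+x^mH$ ($\deg L,\deg H<m$): set $Y\leftarrow H$; for $k=0,\ldots,r-1$ replace $Y$ by $Y+\sum_{t\in T_k}N^{2^k\Delta_t}Y$ (all shifts reading the same stage input); return $L+V(Y)$, which equals $A\bmod g$. Packed representation: coefficient $i$ is bit $i\bmod W$ of word $\lfloor i/W\rfloor$ in an array of $n$ words. A reusable plan retains, for each stage $0\le k<r$, the shifts $2^k\Delta_t$ ($t\in T_k$), one record per shift, together with one record per stage and one record per tap $t\in T$ for the final assembly $L+V(Y)$. The online realization instead keeps no such precomputed data: it derives the shifts of each stage from $T$ immediately before applying the stage, overwriting a descriptor array reused at the next stage. The implementation evaluated in the paper is a scalar in-place one whose scratch array consists of the $n$ words of the state $Y$ plus one extra zero word (sentinel) used for adjacent-word reads. *)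

theory Defs
  imports Complex_Main "HOL-Library.Z2" "HOL-Computational_Algebra.Polynomial"
begin

section \<open>Frobenius-factorized reduction\<close>

text \<open>
  The field with two elements is the type \<^typ>\<open>bit\<close>. A vector in its \<open>m\<close>-th power is identified
  with the polynomial of degree below \<open>m\<close> having these coefficients.
  The support is a list \<open>T\<close> of exponents, strictly increasing, with entries below \<open>m\<close>.
\<close>

definition valid_support :: "nat \<Rightarrow> nat list \<Rightarrow> bool" where
  "valid_support m T \<longleftrightarrow> sorted_wrt (<) T \<and> set T \<subseteq> {..<m}"

definition modulus :: "nat \<Rightarrow> nat list \<Rightarrow> bit poly" where
  "modulus m T = monom 1 m + (\<Sum>t\<in>set T. monom 1 t)"

text \<open>Truncated subtraction makes this \<open>0\<close> for \<open>d \<ge> m\<close>.\<close>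

definition nil_shift :: "nat \<Rightarrow> nat \<Rightarrow> bit poly \<Rightarrow> bit poly" where
  "nil_shift m d y = (\<Sum>i<m - d. monom (coeff y (i + d)) i)"

definition active_taps :: "nat \<Rightarrow> nat list \<Rightarrow> nat \<Rightarrow> nat set" where
  "active_taps m T k = {t \<in> set T. 2 ^ k * (m - t) < m}"

definition num_stages :: "nat \<Rightarrow> nat list \<Rightarrow> nat" where
  "num_stages m T =
     (if set T \<subseteq> {0} then 0
      else nat \<lceil>log 2 (real m / real (Min ((\<lambda>t. m - t) ` set T)))\<rceil>)"

definition num_feedback :: "nat \<Rightarrow> nat list \<Rightarrow> nat" where
  "num_feedback m T = (\<Sum>k<num_stages m T. card (active_taps m T k))"

primrec frob_state :: "nat \<Rightarrow> nat list \<Rightarrow> bit poly \<Rightarrow> nat \<Rightarrow> bit poly" where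
  "frob_state m T H 0 = H"
| "frob_state m T H (Suc k) =
     frob_state m T H k
       + (\<Sum>t\<in>active_taps m T k. nil_shift m (2 ^ k * (m - t)) (frob_state m T H k))"

definition frob_final_state :: "nat \<Rightarrow> nat list \<Rightarrow> bit poly \<Rightarrow> bit poly" where
  "frob_final_state m T H = frob_state m T H (num_stages m T)"

definition low_fold :: "nat \<Rightarrow> nat list \<Rightarrow> bit poly \<Rightarrow> bit poly" where
  "low_fold m T Y = (\<Sum>t\<in>set T. (monom 1 t * Y) mod monom 1 m)"

definition frob_reduce :: "nat \<Rightarrow> nat list \<Rightarrow> bit poly \<Rightarrow> bit poly \<Rightarrow> bit poly" where
  "frob_reduce m T L H = L + low_fold m T (frob_final_state m T H)"


section \<open>A word RAM\<close>

text \<open>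
  The machine has finitely many scalar registers and one array per region. \<open>Input\<close> (the packed
  polynomial to be reduced), \<open>Taps\<close> (the support) and \<open>Output\<close> belong to the caller; the first two
  are read-only. All other regions are workspace: they are initially empty and have to be allocated
  by the program.
\<close>

datatype reg =
  Rm | Rw | Rn | Rs | Rr | Rlo | Rpow | Rlim | Ri | Rj | Rk | Rq | Rb | Rd | Racc | Rlen | Rbase

datatype region =
  Input | Taps | Output | State | Descr | Stages | Feedback | Assembly | Meta

definition packed_regions :: "region set" where
  "packed_regions = {Input, Output, State}"

definition workspace_regions :: "region set" where
  "workspace_regions = {State, Descr, Stages, Feedback, Assembly, Meta}"

datatype binop = Add | Sub | Mul | Quo | Rem | Xor | Shl | Shr | Low | Less

text \<open>\<open>Shl\<close> drops the bits moved out of a \<open>W\<close>-bit word; \<open>Low\<close> keeps the given number of low bits.\<close>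

fun apply_op :: "nat \<Rightarrow> binop \<Rightarrow> nat \<Rightarrow> nat \<Rightarrow> nat" where
  "apply_op W Add a b = a + b"
| "apply_op W Sub a b = a - b"
| "apply_op W Mul a b = a * b"
| "apply_op W Quo a b = a div b"
| "apply_op W Rem a b = a mod b"
| "apply_op W Xor a b = Bit_Operations.xor a b"
| "apply_op W Shl a b = take_bit W (push_bit b a)"
| "apply_op W Shr a b = drop_bit b a"
| "apply_op W Low a b = take_bit b a"
| "apply_op W Less a b = of_bool (a < b)"

datatype exp =
    Const nat
  | Reg reg
  | Load region exp
  | Bin binop exp exp
  | AndAlso exp exp

abbreviation (input) exp_add (infixl "[+]" 65) where "a [+] b \<equiv> Bin Add a b"
abbreviation (input) exp_sub (infixl "[-]" 65) where "a [-] b \<equiv> Bin Sub a b"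
abbreviation (input) exp_mul (infixl "[*]" 70) where "a [*] b \<equiv> Bin Mul a b"
abbreviation (input) exp_div (infixl "[div]" 70) where "a [div] b \<equiv> Bin Quo a b"
abbreviation (input) exp_mod (infixl "[mod]" 70) where "a [mod] b \<equiv> Bin Rem a b"
abbreviation (input) exp_xor (infixl "[xor]" 59) where "a [xor] b \<equiv> Bin Xor a b"
abbreviation (input) exp_shl (infixl "[shl]" 60) where "a [shl] b \<equiv> Bin Shl a b"
abbreviation (input) exp_shr (infixl "[shr]" 60) where "a [shr] b \<equiv> Bin Shr a b"
abbreviation (input) exp_low (infixl "[low]" 60) where "a [low] b \<equiv> Bin Low a b"
abbreviation (input) exp_less (infix "[<]" 50) where "a [<] b \<equiv> Bin Less a b"

text \<open>
  \<open>len st a\<close> is the allocated length of region \<open>a\<close>. Allocation only reserves cells and leaves their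
  contents as they are, so that a freshly allocated array contains arbitrary values.
\<close>

record state =
  regs :: "reg \<Rightarrow> nat"
  mem :: "region \<Rightarrow> nat \<Rightarrow> nat"
  len :: "region \<Rightarrow> nat"

text \<open>
  Expression evaluation is stuck (\<^term>\<open>None\<close>) on an access outside the allocated part of a
  region and on a result that is not below the range \<open>B\<close> of a machine word.
\<close>

definition in_range :: "nat \<Rightarrow> nat \<Rightarrow> nat option" where
  "in_range B v = (if v < B then Some v else None)"

fun eval :: "nat \<Rightarrow> nat \<Rightarrow> exp \<Rightarrow> state \<Rightarrow> nat option" where
  "eval W B (Const c) st = in_range B c"
| "eval W B (Reg x) st = Some (regs st x)"
| "eval W B (Load a e) st =
     (case eval W B e st of
        None \<Rightarrow> None
      | Some i \<Rightarrow> if i < len st a then Some (mem st a i) else None)"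
| "eval W B (Bin f e1 e2) st =
     (case (eval W B e1 st, eval W B e2 st) of
        (Some u, Some v) \<Rightarrow> in_range B (apply_op W f u v)
      | _ \<Rightarrow> None)"
| "eval W B (AndAlso e1 e2) st =
     (case eval W B e1 st of
        None \<Rightarrow> None
      | Some u \<Rightarrow> if u = 0 then Some 0 else eval W B e2 st)"

primrec ops :: "exp \<Rightarrow> nat" where
  "ops (Const c) = 1"
| "ops (Reg x) = 1"
| "ops (Load a e) = ops e + 1"
| "ops (Bin f e1 e2) = ops e1 + ops e2 + 1"
| "ops (AndAlso e1 e2) = ops e1 + ops e2 + 1"

text \<open>\<open>Generate c\<close> behaves as \<open>c\<close>; it marks the descriptor-generating parts of a program.\<close>

datatype com =
    Skip
  | Assign reg exp  (infix "::=" 56)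
  | Store region exp exp
  | Alloc region exp
  | Seq com com  (infixr ";;" 55)
  | If exp com com
  | While exp com
  | Generate com

text \<open>
  \<open>exec W B c st t g st'\<close>: started in \<open>st\<close>, program \<open>c\<close> terminates in \<open>st'\<close> without getting stuck
  after \<open>t\<close> word operations, \<open>g\<close> of which are executed inside \<^const>\<open>Generate\<close>. A region can be
  allocated at most once and is never released, so the final lengths are the total allocation.
\<close>

inductive exec :: "nat \<Rightarrow> nat \<Rightarrow> com \<Rightarrow> state \<Rightarrow> nat \<Rightarrow> nat \<Rightarrow> state \<Rightarrow> bool" for W B where
  Skip: "exec W B Skip st 0 0 st"
| Assign: "eval W B e st = Some v \<Longrightarrow>
    exec W B (x ::= e) st (ops e + 1) 0 (st\<lparr>regs := (regs st)(x := v)\<rparr>)"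
| Store: "eval W B e1 st = Some i \<Longrightarrow> eval W B e2 st = Some v \<Longrightarrow>
    a \<notin> {Input, Taps} \<Longrightarrow> i < len st a \<Longrightarrow> (a \<in> packed_regions \<Longrightarrow> v < 2 ^ W) \<Longrightarrow>
    exec W B (Store a e1 e2) st (ops e1 + ops e2 + 1) 0
      (st\<lparr>mem := (mem st)(a := (mem st a)(i := v))\<rparr>)"
| Alloc: "eval W B e st = Some v \<Longrightarrow> a \<in> workspace_regions \<Longrightarrow> len st a = 0 \<Longrightarrow>
    exec W B (Alloc a e) st (ops e + 1) 0 (st\<lparr>len := (len st)(a := v)\<rparr>)"
| Seq: "exec W B c1 st t1 g1 st1 \<Longrightarrow> exec W B c2 st1 t2 g2 st2 \<Longrightarrow>
    exec W B (c1 ;; c2) st (t1 + t2) (g1 + g2) st2"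
| IfTrue: "eval W B e st = Some v \<Longrightarrow> v \<noteq> 0 \<Longrightarrow> exec W B c1 st t g st' \<Longrightarrow>
    exec W B (If e c1 c2) st (ops e + 1 + t) g st'"
| IfFalse: "eval W B e st = Some 0 \<Longrightarrow> exec W B c2 st t g st' \<Longrightarrow>
    exec W B (If e c1 c2) st (ops e + 1 + t) g st'"
| WhileTrue: "eval W B e st = Some v \<Longrightarrow> v \<noteq> 0 \<Longrightarrow> exec W B c st t1 g1 st1 \<Longrightarrow>
    exec W B (While e c) st1 t2 g2 st2 \<Longrightarrow>
    exec W B (While e c) st (ops e + 1 + t1 + t2) (g1 + g2) st2"
| WhileFalse: "eval W B e st = Some 0 \<Longrightarrow> exec W B (While e c) st (ops e + 1) 0 st"
| Generate: "exec W B c st t g st' \<Longrightarrow> exec W B (Generate c) st t t st'"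

text \<open>
  Machine words hold \<open>W\<close>-bit packed words and also the scalars addressing a problem of size \<open>m\<close>.
  The second bound only matters if \<open>W\<close> is too small for the latter, which the usual word-RAM
  convention (word length at least logarithmic in the problem size) rules out.
\<close>

definition word_range :: "nat \<Rightarrow> nat \<Rightarrow> nat" where
  "word_range m W = max (2 ^ W) (4 * (m + W))"

definition workspace :: "state \<Rightarrow> nat" where
  "workspace st = (\<Sum>a\<in>workspace_regions. len st a)"

definition contents :: "state \<Rightarrow> region \<Rightarrow> nat list" where
  "contents st a = map (mem st a) [0..<len st a]"


section \<open>Packed polynomials and calling conventions\<close>

definition num_words :: "nat \<Rightarrow> nat \<Rightarrow> nat" where
  "num_words W b = nat \<lceil>real b / real W\<rceil>"

definition packs :: "nat \<Rightarrow> nat \<Rightarrow> (nat \<Rightarrow> nat) \<Rightarrow> bit poly \<Rightarrow> bool" where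
  "packs W n w p \<longleftrightarrow>
     (\<forall>i<n. w i < 2 ^ W) \<and>
     (\<forall>i<n * W. Bit_Operations.bit (w (i div W)) (i mod W) \<longleftrightarrow> coeff p i = 1)"

definition has_support :: "nat \<Rightarrow> nat list \<Rightarrow> nat \<Rightarrow> state \<Rightarrow> bool" where
  "has_support m T W st \<longleftrightarrow>
     regs st Rm = m \<and> regs st Rw = W \<and> regs st Rs = length T \<and> contents st Taps = T"

definition has_io :: "nat \<Rightarrow> nat \<Rightarrow> bit poly \<Rightarrow> state \<Rightarrow> bool" where
  "has_io m W A st \<longleftrightarrow>
     len st Input = num_words W (2 * m) \<and> packs W (num_words W (2 * m)) (mem st Input) A \<and>
     len st Output = num_words W m"

definition no_workspace :: "state \<Rightarrow> bool" where
  "no_workspace st \<longleftrightarrow> (\<forall>a\<in>workspace_regions. len st a = 0)"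

definition stage_shifts :: "nat \<Rightarrow> nat list \<Rightarrow> nat \<Rightarrow> nat list" where
  "stage_shifts m T k = map (\<lambda>t. 2 ^ k * (m - t)) (filter (\<lambda>t. t \<in> active_taps m T k) T)"

text \<open>
  The record of a stage is the number of its shifts; the shifts themselves are stored stage by
  stage. The record of a tap is its exponent.
\<close>

definition holds_plan :: "nat \<Rightarrow> nat list \<Rightarrow> nat \<Rightarrow> state \<Rightarrow> bool" where
  "holds_plan m T W st \<longleftrightarrow>
     contents st Meta = [m, W, num_words W m, length T, num_stages m T] \<and>
     contents st Stages = map (\<lambda>k. card (active_taps m T k)) [0..<num_stages m T] \<and>
     contents st Feedback = concat (map (stage_shifts m T) [0..<num_stages m T]) \<and>
     contents st Assembly = T \<and>
     len st State = num_words W m + 1"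

definition reduced :: "nat \<Rightarrow> nat list \<Rightarrow> nat \<Rightarrow> bit poly \<Rightarrow> bit poly \<Rightarrow> state \<Rightarrow> bool" where
  "reduced m T W L H st \<longleftrightarrow>
     packs W (num_words W m) (mem st State) (frob_final_state m T H) \<and>
     packs W (num_words W m) (mem st Output) (frob_reduce m T L H)"


section \<open>The programs\<close>

definition for_below :: "reg \<Rightarrow> exp \<Rightarrow> com \<Rightarrow> com" where
  "for_below x e c =
     (x ::= Const 0 ;; While (Reg x [<] e) (c ;; x ::= Reg x [+] Const 1))"

definition count_words :: com where
  "count_words = Rn ::= (Reg Rm [+] Reg Rw [-] Const 1) [div] Reg Rw"

text \<open>State := bits \<open>m, m + 1, \<dots>\<close> of the input.\<close>

definition load_high :: com where
  "load_high = for_below Ri (Reg Rn)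
     (Rd ::= Reg Rm [+] Reg Ri [*] Reg Rw ;;
      Rq ::= Reg Rd [div] Reg Rw ;;
      Rb ::= Reg Rd [mod] Reg Rw ;;
      Racc ::= Load Input (Reg Rq) [shr] Reg Rb ;;
      If (Reg Rq [+] Const 1 [<] (Reg Rm [+] Reg Rm [+] Reg Rw [-] Const 1) [div] Reg Rw)
        (Racc ::= Reg Racc
           [xor] (Load Input (Reg Rq [+] Const 1) [shl] (Reg Rw [-] Reg Rb)))
        Skip ;;
      Store State (Reg Ri) (Reg Racc))"

text \<open>
  In stage \<open>k\<close> the registers hold \<open>Rpow = 2 ^ k\<close> and \<open>Rlim = (m - 1) div 2 ^ k\<close>, so that a tap \<open>t\<close>
  is active iff \<open>m - t \<le> Rlim\<close>. As the support is increasing, the active taps are those from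
  position \<open>Rlo\<close> on, and the stages end when there are none.
\<close>

definition skip_inactive :: com where
  "skip_inactive =
     While (AndAlso (Reg Rlo [<] Reg Rs) (Reg Rlim [<] Reg Rm [-] Load Taps (Reg Rlo)))
       (Rlo ::= Reg Rlo [+] Const 1)"

definition first_stage :: com where
  "first_stage =
     (Rlo ::= Const 0 ;; Rpow ::= Const 1 ;; Rlim ::= Reg Rm [-] Const 1 ;; skip_inactive)"

definition next_stage :: com where
  "next_stage =
     (Rpow ::= Reg Rpow [+] Reg Rpow ;; Rlim ::= Reg Rlim [div] Const 2 ;; skip_inactive)"

abbreviation more_stages :: exp where "more_stages \<equiv> Reg Rlo [<] Reg Rs"

abbreviation tap_shift :: exp where
  "tap_shift \<equiv> (Reg Rm [-] Load Taps (Reg Rlo [+] Reg Rj)) [*] Reg Rpow"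

text \<open>
  One feedback stage on the state array, in place: the new word \<open>i\<close> depends only on old words with
  index at least \<open>i\<close>, and words are overwritten in increasing order. The expression \<open>shift\<close>
  yields the shift with index \<open>Rj\<close>, and \<open>adjacent\<close> accumulates the contribution of word \<open>Rq + 1\<close>.
\<close>

definition apply_stage :: "exp \<Rightarrow> com \<Rightarrow> com" where
  "apply_stage shift adjacent = for_below Ri (Reg Rn)
     (Racc ::= Load State (Reg Ri) ;;
      for_below Rj (Reg Rlen)
        (Rd ::= shift ;;
         Rq ::= Reg Ri [+] Reg Rd [div] Reg Rw ;;
         Rb ::= Reg Rd [mod] Reg Rw ;;
         If (Reg Rq [<] Reg Rn)
           (Racc ::= Reg Racc [xor] (Load State (Reg Rq) [shr] Reg Rb) ;; adjacent)
           Skip) ;;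
      Store State (Reg Ri) (Reg Racc))"

definition adjacent_word :: com where
  "adjacent_word = Racc ::= Reg Racc
     [xor] (Load State (Reg Rq [+] Const 1) [shl] (Reg Rw [-] Reg Rb))"

definition adjacent_word_guarded :: com where
  "adjacent_word_guarded = If (Reg Rq [+] Const 1 [<] Reg Rn) adjacent_word Skip"

text \<open>Output := \<open>L + V(Y)\<close>, with the tap exponents read from region \<open>a\<close>.\<close>

definition assemble :: "region \<Rightarrow> com" where
  "assemble a = for_below Ri (Reg Rn)
     (Racc ::= Load Input (Reg Ri) ;;
      for_below Rj (Reg Rs)
        (Rd ::= Load a (Reg Rj) ;;
         Rq ::= Reg Rd [div] Reg Rw ;;
         Rb ::= Reg Rd [mod] Reg Rw ;;
         If (Reg Rq [<] Reg Ri [+] Const 1)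
           (Racc ::= Reg Racc [xor] (Load State (Reg Ri [-] Reg Rq) [shl] Reg Rb))
           Skip ;;
         If (Reg Rq [<] Reg Ri)
           (Racc ::= Reg Racc
              [xor] (Load State (Reg Ri [-] Reg Rq [-] Const 1) [shr] (Reg Rw [-] Reg Rb)))
           Skip) ;;
      Store Output (Reg Ri) (Reg Racc [low] (Reg Rm [-] Reg Ri [*] Reg Rw)))"

text \<open>No storage besides the packed state: shifts are recomputed whenever they are used.\<close>

definition inplace_reduction :: com where
  "inplace_reduction =
     (count_words ;;
      Alloc State (Reg Rn) ;;
      load_high ;;
      first_stage ;;
      While more_stages
        (Rlen ::= Reg Rs [-] Reg Rlo ;;
         apply_stage tap_shift adjacent_word_guarded ;;
         next_stage) ;;
      assemble Taps)"

text \<open>A first pass over the stages determines the sizes of the plan, a second one fills it.\<close>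

definition build_plan :: com where
  "build_plan =
     (count_words ;;
      first_stage ;;
      Rr ::= Const 0 ;;
      Rbase ::= Const 0 ;;
      While more_stages
        (Rbase ::= Reg Rbase [+] (Reg Rs [-] Reg Rlo) ;;
         Rr ::= Reg Rr [+] Const 1 ;;
         next_stage) ;;
      Alloc Meta (Const 5) ;;
      Alloc Stages (Reg Rr) ;;
      Alloc Feedback (Reg Rbase) ;;
      Alloc Assembly (Reg Rs) ;;
      Alloc State (Reg Rn [+] Const 1) ;;
      Store Meta (Const 0) (Reg Rm) ;;
      Store Meta (Const 1) (Reg Rw) ;;
      Store Meta (Const 2) (Reg Rn) ;;
      Store Meta (Const 3) (Reg Rs) ;;
      Store Meta (Const 4) (Reg Rr) ;;
      first_stage ;;
      Rk ::= Const 0 ;;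
      Rbase ::= Const 0 ;;
      While more_stages
        (Rlen ::= Reg Rs [-] Reg Rlo ;;
         Store Stages (Reg Rk) (Reg Rlen) ;;
         for_below Rj (Reg Rlen) (Store Feedback (Reg Rbase [+] Reg Rj) tap_shift) ;;
         Rbase ::= Reg Rbase [+] Reg Rlen ;;
         Rk ::= Reg Rk [+] Const 1 ;;
         next_stage) ;;
      for_below Rj (Reg Rs) (Store Assembly (Reg Rj) (Load Taps (Reg Rj))))"

definition planned_reduction :: com where
  "planned_reduction =
     (Rm ::= Load Meta (Const 0) ;;
      Rw ::= Load Meta (Const 1) ;;
      Rn ::= Load Meta (Const 2) ;;
      Rs ::= Load Meta (Const 3) ;;
      Rr ::= Load Meta (Const 4) ;;
      load_high ;;
      Store State (Reg Rn) (Const 0) ;;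
      Rbase ::= Const 0 ;;
      for_below Rk (Reg Rr)
        (Rlen ::= Load Stages (Reg Rk) ;;
         apply_stage (Load Feedback (Reg Rbase [+] Reg Rj)) adjacent_word ;;
         Rbase ::= Reg Rbase [+] Reg Rlen) ;;
      assemble Assembly)"

definition online_reduction :: com where
  "online_reduction =
     (count_words ;;
      Alloc State (Reg Rn [+] Const 1) ;;
      load_high ;;
      Store State (Reg Rn) (Const 0) ;;
      Generate (Alloc Descr (Reg Rs) ;; Rbase ::= Const 0 ;; first_stage) ;;
      While more_stages
        (Generate
           (Rlen ::= Reg Rs [-] Reg Rlo ;;
            for_below Rj (Reg Rlen) (Store Descr (Reg Rj) tap_shift)) ;;
         apply_stage (Load Descr (Reg Rbase [+] Reg Rj)) adjacent_word ;;
         Generate next_stage) ;;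
      assemble Taps)"

end

theory Submission
  imports Defs
begin

text \<open>
  The feedback operator \<open>M = (\<Sum>t\<in>T. N\<^sup>m\<^sup>-\<^sup>t)\<close> is nilpotent, and squaring doubles its shifts in
  characteristic two. Hence the stages compute \<open>Y = (1 + M)\<^sup>-\<^sup>1 H\<close>, which is the quotient of the
  division by \<open>g\<close>.

  On packed words, a shift of the polynomial becomes the exclusive or of two adjacent shifted words.
  All passes over packed arrays have exact operation counts that depend only on the schedule, so that
  the online and the planned reduction differ only in the handling of descriptors. Since the support
  is sorted, the first active position only moves upwards, and finding the active taps costs
  \<open>O(s + r)\<close> operations over all stages. The number of active taps in stage \<open>k\<close> is at most
  \<open>(m - 1) div 2 ^ k\<close>, which keeps all offsets into the schedule below \<open>2 * m\<close> and thus
  within a machine word.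
\<close>

section \<open>The reduction as a polynomial identity\<close>

text \<open>In operator form the invariant of the stages is that \<open>1 + M\<close> times the
  product of \<open>1 + M^(2^j)\<close> over \<open>j < k\<close> equals \<open>1 + M^(2^k)\<close>.
  Truncated shifts compose awkwardly, so this is proved for the untruncated
  \<open>poly_shift\<close>, which agrees with them on polynomials of degree below \<open>m\<close>.
  The machine gets stuck on values outside the word range and on unallocated cells, and fresh cells
  hold arbitrary values. A program proof therefore has to deliver termination, a bound for every
  intermediate value, the initialisation of the sentinel and the operation count at once; the
  predicate \<open>runs\<close> is made for this. The extra cost of online generation is measured
  against every possible run of the planned reduction. This takes an upper bound for the former, a
  lower bound for the latter, and determinism. The leading terms agree exactly because both programs
  fetch a shift by a load of the shape \<open>Load a (Reg Rbase [+] Reg Rj)\<close>; for this reason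
  the online program keeps \<open>Rbase\<close> at zero.\<close>

lemma bit_add_self [simp]: "x + x = (0::bit)"
  by (cases x) simp_all

lemma bit_poly_add_self [simp]: "p + p = (0::bit poly)"
  by (rule poly_eqI) (simp only: coeff_add bit_add_self coeff_0)

lemma bit_poly_add_cancel_left [simp]: "p + (p + q) = (q::bit poly)"
  by (simp flip: add.assoc)

text \<open>The pairs \<open>(t, u)\<close> and \<open>(u, t)\<close> off the diagonal contribute
  equal terms, which cancel in characteristic two. This is the Frobenius identity in the form that
  \<open>feedback_square\<close> needs.\<close>

lemma sum_symmetric_bit_poly:
  fixes F :: "'a \<Rightarrow> 'a \<Rightarrow> bit poly"
  assumes "finite S" and "\<And>t u. F t u = F u t"
  shows "(\<Sum>t\<in>S. \<Sum>u\<in>S. F t u) = (\<Sum>t\<in>S. F t t)"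
  using assms(1)
proof (induction S rule: finite_induct)
  case (insert a S)
  have "(\<Sum>t\<in>S. F t a) = (\<Sum>t\<in>S. F a t)"
    using assms(2) by simp
  with insert show ?case
    by (simp add: sum.distrib add.assoc)
qed simp

lemma poly_shift_poly_shift: "poly_shift a (poly_shift b p) = poly_shift (a + b) p"
  by (simp add: poly_eq_iff coeff_poly_shift add.assoc)

lemma poly_shift_add: "poly_shift a (p + q) = poly_shift a p + poly_shift a q"
  by (simp add: poly_eq_iff coeff_poly_shift)

lemma poly_shift_sum: "poly_shift a (\<Sum>t\<in>S. f t) = (\<Sum>t\<in>S. poly_shift a (f t))"
  by (simp add: poly_eq_iff coeff_poly_shift coeff_sum)

lemma coeff_eq_0_degree_less: "degree p < m \<Longrightarrow> m \<le> i \<Longrightarrow> coeff p i = 0"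
  by (simp add: coeff_eq_0)

section \<open>Truncated shifts on polynomials of degree below \<open>m\<close>\<close>

lemma coeff_nil_shift: "coeff (nil_shift m d y) i = (if i < m - d then coeff y (i + d) else 0)"
  by (simp add: nil_shift_def coeff_sum)

text \<open>The truncation only discards coefficients of \<open>y\<close> with index at least
  \<open>m\<close>, which vanish. Unlike \<open>nil_shift\<close>, \<open>poly_shift\<close> has a
  composition law without side conditions.\<close>

lemma nil_shift_eq_poly_shift:
  assumes "degree y < m"
  shows "nil_shift m d y = poly_shift d y"
  using coeff_eq_0_degree_less[OF assms]
  by (auto simp: poly_eq_iff coeff_nil_shift coeff_poly_shift)

lemma poly_shift_eq_0: "degree y < m \<Longrightarrow> m \<le> d \<Longrightarrow> poly_shift d y = 0"
  by (simp add: poly_eq_iff coeff_poly_shift coeff_eq_0)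

lemma degree_poly_shift_less: "degree y < m \<Longrightarrow> degree (poly_shift d y) < m"
  by (rule degree_lessI) (auto simp: coeff_poly_shift coeff_eq_0)

text \<open>\<open>p\<close> is its part below \<open>x^m\<close> plus a multiple of
  \<open>x^m\<close>. Reduction modulo \<open>x^m\<close> becomes a coefficientwise cutoff, which is
  visibly additive and matches a bit mask on packed words.\<close>

lemma mod_monom_eq_poly_cutoff: "p mod monom 1 m = poly_cutoff m (p :: 'a::field poly)"
proof -
  have p: "p = poly_cutoff m p + monom 1 m * poly_shift m p"
    by (simp add: poly_eq_iff coeff_poly_cutoff coeff_monom_mult coeff_poly_shift)
  have "p mod monom 1 m = poly_cutoff m p mod monom 1 m"
    by (subst p) (simp only: mod_mult_self2)
  also have "poly_cutoff m p mod monom 1 m = poly_cutoff m p"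
  proof (cases "m = 0")
    case True
    then have "poly_cutoff m p = 0"
      by (simp add: poly_eq_iff coeff_poly_cutoff)
    then show ?thesis
      by simp
  next
    case False
    then have "degree (poly_cutoff m p) < m"
      by (intro degree_lessI) (simp_all add: coeff_poly_cutoff)
    then show ?thesis
      by (intro mod_poly_less) (simp add: degree_monom_eq)
  qed
  finally show ?thesis .
qed

text \<open>The \<open>2\<^sup>k\<close>-th power of the nilpotent operator; inactive taps contribute nothing.\<close>

definition feedback :: "nat \<Rightarrow> nat list \<Rightarrow> nat \<Rightarrow> bit poly \<Rightarrow> bit poly" where
  "feedback m T k y = (\<Sum>t\<in>set T. poly_shift (2 ^ k * (m - t)) y)"

lemma feedback_add: "feedback m T k (p + q) = feedback m T k p + feedback m T k q"
  by (simp add: feedback_def poly_shift_add sum.distrib)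

lemma feedback_commute:
  "feedback m T j (feedback m T k y) = feedback m T k (feedback m T j y)"
  unfolding feedback_def poly_shift_sum poly_shift_poly_shift
  by (subst sum.swap) (simp add: add.commute)

lemma feedback_square: "feedback m T k (feedback m T k y) = feedback m T (Suc k) y"
proof -
  have "feedback m T k (feedback m T k y) =
      (\<Sum>t\<in>set T. poly_shift (2 ^ k * (m - t) + 2 ^ k * (m - t)) y)"
    unfolding feedback_def poly_shift_sum poly_shift_poly_shift
    by (rule sum_symmetric_bit_poly) (simp_all add: add.commute)
  also have "\<dots> = feedback m T (Suc k) y"
    unfolding feedback_def by (simp add: mult_2 distrib_right)
  finally show ?thesis .
qed

lemma finite_active_taps [simp]: "finite (active_taps m T k)"
  by (simp add: active_taps_def)

lemma feedback_eq_sum_active: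
  assumes "degree y < m"
  shows "feedback m T k y = (\<Sum>t\<in>active_taps m T k. poly_shift (2 ^ k * (m - t)) y)"
  unfolding feedback_def
  by (rule sum.mono_neutral_right) (auto simp: active_taps_def intro: poly_shift_eq_0[OF assms])

lemma degree_feedback_less: "degree y < m \<Longrightarrow> degree (feedback m T k y) < m"
  unfolding feedback_def
  by (cases "m = 0") (auto intro!: degree_sum_less degree_poly_shift_less)

lemma frob_state_Suc_feedback:
  assumes "degree (frob_state m T H k) < m"
  shows "frob_state m T H (Suc k) = frob_state m T H k + feedback m T k (frob_state m T H k)"
  by (simp add: feedback_eq_sum_active[OF assms] nil_shift_eq_poly_shift[OF assms])

lemma degree_frob_state_less:
  assumes "degree H < m"
  shows "degree (frob_state m T H k) < m"
proof (induction k)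
  case (Suc k)
  then show ?case
    unfolding frob_state_Suc_feedback[OF Suc]
    by (intro degree_add_less degree_feedback_less)
qed (use assms in simp)

text \<open>With \<open>M\<close> for \<open>feedback m T 0\<close>, the state is the product of
  \<open>1 + M^(2^j)\<close> over \<open>j < k\<close> applied to \<open>H\<close>, and
  \<open>1 + M\<close> completes it to \<open>1 + M^(2^k)\<close>. The induction step multiplies by
  \<open>1 + M^(2^k)\<close>, whose square is \<open>1 + M^(2^(k+1))\<close> in characteristic
  two.\<close>

lemma frob_state_inverts:
  assumes "degree H < m"
  shows "frob_state m T H k + feedback m T 0 (frob_state m T H k) = H + feedback m T k H"
proof (induction k)
  case (Suc k)
  define Y where "Y = frob_state m T H k"
  have "frob_state m T H (Suc k) + feedback m T 0 (frob_state m T H (Suc k)) =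
      (Y + feedback m T 0 Y) + feedback m T k (Y + feedback m T 0 Y)"
    unfolding frob_state_Suc_feedback[OF degree_frob_state_less[OF assms]] Y_def[symmetric]
    by (simp add: feedback_add feedback_commute[of m T 0 k] add_ac)
  also have "\<dots> = (H + feedback m T k H) + feedback m T k (H + feedback m T k H)"
    using Suc by (simp add: Y_def)
  also have "\<dots> = H + feedback m T (Suc k) H"
    by (simp add: feedback_add feedback_square add_ac)
  finally show ?case .
qed simp

text \<open>The tap of smallest distance is the last to become inactive, namely once
  \<open>2 ^ k\<close> reaches \<open>m / Min D\<close>. If no tap but \<open>0\<close> occurs, its
  distance is \<open>m\<close> and it is never active. Only here is the logarithm in
  \<open>num_stages\<close> unfolded; the programs never compute it and stop at the first empty
  stage.\<close>

lemma active_taps_eq_empty_iff: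
  assumes "m \<ge> 1" and "valid_support m T"
  shows "active_taps m T k = {} \<longleftrightarrow> num_stages m T \<le> k"
proof (cases "set T \<subseteq> {0}")
  case True
  have "m \<le> 2 ^ k * m"
    by simp
  with True show ?thesis
    by (auto simp: num_stages_def active_taps_def not_less)
next
  case False
  define D where "D = (\<lambda>t. m - t) ` set T"
  have fin: "finite D" and ne: "D \<noteq> {}"
    using False by (auto simp: D_def)
  have pos: "Min D > 0"
    using fin ne assms(2) by (subst Min_gr_iff) (auto simp: D_def valid_support_def)
  have "active_taps m T k = {} \<longleftrightarrow> (\<forall>d\<in>D. m \<le> 2 ^ k * d)"
    by (auto simp: active_taps_def D_def not_less)
  also have "\<dots> \<longleftrightarrow> m \<le> 2 ^ k * Min D"
    using Min_in[OF fin ne] Min_le[OF fin]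
    by (meson le_trans mult_le_mono2)
  also have "\<dots> \<longleftrightarrow> real m \<le> 2 ^ k * real (Min D)"
    by (metis of_nat_le_iff of_nat_mult of_nat_numeral of_nat_power)
  also have "\<dots> \<longleftrightarrow> real m / real (Min D) \<le> 2 ^ k"
    using pos by (simp add: divide_le_eq)
  also have "\<dots> \<longleftrightarrow> log 2 (real m / real (Min D)) \<le> real k"
    using pos assms(1) by (subst log_le_iff) (auto simp: powr_realpow)
  also have "\<dots> \<longleftrightarrow> num_stages m T \<le> k"
    using False by (simp add: num_stages_def D_def ceiling_le_iff nat_le_iff)
  finally show ?thesis .
qed

lemma frob_final_state_inverts:
  assumes "m \<ge> 1" and "valid_support m T" and "degree H < m"
  shows "frob_final_state m T H + feedback m T 0 (frob_final_state m T H) = H"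
proof -
  have "active_taps m T (num_stages m T) = {}"
    using active_taps_eq_empty_iff[OF assms(1,2)] by blast
  then have "feedback m T (num_stages m T) H = 0"
    using assms(3) by (simp add: feedback_eq_sum_active)
  then show ?thesis
    by (simp add: frob_final_state_def frob_state_inverts[OF assms(3)])
qed

section \<open>Division by the modulus\<close>

lemma low_fold_eq_poly_cutoff: "low_fold m T Y = poly_cutoff m (\<Sum>t\<in>set T. monom 1 t * Y)"
  by (simp add: low_fold_def mod_monom_eq_poly_cutoff poly_eq_iff coeff_sum coeff_poly_cutoff)

text \<open>Multiplication by \<open>x^t\<close> pushes the coefficients from index
  \<open>m - t\<close> on past \<open>x^m\<close>, and what overflows is the shift of
  \<open>Y\<close> by \<open>m - t\<close>. This is where the distances \<open>m - t\<close> come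
  from.\<close>

lemma monom_mult_eq_cutoff_shift:
  assumes "t \<le> m"
  shows "monom 1 t * Y = poly_cutoff m (monom 1 t * Y) + monom 1 m * poly_shift (m - t) Y"
  using assms by (auto simp: poly_eq_iff coeff_poly_cutoff coeff_monom_mult coeff_poly_shift)

lemma degree_modulus:
  assumes "m \<ge> 1" and "valid_support m T"
  shows "degree (modulus m T) = m"
proof -
  have "degree (\<Sum>t\<in>set T. monom (1::bit) t) < m"
    using assms by (auto intro!: degree_sum_less simp: degree_monom_eq valid_support_def)
  then show ?thesis
    unfolding modulus_def by (subst degree_add_eq_left) (auto simp: degree_monom_eq)
qed

text \<open>The quotient is the final state \<open>Y\<close>: since \<open>Y\<close> plus its feedback is \<open>H\<close>, we have \<open>g Y = x\<^sup>m H + V(Y)\<close>.\<close>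

lemma frob_reduce_eq_mod:
  assumes "m \<ge> 1" and "valid_support m T" and "degree L < m" and "degree H < m"
  shows "frob_reduce m T L H = (L + monom 1 m * H) mod modulus m T"
proof -
  define Y where "Y = frob_final_state m T H"
  have "(\<Sum>t\<in>set T. monom 1 t * Y) =
      (\<Sum>t\<in>set T. poly_cutoff m (monom 1 t * Y) + monom 1 m * poly_shift (m - t) Y)"
    using assms(2) by (intro sum.cong monom_mult_eq_cutoff_shift) (auto simp: valid_support_def)
  also have "\<dots> = low_fold m T Y + monom 1 m * feedback m T 0 Y"
    by (simp add: sum.distrib low_fold_def mod_monom_eq_poly_cutoff feedback_def sum_distrib_left)
  finally have "Y * modulus m T =
      monom 1 m * (Y + feedback m T 0 Y) + low_fold m T Y"
    by (simp add: modulus_def algebra_simps sum_distrib_left)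
  then have "Y * modulus m T = monom 1 m * H + low_fold m T Y"
    using frob_final_state_inverts[OF assms(1,2,4)] by (simp add: Y_def)
  \<comment> \<open>Each summand on the right contains one copy of \<open>low_fold m T Y\<close>;
    the copies cancel in characteristic two, which exhibits \<open>Y\<close> as a quotient.\<close>
  then have "L + monom 1 m * H = frob_reduce m T L H + Y * modulus m T"
    by (simp add: frob_reduce_def Y_def[symmetric] add_ac)
  moreover have "degree (frob_reduce m T L H) < m"
    unfolding frob_reduce_def low_fold_eq_poly_cutoff
    using assms(1,3) by (intro degree_add_less degree_lessI) (auto simp: coeff_poly_cutoff coeff_eq_0)
  ultimately show ?thesis
    using degree_modulus[OF assms(1,2)] by (simp add: mod_poly_less)
qed

section \<open>Packed words\<close>

unbundle bit_operations_syntax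

lemma bit_nat_ge: "v < 2 ^ W \<Longrightarrow> W \<le> j \<Longrightarrow> \<not> bit (v::nat) j"
  by (metis bit_take_bit_iff not_le take_bit_nat_eq_self)

lemma xor_less: "x < 2 ^ W \<Longrightarrow> y < 2 ^ W \<Longrightarrow> x XOR y < (2 ^ W :: nat)"
  by (metis take_bit_nat_eq_self take_bit_nat_less_exp take_bit_xor)

lemma drop_bit_less: "x < 2 ^ W \<Longrightarrow> drop_bit k x < (2 ^ W :: nat)"
  by (simp add: drop_bit_eq_div) (meson div_le_dividend le_less_trans)

definition word :: "nat \<Rightarrow> bit poly \<Rightarrow> nat \<Rightarrow> nat" where
  "word W p i = horner_sum of_bool 2 (map (\<lambda>j. coeff p (i * W + j) = 1) [0..<W])"

lemma bit_word_iff: "bit (word W p i) j \<longleftrightarrow> j < W \<and> coeff p (i * W + j) = 1"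
  by (auto simp: word_def bit_horner_sum_bit_iff)

lemma word_less [simp]: "word W p i < 2 ^ W"
proof -
  have "take_bit W (word W p i) = word W p i"
    by (rule bit_eqI) (auto simp: bit_take_bit_iff bit_word_iff)
  then show ?thesis
    by (metis take_bit_nat_less_exp)
qed

text \<open>The range condition in \<open>packs\<close> forces the bits from \<open>W\<close> on to
  vanish, so the bit condition leaves no freedom. Packing thus becomes a set of equations that can
  be used for rewriting.\<close>

lemma packs_iff_word: "packs W n w p \<longleftrightarrow> (\<forall>i<n. w i = word W p i)"
proof
  assume p: "packs W n w p"
  show "\<forall>i<n. w i = word W p i"
  proof (intro allI impI bit_eqI)
    fix i j assume i: "i < n"
    show "bit (w i) j \<longleftrightarrow> bit (word W p i) j"
    proof (cases "j < W")
      case True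
      have "i * W + j < Suc i * W"
        using True by simp
      also have "\<dots> \<le> n * W"
        using i by (intro mult_le_mono1) simp
      finally have "bit (w ((i * W + j) div W)) ((i * W + j) mod W) \<longleftrightarrow>
          coeff p (i * W + j) = 1"
        using p unfolding packs_def by blast
      with True show ?thesis
        by (simp add: bit_word_iff)
    next
      case False
      moreover have "w i < 2 ^ W"
        using p i by (simp add: packs_def)
      ultimately show ?thesis
        by (simp add: bit_word_iff bit_nat_ge)
    qed
  qed
next
  assume w: "\<forall>i<n. w i = word W p i"
  show "packs W n w p"
    unfolding packs_def
  proof (intro conjI allI impI)
    fix i assume "i < n * W"
    then have "i div W < n" "i mod W < W"
      by (cases "W = 0"; simp add: less_mult_imp_div_less)+
    with w show "bit (w (i div W)) (i mod W) \<longleftrightarrow> coeff p i = 1"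
      by (simp add: bit_word_iff)
  qed (use w in simp)
qed

lemma coeff_bit_add_eq_1_iff:
  "coeff (p + q) k = (1::bit) \<longleftrightarrow> (coeff p k = 1) \<noteq> (coeff q k = 1)"
  by (cases "coeff p k"; cases "coeff q k") simp_all

lemma word_add: "word W (p + q) i = word W p i XOR word W q i"
  by (rule bit_eqI) (auto simp: bit_word_iff bit_xor_iff coeff_bit_add_eq_1_iff simp del: coeff_add)

lemma word_eq_0: "(\<And>k. i * W \<le> k \<Longrightarrow> coeff p k = 0) \<Longrightarrow> word W p i = 0"
  by (rule bit_eqI) (simp add: bit_word_iff)

text \<open>With \<open>d = q * W + b\<close>, bit \<open>j\<close> of the shifted word is bit
  \<open>b + j\<close> counted from the start of word \<open>i + q\<close>. The lower
  \<open>W - b\<close> bits come from that word and the upper \<open>b\<close> bits from the next.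
  For \<open>b = 0\<close> the second part is shifted by \<open>W\<close> and erased by
  \<open>take_bit\<close>, so no case distinction is needed.\<close>

lemma word_poly_shift:
  assumes "W \<ge> 1"
  shows "word W (poly_shift d p) i =
    drop_bit (d mod W) (word W p (i + d div W)) XOR
    take_bit W (push_bit (W - d mod W) (word W p (i + d div W + 1)))"
proof (rule bit_eqI)
  fix j
  define b where "b = d mod W"
  define q where "q = d div W"
  have d: "d = q * W + b" and b: "b < W"
    using assms by (simp_all add: b_def q_def)
  have e1: "(i + q) * W + (b + j) = i * W + j + d"
    by (simp add: d algebra_simps)
  have e2: "(i + q + 1) * W + (j - (W - b)) = i * W + j + d" if "W - b \<le> j"
    using that b by (simp add: d algebra_simps)
  show "bit (word W (poly_shift d p) i) j \<longleftrightarrow>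
      bit (drop_bit (d mod W) (word W p (i + d div W)) XOR
        take_bit W (push_bit (W - d mod W) (word W p (i + d div W + 1)))) j"
    unfolding b_def[symmetric] q_def[symmetric] bit_xor_iff bit_take_bit_iff
      bit_push_bit_iff bit_drop_bit_eq bit_word_iff coeff_poly_shift comp_apply e1
    using b e2 by (cases "j < W"; cases "W - b \<le> j") (auto simp del: mult_Suc)
qed

text \<open>The mirror image of \<open>word_poly_shift\<close>, with two source words below
  \<open>i\<close>. Neither source may have a negative index, hence the two conditions. For
  \<open>b = 0\<close> the second source is shifted right by \<open>W\<close> and contributes
  nothing.\<close>

lemma word_monom_mult:
  assumes "W \<ge> 1"
  shows "word W (monom 1 d * p) i =
    (if d div W \<le> i then take_bit W (push_bit (d mod W) (word W p (i - d div W))) else 0) XOR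
    (if d div W < i then drop_bit (W - d mod W) (word W p (i - d div W - 1)) else 0)"
proof (rule bit_eqI)
  fix j
  define b where "b = d mod W"
  define q where "q = d div W"
  have d: "d = q * W + b" and b: "b < W"
    using assms by (simp_all add: b_def q_def)
  \<comment> \<open>Word \<open>i\<close> lies before the word that contains position
    \<open>d\<close>, is that word, or lies beyond it. Accordingly no source word, one, or both
    exist.\<close>
  consider (low) "i < q" | (mid) "i = q" | (high) c where "i = q + 1 + c"
    by (metis add.assoc less_iff_Suc_add linorder_neqE_nat plus_1_eq_Suc add_Suc_right add_Suc)
  then show "bit (word W (monom 1 d * p) i) j \<longleftrightarrow>
      bit
       ((if d div W \<le> i then take_bit W (push_bit (d mod W) (word W p (i - d div W))) else 0) XOR
        (if d div W < i then drop_bit (W - d mod W) (word W p (i - d div W - 1)) else 0)) j"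
    unfolding b_def[symmetric] q_def[symmetric]
  proof cases
    case low
    then have "Suc i * W \<le> q * W"
      by (intro mult_le_mono1) simp
    then have "j < W \<Longrightarrow> i * W + j < d"
      by (simp add: d)
    with low show "bit (word W (monom 1 d * p) i) j \<longleftrightarrow>
      bit
       ((if q \<le> i then take_bit W (push_bit b (word W p (i - q))) else 0) XOR
        (if q < i then drop_bit (W - b) (word W p (i - q - 1)) else 0)) j"
      by (auto simp: bit_word_iff coeff_monom_mult)
  next
    case mid
    then have "i * W + j - d = j - b" "d \<le> i * W + j \<longleftrightarrow> b \<le> j"
      by (simp_all add: d)
    with mid b show "bit (word W (monom 1 d * p) i) j \<longleftrightarrow>
      bit
       ((if q \<le> i then take_bit W (push_bit b (word W p (i - q))) else 0) XOR
        (if q < i then drop_bit (W - b) (word W p (i - q - 1)) else 0)) j"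
      by (auto simp: bit_word_iff coeff_monom_mult bit_take_bit_iff bit_push_bit_iff)
  next
    case high
    have e: "i * W + j = q * W + (W + c * W + j)"
      by (simp add: high algebra_simps)
    have h: "i * W + j - d = W + c * W + j - b" "d \<le> i * W + j" "q \<le> i" "q < i"
      "i - q = 1 + c" "i - q - 1 = c"
      using b by (simp_all add: e d) (simp_all add: high)
    have e1: "(1 + c) * W + (j - b) = W + c * W + j - b" if "b \<le> j"
      using that by simp
    have e2: "c * W + (W - b + j) = W + c * W + j - b"
      using b by simp
    \<comment> \<open>\<open>P\<close> is the single coefficient that decides bit \<open>j\<close>.
      The left-shifted word delivers it when \<open>b \<le> j\<close>, the right-shifted word
      otherwise, so exactly one of the two bits can be set.\<close>
    define P where "P \<longleftrightarrow> coeff p (W + c * W + j - b) = 1"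
    have "b \<le> j \<and> coeff p ((1 + c) * W + (j - b)) = 1 \<longleftrightarrow> b \<le> j \<and> P"
      using e1 by (metis P_def)
    then have "j < W \<and> P \<longleftrightarrow>
        (j < W \<and> b \<le> j \<and> j - b < W \<and> coeff p ((1 + c) * W + (j - b)) = 1) \<noteq>
        (W - b + j < W \<and> P)"
      using b by (cases "b \<le> j") auto
    moreover have "bit (word W (monom 1 d * p) i) j \<longleftrightarrow> j < W \<and> P"
      using h(2) by (simp add: bit_word_iff coeff_monom_mult h(1) P_def not_less[symmetric])
    moreover have "bit (take_bit W (push_bit b (word W p (i - q)))) j \<longleftrightarrow>
        j < W \<and> b \<le> j \<and> j - b < W \<and> coeff p ((1 + c) * W + (j - b)) = 1"
      unfolding h(5) by (auto simp: bit_word_iff bit_take_bit_iff bit_push_bit_iff)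
    moreover have "bit (drop_bit (W - b) (word W p (i - q - 1))) j \<longleftrightarrow> W - b + j < W \<and> P"
      unfolding h(6) bit_drop_bit_eq comp_apply bit_word_iff e2 P_def ..
    ultimately show "bit (word W (monom 1 d * p) i) j \<longleftrightarrow>
      bit
       ((if q \<le> i then take_bit W (push_bit b (word W p (i - q))) else 0) XOR
        (if q < i then drop_bit (W - b) (word W p (i - q - 1)) else 0)) j"
      unfolding bit_xor_iff if_P[OF h(3)] if_P[OF h(4)] by blast
  qed
qed

text \<open>\<open>m - i * W\<close> is the number of bits of word \<open>i\<close> that lie below
  position \<open>m\<close>. It exceeds \<open>W\<close> for inner words, which are left alone, and
  truncates to zero for words beyond \<open>m\<close>.\<close>

lemma take_bit_word: "take_bit (m - i * W) (word W p i) = word W (poly_cutoff m p) i"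
  by (rule bit_eqI) (auto simp: bit_word_iff bit_take_bit_iff coeff_poly_cutoff)

section \<open>Reasoning about programs\<close>

text \<open>Total counterpart of \<open>eval\<close>. Keeping the value apart from the condition
  \<open>safe\<close> for not being stuck lets symbolic execution compute without options.\<close>

fun val :: "nat \<Rightarrow> exp \<Rightarrow> state \<Rightarrow> nat" where
  "val W (Const c) st = c"
| "val W (Reg x) st = regs st x"
| "val W (Load a e) st = mem st a (val W e st)"
| "val W (Bin f e1 e2) st = apply_op W f (val W e1 st) (val W e2 st)"
| "val W (AndAlso e1 e2) st = (if val W e1 st = 0 then 0 else val W e2 st)"

fun safe :: "nat \<Rightarrow> nat \<Rightarrow> exp \<Rightarrow> state \<Rightarrow> bool" where
  "safe W B (Const c) st \<longleftrightarrow> c < B"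
| "safe W B (Reg x) st \<longleftrightarrow> True"
| "safe W B (Load a e) st \<longleftrightarrow> safe W B e st \<and> val W e st < len st a"
| "safe W B (Bin f e1 e2) st \<longleftrightarrow>
     safe W B e1 st \<and> safe W B e2 st \<and> apply_op W f (val W e1 st) (val W e2 st) < B"
| "safe W B (AndAlso e1 e2) st \<longleftrightarrow> safe W B e1 st \<and> (val W e1 st \<noteq> 0 \<longrightarrow> safe W B e2 st)"

lemma eval_eq: "eval W B e st = (if safe W B e st then Some (val W e st) else None)"
  by (induction e) (auto simp: in_range_def split: option.splits)

text \<open>A total-correctness triple with costs. It asks for the existence of a run, and for
  loop-free commands the rules below are equivalences, so they can be used as rewrite rules that
  execute a program symbolically.\<close>

definition runs ::
    "nat \<Rightarrow> nat \<Rightarrow> com \<Rightarrow> state \<Rightarrow> (nat \<Rightarrow> nat \<Rightarrow> state \<Rightarrow> bool) \<Rightarrow> bool" where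
  "runs W B c st Q \<longleftrightarrow> (\<exists>t g st'. exec W B c st t g st' \<and> Q t g st')"

lemma runs_mono:
  assumes "runs W B c st Q" and "\<And>t g s. Q t g s \<Longrightarrow> Q' t g s"
  shows "runs W B c st Q'"
  using assms unfolding runs_def by blast

inductive_cases exec_SkipE: "exec W B Skip st t g st'"
inductive_cases exec_AssignE: "exec W B (x ::= e) st t g st'"
inductive_cases exec_StoreE: "exec W B (Store a e1 e2) st t g st'"
inductive_cases exec_AllocE: "exec W B (Alloc a e) st t g st'"
inductive_cases exec_SeqE: "exec W B (c1 ;; c2) st t g st'"
inductive_cases exec_IfE: "exec W B (If e c1 c2) st t g st'"
inductive_cases exec_WhileE: "exec W B (While e c) st t g st'"
inductive_cases exec_GenerateE: "exec W B (Generate c) st t g st'"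

lemma runs_Skip: "runs W B Skip st Q \<longleftrightarrow> Q 0 0 st"
  unfolding runs_def by (auto elim: exec_SkipE intro: exec.Skip)

lemma runs_Assign:
  "runs W B (x ::= e) st Q \<longleftrightarrow>
     safe W B e st \<and> Q (ops e + 1) 0 (st\<lparr>regs := (regs st)(x := val W e st)\<rparr>)"
proof
  assume "runs W B (x ::= e) st Q"
  then show "safe W B e st \<and> Q (ops e + 1) 0 (st\<lparr>regs := (regs st)(x := val W e st)\<rparr>)"
    unfolding runs_def by (auto elim!: exec_AssignE simp: eval_eq split: if_splits)
next
  assume a: "safe W B e st \<and> Q (ops e + 1) 0 (st\<lparr>regs := (regs st)(x := val W e st)\<rparr>)"
  then have "exec W B (x ::= e) st (ops e + 1) 0 (st\<lparr>regs := (regs st)(x := val W e st)\<rparr>)"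
    by (intro exec.Assign) (simp add: eval_eq)
  with a show "runs W B (x ::= e) st Q"
    unfolding runs_def by blast
qed

lemma runs_Store:
  "runs W B (Store a e1 e2) st Q \<longleftrightarrow>
     safe W B e1 st \<and> safe W B e2 st \<and> a \<notin> {Input, Taps} \<and> val W e1 st < len st a \<and>
     (a \<in> packed_regions \<longrightarrow> val W e2 st < 2 ^ W) \<and>
     Q (ops e1 + ops e2 + 1) 0
       (st\<lparr>mem := (mem st)(a := (mem st a)(val W e1 st := val W e2 st))\<rparr>)"
  (is "?l \<longleftrightarrow> ?r")
proof
  assume ?l
  then show ?r
    unfolding runs_def by (auto elim!: exec_StoreE simp: eval_eq split: if_splits)
next
  assume r: ?r
  then have "exec W B (Store a e1 e2) st (ops e1 + ops e2 + 1) 0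
      (st\<lparr>mem := (mem st)(a := (mem st a)(val W e1 st := val W e2 st))\<rparr>)"
    by (intro exec.Store) (auto simp: eval_eq)
  with r show ?l
    unfolding runs_def by blast
qed

lemma runs_Alloc:
  "runs W B (Alloc a e) st Q \<longleftrightarrow>
     safe W B e st \<and> a \<in> workspace_regions \<and> len st a = 0 \<and>
     Q (ops e + 1) 0 (st\<lparr>len := (len st)(a := val W e st)\<rparr>)"
  (is "?l \<longleftrightarrow> ?r")
proof
  assume ?l
  then show ?r
    unfolding runs_def by (auto elim!: exec_AllocE simp: eval_eq split: if_splits)
next
  assume r: ?r
  then have "exec W B (Alloc a e) st (ops e + 1) 0 (st\<lparr>len := (len st)(a := val W e st)\<rparr>)"
    by (intro exec.Alloc) (auto simp: eval_eq)
  with r show ?l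
    unfolding runs_def by blast
qed

lemma runs_Seq:
  "runs W B (c1 ;; c2) st Q \<longleftrightarrow>
     runs W B c1 st (\<lambda>t1 g1 s1. runs W B c2 s1 (\<lambda>t2 g2 s2. Q (t1 + t2) (g1 + g2) s2))"
  unfolding runs_def by (blast elim: exec_SeqE intro: exec.Seq)

lemma runs_If:
  "runs W B (If e c1 c2) st Q \<longleftrightarrow>
     safe W B e st \<and>
     (if val W e st \<noteq> 0 then runs W B c1 st (\<lambda>t g s. Q (ops e + 1 + t) g s)
      else runs W B c2 st (\<lambda>t g s. Q (ops e + 1 + t) g s))"
  (is "?l \<longleftrightarrow> ?r")
proof
  assume ?l
  then show ?r
    unfolding runs_def by (auto elim!: exec_IfE simp: eval_eq split: if_splits)
next
  assume r: ?r
  show ?l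
  proof (cases "val W e st = 0")
    case True
    with r obtain t g s where "exec W B c2 st t g s" "Q (ops e + 1 + t) g s"
      unfolding runs_def by auto
    moreover have "eval W B e st = Some 0"
      using True r by (simp add: eval_eq)
    ultimately show ?thesis
      unfolding runs_def by (blast intro: exec.IfFalse)
  next
    case False
    with r obtain t g s where "exec W B c1 st t g s" "Q (ops e + 1 + t) g s"
      unfolding runs_def by auto
    moreover have "eval W B e st = Some (val W e st)"
      using r by (simp add: eval_eq)
    ultimately show ?thesis
      using False unfolding runs_def by (blast intro: exec.IfTrue)
  qed
qed

lemma runs_Generate:
  "runs W B (Generate c) st Q \<longleftrightarrow> runs W B c st (\<lambda>t g s. Q t t s)"
  unfolding runs_def by (blast elim: exec_GenerateE intro: exec.Generate)

lemmas runs_simps =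
  runs_Skip runs_Assign runs_Store runs_Alloc runs_Seq runs_If runs_Generate

lemma runs_While_unfold:
  assumes "safe W B e st" and
    "val W e st \<noteq> 0 \<Longrightarrow> runs W B c st (\<lambda>t g s. runs W B (While e c) s
       (\<lambda>t' g' s'. Q (ops e + 1 + t + t') (g + g') s'))" and
    "val W e st = 0 \<Longrightarrow> Q (ops e + 1) 0 st"
  shows "runs W B (While e c) st Q"
proof (cases "val W e st = 0")
  case True
  then have "exec W B (While e c) st (ops e + 1) 0 st"
    using assms(1) by (intro exec.WhileFalse) (simp add: eval_eq)
  with True assms(3) show ?thesis
    unfolding runs_def by blast
next
  case False
  from assms(2)[OF this] obtain t g s t' g' s' where
    "exec W B c st t g s" "exec W B (While e c) s t' g' s'"
    "Q (ops e + 1 + t + t') (g + g') s'"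
    unfolding runs_def by blast
  with False assms(1) show ?thesis
    unfolding runs_def by (meson eval_eq exec.WhileTrue)
qed

text \<open>The number \<open>N\<close> of iterations is known in advance, so no separate
  termination measure is needed. The invariant also receives the costs accumulated so far, which
  allows it to state exact counts as well as bounds.\<close>

lemma runs_While:
  assumes "I 0 0 0 st"
    and "\<And>i t g s. i < N \<Longrightarrow> I i t g s \<Longrightarrow> safe W B e s \<and> val W e s \<noteq> 0 \<and>
      runs W B c s (\<lambda>t' g' s'. I (Suc i) (t + (ops e + 1 + t')) (g + g') s')"
    and "\<And>t g s. I N t g s \<Longrightarrow> safe W B e s \<and> val W e s = 0 \<and> Q (t + (ops e + 1)) g s"
  shows "runs W B (While e c) st Q"
proof -
  \<comment> \<open>Generalised to a run that enters the loop after \<open>i\<close> iterations, at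
    costs \<open>t\<close> and \<open>g\<close>; the induction is on the iterations left.\<close>
  have "runs W B (While e c) s (\<lambda>t' g' s'. Q (t + t') (g + g') s')"
    if "I i t g s" "i \<le> N" for i t g s
    using that
  proof (induction "N - i" arbitrary: i t g s)
    case 0
    with assms(3)[of t g s] show ?case
      by (intro runs_While_unfold) auto
  next
    case (Suc d)
    then have i: "i < N" "d = N - Suc i"
      by simp_all
    from assms(2)[OF i(1) Suc.prems(1)] have
      r: "runs W B c s (\<lambda>t' g' s'. I (Suc i) (t + (ops e + 1 + t')) (g + g') s')" and
      e: "safe W B e s" "val W e s \<noteq> 0"
      by auto
    show ?case
    proof (rule runs_While_unfold)
      show "runs W B c s (\<lambda>t' g' s'. runs W B (While e c) s'
          (\<lambda>t'' g'' s''. Q (t + (ops e + 1 + t' + t'')) (g + (g' + g'')) s''))"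
        using r
      proof (rule runs_mono)
        fix t' g' s'
        assume "I (Suc i) (t + (ops e + 1 + t')) (g + g') s'"
        from Suc.hyps(1)[OF i(2) this] i(1)
        show "runs W B (While e c) s'
            (\<lambda>t'' g'' s''. Q (t + (ops e + 1 + t' + t'')) (g + (g' + g'')) s'')"
          by (simp add: add.assoc)
      qed
    qed (use e in simp_all)
  qed
  from this[OF assms(1)] show ?thesis
    by simp
qed

text \<open>Each round costs 4 operations for the test and 4 for the increment. The 6 outside are 2
  for the initial assignment and 4 for the last, failing test. The body has to establish the
  invariant in the state after the increment, and \<open>N < B\<close> keeps the counter in
  range.\<close>

lemma runs_for_below:
  assumes "x \<noteq> y" and "regs st y = N" and "N < B" and "1 < B"
    and "I 0 (st\<lparr>regs := (regs st)(x := 0)\<rparr>)"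
    and "\<And>i s. i < N \<Longrightarrow> I i s \<Longrightarrow> regs s x = i \<Longrightarrow> regs s y = N \<Longrightarrow>
      runs W B c s (\<lambda>t g s'. t = \<tau> i \<and> g = 0 \<and> regs s' x = i \<and> regs s' y = N \<and>
        I (Suc i) (s'\<lparr>regs := (regs s')(x := Suc i)\<rparr>))"
    and "\<And>s. I N s \<Longrightarrow> regs s x = N \<Longrightarrow> regs s y = N \<Longrightarrow> Q (6 + (\<Sum>i<N. \<tau> i + 8)) 0 s"
  shows "runs W B (for_below x (Reg y) c) st Q"
  unfolding for_below_def runs_Seq runs_Assign
proof (intro conjI)
  show "safe W B (Const 0) st"
    using assms(4) by simp
  show "runs W B (While (Reg x [<] Reg y) (c ;; x ::= Reg x [+] Const 1))
     (st\<lparr>regs := (regs st)(x := val W (Const 0) st)\<rparr>)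
     (\<lambda>t2 g2 s2. Q (ops (Const 0) + 1 + t2) (0 + g2) s2)"
  proof (rule runs_While[where N = N and I = "\<lambda>i t (g::nat) s. t = (\<Sum>i<i. \<tau> i + 8) \<and> g = 0 \<and>
      regs s x = i \<and> regs s y = N \<and> I i s"])
    fix i t g :: nat and s
    assume i: "i < N" and
      "t = (\<Sum>i<i. \<tau> i + 8) \<and> g = 0 \<and> regs s x = i \<and> regs s y = N \<and> I i s"
    then have I: "I i s" "regs s x = i" "regs s y = N" and t: "t = (\<Sum>i<i. \<tau> i + 8)" "g = 0"
      by auto
    have "runs W B (c ;; x ::= Reg x [+] Const 1) s
        (\<lambda>t' g' s'. t' = \<tau> i + 4 \<and> g' = 0 \<and> regs s' x = Suc i \<and> regs s' y = N \<and> I (Suc i) s')"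
      unfolding runs_Seq using assms(6)[OF i I]
      by (rule runs_mono) (use i assms in \<open>auto simp: runs_Assign\<close>)
    then have "runs W B (c ;; x ::= Reg x [+] Const 1) s
        (\<lambda>t' g' s'. t + (ops (Reg x [<] Reg y) + 1 + t') = (\<Sum>i<Suc i. \<tau> i + 8) \<and>
          g + g' = 0 \<and> regs s' x = Suc i \<and> regs s' y = N \<and> I (Suc i) s')"
      by (rule runs_mono) (auto simp: t)
    with I i assms show "safe W B (Reg x [<] Reg y) s \<and> val W (Reg x [<] Reg y) s \<noteq> 0 \<and>
      runs W B (c ;; x ::= Reg x [+] Const 1) s
        (\<lambda>t' g' s'. t + (ops (Reg x [<] Reg y) + 1 + t') = (\<Sum>i<Suc i. \<tau> i + 8) \<and>
          g + g' = 0 \<and> regs s' x = Suc i \<and> regs s' y = N \<and> I (Suc i) s')"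
      by simp
  next
    fix t g :: nat and s
    assume "t = (\<Sum>i<N. \<tau> i + 8) \<and> g = 0 \<and> regs s x = N \<and> regs s y = N \<and> I N s"
    then have I: "I N s" "regs s x = N" "regs s y = N" and t: "g = 0" "t = (\<Sum>i<N. \<tau> i + 8)"
      by auto
    have "ops (Const 0) + 1 + (t + (ops (Reg x [<] Reg y) + 1)) = 6 + (\<Sum>i<N. \<tau> i + 8)"
      by (simp add: t)
    with assms(7)[OF I] have "Q (ops (Const 0) + 1 + (t + (ops (Reg x [<] Reg y) + 1))) (0 + g) s"
      by (simp only: t(1) add_0)
    with assms(4) I
    show "safe W B (Reg x [<] Reg y) s \<and> val W (Reg x [<] Reg y) s = 0 \<and>
        Q (ops (Const 0) + 1 + (t + (ops (Reg x [<] Reg y) + 1))) (0 + g) s"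
      by simp
  qed (use assms in auto)
qed

text \<open>The correctness lemmas produce one run each. Determinism turns a bound on that run into
  a bound on every run, as required when the planned reduction serves as the reference for
  costs.\<close>

lemma exec_deterministic:
  assumes "exec W B c st t g st'" and "exec W B c st t' g' st''"
  shows "t' = t \<and> g' = g \<and> st'' = st'"
  using assms
proof (induction arbitrary: t' g' st'' rule: exec.induct)
  case (Seq c1 st t1 g1 st1 c2 t2 g2 st2)
  from Seq.prems show ?case
  proof (rule exec_SeqE, goal_cases)
    case (1 t1' g1' st1' t2' g2')
    have a: "t1' = t1 \<and> g1' = g1 \<and> st1' = st1"
      by (rule Seq.IH(1)) (fact 1)
    have "t2' = t2 \<and> g2' = g2 \<and> st'' = st2"
      by (rule Seq.IH(2)) (use 1 a in simp)
    with a 1 show ?case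
      by simp
  qed
next
  case (WhileTrue e st v c t1 g1 st1 t2 g2 st2)
  from WhileTrue.prems show ?case
  proof (rule exec_WhileE, goal_cases)
    case (1 v' t1' g1' st1' t2' g2')
    have a: "t1' = t1 \<and> g1' = g1 \<and> st1' = st1"
      by (rule WhileTrue.IH(1)) (fact 1)
    have "t2' = t2 \<and> g2' = g2 \<and> st'' = st2"
      by (rule WhileTrue.IH(2)) (use 1 a in simp)
    with a 1 show ?case
      by simp
  next
    case 2
    with WhileTrue.hyps show ?case
      by simp
  qed
next
  case (WhileFalse e st)
  from WhileFalse.prems show ?case
    by (rule exec_WhileE) (use WhileFalse.hyps in simp_all)
next
  case (IfTrue e st v c1 t g st' c2)
  from IfTrue.prems show ?case
  proof (rule exec_IfE, goal_cases)
    case (1 v' t1')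
    have "t1' = t \<and> g' = g \<and> st'' = st'"
      by (rule IfTrue.IH) (fact 1)
    with 1 show ?case
      by simp
  next
    case (2 t1')
    with IfTrue.hyps show ?case
      by simp
  qed
next
  case (IfFalse e st c2 t g st' c1)
  from IfFalse.prems show ?case
  proof (rule exec_IfE, goal_cases)
    case (1 v' t1')
    with IfFalse.hyps show ?case
      by simp
  next
    case (2 t1')
    have "t1' = t \<and> g' = g \<and> st'' = st'"
      by (rule IfFalse.IH) (fact 2)
    with 2 show ?case
      by simp
  qed
next
  case (Generate c st t g st')
  from Generate.prems show ?case
  proof (rule exec_GenerateE, goal_cases)
    case (1 g1')
    have "t' = t \<and> g1' = g \<and> st'' = st'"
      by (rule Generate.IH) (fact 1)
    with 1 show ?case
      by simp
  qed
qed (auto elim!: exec_SkipE exec_AssignE exec_StoreE exec_AllocE)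

lemma runsI: "exec W B c st t g s \<Longrightarrow> Q t g s \<Longrightarrow> runs W B c st Q"
  by (auto simp: runs_def)

lemma runsE:
  assumes "runs W B c st Q"
  obtains t g s where "exec W B c st t g s" and "Q t g s"
  using assms by (auto simp: runs_def)

lemma runs_Seq_exec:
  "exec W B c1 st t g s1 \<Longrightarrow> runs W B c2 s1 (\<lambda>t' g' s. Q (t + t') (g + g') s) \<Longrightarrow>
    runs W B (c1 ;; c2) st Q"
  unfolding runs_Seq by (rule runsI)

lemma runs_eqD: "runs W B c st (\<lambda>t g s. t = a \<and> g = b \<and> s = u) \<Longrightarrow> exec W B c st a b u"
  by (auto simp: runs_def)

section \<open>Passes over packed arrays\<close>

text \<open>The frame condition: \<open>X\<close> and \<open>R\<close> may change. Since all lengths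
  must stay the same, it does not cover allocations, whose effect is written out as explicit record
  updates in the program proofs.\<close>

definition preserves :: "reg set \<Rightarrow> region set \<Rightarrow> state \<Rightarrow> state \<Rightarrow> bool" where
  "preserves X R s s' \<longleftrightarrow>
     (\<forall>x. x \<notin> X \<longrightarrow> regs s' x = regs s x) \<and> (\<forall>a. a \<notin> R \<longrightarrow> mem s' a = mem s a) \<and> len s' = len s"

lemma preserves_trans:
  "preserves X R s s' \<Longrightarrow> preserves X' R' s' s'' \<Longrightarrow> preserves (X \<union> X') (R \<union> R') s s''"
  unfolding preserves_def by (metis UnI1 UnI2)

lemma contents_eq_iff:
  "contents st a = xs \<longleftrightarrow> len st a = length xs \<and> (\<forall>i<length xs. mem st a i = xs ! i)"
  by (auto simp: contents_def list_eq_iff_nth_eq)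

text \<open>The integer \<open>N\<close> with \<open>b \<le> N * W < b + W\<close> is the ceiling of
  \<open>b / W\<close>. The right-hand side is the formula that \<open>count_words\<close>
  evaluates.\<close>

lemma num_words_eq:
  assumes "W \<ge> 1"
  shows "num_words W b = (b + W - 1) div W"
proof -
  define N where "N = (b + W - 1) div W"
  have "N * W \<le> b + W - 1" "b + W - 1 < N * W + W"
    using assms dividend_less_div_times[of W "b + W - 1"] by (simp_all add: N_def add.commute)
  then have "N * W < b + W" "b \<le> N * W"
    using assms by simp_all
  then have "real N * real W < real b + real W" "real b \<le> real N * real W"
    by (simp_all flip: of_nat_mult of_nat_add)
  then have "\<lceil>real b / real W\<rceil> = int N"
    using assms by (simp add: ceiling_eq_iff field_simps)
  then show ?thesis
    by (simp add: num_words_def N_def)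
qed

lemma less_num_words_iff:
  assumes "W \<ge> 1"
  shows "i < num_words W b \<longleftrightarrow> i * W < b"
proof -
  have "i < num_words W b \<longleftrightarrow> (i + 1) * W \<le> b + W - 1"
    using assms less_eq_div_iff_mult_less_eq[of W "i + 1" "b + W - 1"]
    by (auto simp: num_words_eq)
  also have "\<dots> \<longleftrightarrow> i * W < b"
    using assms by auto
  finally show ?thesis .
qed

lemma num_words_le_iff: "W \<ge> 1 \<Longrightarrow> num_words W b \<le> i \<longleftrightarrow> b \<le> i * W"
  by (metis less_num_words_iff not_less)

lemma num_words_le: "W \<ge> 1 \<Longrightarrow> num_words W b \<le> b"
  by (simp add: num_words_le_iff)

lemma num_words_mono: "W \<ge> 1 \<Longrightarrow> b \<le> b' \<Longrightarrow> num_words W b \<le> num_words W b'"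
  by (simp add: num_words_eq div_le_mono)

lemma takeWhile_filter_monotone:
  assumes "sorted_wrt R xs" and "\<And>x y. R x y \<Longrightarrow> P x \<Longrightarrow> P y"
  shows "filter P xs = drop (length (takeWhile (\<lambda>x. \<not> P x) xs)) xs"
  using assms(1)
proof (induction xs)
  case (Cons x xs)
  show ?case
  proof (cases "P x")
    case True
    with Cons.prems assms(2) have "filter P xs = xs"
      by (auto intro!: filter_True)
    with True show ?thesis
      by simp
  qed (use Cons in simp)
qed simp

section \<open>One instance of the problem and the word-range bounds for it\<close>

locale reduction =
  fixes m :: nat and T :: "nat list" and W :: nat
  assumes m_pos: "m \<ge> 1" and support: "valid_support m T" and W_pos: "W \<ge> 1"
begin

abbreviation n where "n \<equiv> num_words W m"
abbreviation B where "B \<equiv> word_range m W"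
abbreviation r where "r \<equiv> num_stages m T"

text \<open>Indices, offsets and other scalars are kept in range through this half of the maximum,
  packed words through \<open>word_less_B\<close>.\<close>

lemma less_B: "x < 4 * (m + W) \<Longrightarrow> x < B"
  by (simp add: word_range_def)

lemma small_less_B: "x < 8 \<Longrightarrow> x < B"
  using m_pos W_pos by (intro less_B) simp

lemma word_less_B: "x < 2 ^ W \<Longrightarrow> x < B"
  by (simp add: word_range_def)

lemma mod_W_less_B: "k mod W < B"
proof -
  have "k mod W < W"
    using W_pos by simp
  also have "W \<le> 4 * (m + W)"
    by simp
  finally show ?thesis
    by (rule less_B)
qed

lemma n_pos: "n \<ge> 1"
  using less_num_words_iff[OF W_pos, of 0 m] m_pos by simp

lemma n_le_m: "n \<le> m"
  by (rule num_words_le[OF W_pos])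

lemma n_less_B: "n < B"
  using n_le_m m_pos by (intro less_B) simp

lemma length_T_le: "length T \<le> m"
proof -
  have "length T = card (set T)"
    using support by (simp add: valid_support_def strict_sorted_iff distinct_card)
  also have "\<dots> \<le> m"
    using support card_mono[of "{..<m}" "set T"] by (simp add: valid_support_def)
  finally show ?thesis .
qed

lemma length_T_less_B: "length T < B"
  using length_T_le m_pos by (intro less_B) simp

lemma nth_T_less: "j < length T \<Longrightarrow> T ! j < m"
  using support by (metis lessThan_iff nth_mem subsetD valid_support_def)

lemma word_beyond:
  assumes "degree y < m" and "n \<le> i"
  shows "word W y i = 0"
proof (rule word_eq_0)
  fix k assume "i * W \<le> k"
  moreover have "m \<le> i * W"
    using assms(2) W_pos by (simp add: num_words_le_iff)
  ultimately show "coeff y k = 0"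
    using assms(1) by (simp add: coeff_eq_0)
qed

lemma runs_count_words:
  assumes "regs st Rm = m" and "regs st Rw = W"
  shows "runs W B count_words st (\<lambda>t g s. t = 8 \<and> g = 0 \<and> preserves {Rn} {} st s \<and> regs s Rn = n)"
proof -
  have "m + W < B" "m + W - Suc 0 < B" "Suc 0 < B" "(m + W - Suc 0) div W < B"
    using m_pos W_pos less_B[of "m + W"] small_less_B[of 1]
    by (auto intro: le_less_trans[OF div_le_dividend])
  with assms W_pos show ?thesis
    by (simp add: count_words_def runs_simps preserves_def num_words_eq)
qed

text \<open>36 operations per word for the address computation, the first read, the test and the
  store, and 11 more if the adjacent input word exists. The value depends on \<open>m\<close> and
  \<open>W\<close> alone, so it is common to the online and the planned program.\<close>

definition load_cost :: nat where
  "load_cost = 6 + (\<Sum>i<n. (36 +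
     (if (m + i * W) div W + 1 < num_words W (2 * m) then 11 else 0)) + 8)"

lemma runs_load_high:
  assumes regs: "regs st Rm = m" "regs st Rw = W" "regs st Rn = n"
    and input: "len st Input = num_words W (2 * m)"
      "packs W (num_words W (2 * m)) (mem st Input) A"
    and A: "degree A < 2 * m"
    and len: "n \<le> len st State"
  shows "runs W B load_high st (\<lambda>t g s. t = load_cost \<and> g = 0 \<and>
    preserves {Ri, Rd, Rq, Rb, Racc} {State} st s \<and>
    (\<forall>i<n. mem s State i = word W (poly_shift m A) i))"
  unfolding load_high_def
proof (rule runs_for_below[where N = n and
      I = "\<lambda>i s. preserves {Ri, Rd, Rq, Rb, Racc} {State} st s \<and>
        (\<forall>i'<i. mem s State i' = word W (poly_shift m A) i')" and
      \<tau> = "\<lambda>i. 36 + (if (m + i * W) div W + 1 < num_words W (2 * m) then 11 else 0)"])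
  fix i s
  assume i: "i < n" and
    I: "preserves {Ri, Rd, Rq, Rb, Racc} {State} st s \<and>
      (\<forall>i'<i. mem s State i' = word W (poly_shift m A) i')" and Ri: "regs s Ri = i"
  define q where "q = i + m div W"
  have iW: "i * W < m"
    using i W_pos by (simp add: less_num_words_iff)
  have q: "(m + i * W) div W = q" "(m + i * W) mod W = m mod W"
    using W_pos by (simp_all add: q_def)
  have qW: "q * W < 2 * m"
    using add_less_le_mono[OF iW div_times_less_eq_dividend[of m W]]
    by (simp only: q_def distrib_right mult_2)
  then have qN: "q < num_words W (2 * m)"
    using W_pos by (simp add: less_num_words_iff)
  have q_le: "q < 2 * m"
    using qN num_words_le[OF W_pos, of "2 * m"] by simp
  have N: "(m + m + W - Suc 0) div W = num_words W (2 * m)"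
    using W_pos by (simp add: num_words_eq mult_2)
  have m2: "num_words W (2 * m) \<le> 2 * m"
    by (rule num_words_le[OF W_pos])
  have mem: "mem s Input k = word W A k" if "k < num_words W (2 * m)" for k
    using I input(2) that by (simp add: preserves_def packs_iff_word)
  \<comment> \<open>The input has no sentinel, so its last word is followed by a guarded read.
    Skipping that read is correct since \<open>A\<close> has no coefficients from
    \<open>2 * m\<close> on.\<close>
  have A0: "word W A (Suc q) = 0" if "\<not> Suc q < num_words W (2 * m)"
  proof (rule word_eq_0)
    fix k assume "Suc q * W \<le> k"
    moreover have "2 * m \<le> Suc q * W"
      using that W_pos num_words_le_iff[of W "2 * m" "Suc q"] by simp
    ultimately show "coeff A k = 0"
      using A by (intro coeff_eq_0) simp
  qed
  have bounds: "m + i * W < B" "i * W < B" "q < B" "m mod W < B" "Suc 0 < B" "Suc q < B"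
    "W < B" "W - m mod W < B" "m + m < B" "m + m + W < B" "m + m + W - Suc 0 < B"
    "num_words W (2 * m) < B"
    using iW q_le m2 W_pos m_pos mod_W_less_B by (auto intro!: less_B)
  have words: "drop_bit k (word W A i) < 2 ^ W" "take_bit W k < 2 ^ W" for k i
    by (simp_all add: drop_bit_less)
  have i_len: "i < len st State"
    using i len by simp
  show "runs W B
     (Rd ::= Reg Rm [+] Reg Ri [*] Reg Rw ;;
      Rq ::= Reg Rd [div] Reg Rw ;;
      Rb ::= Reg Rd [mod] Reg Rw ;;
      Racc ::= Load Input (Reg Rq) [shr] Reg Rb ;;
      If (Reg Rq [+] Const 1 [<] (Reg Rm [+] Reg Rm [+] Reg Rw [-] Const 1) [div] Reg Rw)
        (Racc ::= Reg Racc
           [xor] (Load Input (Reg Rq [+] Const 1) [shl] (Reg Rw [-] Reg Rb)))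
        Skip ;;
      Store State (Reg Ri) (Reg Racc)) s
     (\<lambda>t g s'. t = 36 + (if (m + i * W) div W + 1 < num_words W (2 * m) then 11 else 0) \<and>
       g = 0 \<and> regs s' Ri = i \<and> regs s' Rn = n \<and>
       preserves {Ri, Rd, Rq, Rb, Racc} {State} st (s'\<lparr>regs := (regs s')(Ri := Suc i)\<rparr>) \<and>
       (\<forall>i'<Suc i. mem (s'\<lparr>regs := (regs s')(Ri := Suc i)\<rparr>) State i' =
          word W (poly_shift m A) i'))"
    using I i_len Ri qN regs input(1) mem A0
    by (auto simp: runs_simps preserves_def packed_regions_def q N bounds words xor_less word_less_B
        word_poly_shift[OF W_pos] q_def[symmetric] less_Suc_eq)
qed (use assms n_less_B small_less_B in \<open>auto simp: preserves_def load_cost_def\<close>)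

text \<open>The source of the shifts enters only through \<open>ops shift\<close>, and
  \<open>\<alpha> q\<close> is the cost of treating the word after \<open>q\<close>. The 12 are 3
  for reading, 3 for storing and 6 for the inner loop; the 15 cover the split of a shift into
  \<open>q\<close> and \<open>b\<close> and the test, the 7 the first read.\<close>

definition stage_cost :: "exp \<Rightarrow> (nat \<Rightarrow> nat) \<Rightarrow> nat list \<Rightarrow> nat" where
  "stage_cost shift \<alpha> ds = 6 + (\<Sum>i<n. (12 + (\<Sum>j<length ds. (ops shift + 15 +
     (let q = i + ds ! j div W in if q < n then 7 + \<alpha> q else 0)) + 8)) + 8)"

abbreviation stage_regs :: "reg set" where
  "stage_regs \<equiv> {Ri, Rj, Rd, Rq, Rb, Racc}"

text \<open>Shift source and adjacent read are parameters, so one proof serves all three reductions.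
  The assumption on \<open>adjacent\<close> asks it to act as if word \<open>n\<close> were zero,
  whether by a guard or by a sentinel. The conclusion also covers the cells from \<open>n\<close>
  on, which keeps a sentinel intact.\<close>

lemma runs_apply_stage:
  assumes regs: "regs st Rw = W" "regs st Rn = n" "regs st Rlen = length ds"
    and len: "n \<le> len st State" "length ds < B"
    and y: "degree y < m" and state: "\<And>i. i < n \<Longrightarrow> mem st State i = word W y i"
    and ds: "\<And>d. d \<in> set ds \<Longrightarrow> d < m"
    and shift: "\<And>s. preserves stage_regs {State} st s \<Longrightarrow> regs s Rj < length ds \<Longrightarrow>
      safe W B shift s \<and> val W shift s = ds ! regs s Rj"
    and adjacent: "\<And>s. preserves stage_regs {State} st s \<Longrightarrow>
      mem s State n = mem st State n \<Longrightarrow> regs s Rq < n \<Longrightarrow> regs s Racc < 2 ^ W \<Longrightarrow>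
      runs W B adjacent s (\<lambda>t g s'. t = \<alpha> (regs s Rq) \<and> g = 0 \<and>
        s' = s\<lparr>regs := (regs s)(Racc := regs s Racc XOR take_bit W (push_bit (W - regs s Rb)
          (if regs s Rq + 1 < n then mem s State (regs s Rq + 1) else 0)))\<rparr>)"
  shows "runs W B (apply_stage shift adjacent) st (\<lambda>t g s. t = stage_cost shift \<alpha> ds \<and> g = 0 \<and>
    preserves stage_regs {State} st s \<and>
    (\<forall>i. mem s State i = (if i < n then word W (y + (\<Sum>j<length ds. poly_shift (ds ! j) y)) i
       else mem st State i)))"
  unfolding apply_stage_def
proof (rule runs_for_below[where N = n and
      I = "\<lambda>i s. preserves stage_regs {State} st s \<and>
        (\<forall>i'. mem s State i' =
          (if i' < i then word W (y + (\<Sum>j<length ds. poly_shift (ds ! j) y)) i'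
           else mem st State i'))" and
      \<tau> = "\<lambda>i. 12 + (\<Sum>j<length ds. (ops shift + 15 +
     (let q = i + ds ! j div W in if q < n then 7 + \<alpha> q else 0)) + 8)"])
  fix i s
  \<comment> \<open>The invariant of the inner loop: after \<open>j\<close> shifts the accumulator
    holds word \<open>i\<close> of this partial sum.\<close>
  define z where "z j = y + (\<Sum>j<j. poly_shift (ds ! j) y)" for j
  assume i: "i < n" and Ri: "regs s Ri = i" and
    I: "preserves stage_regs {State} st s \<and>
        (\<forall>i'. mem s State i' =
          (if i' < i then word W (y + (\<Sum>j<length ds. poly_shift (ds ! j) y)) i'
           else mem st State i'))"
  \<comment> \<open>The words from \<open>i\<close> on are still those of the stage input, so all
    shifts read the same \<open>y\<close> although the array is being overwritten.\<close>
  have mem: "mem s State k = word W y k" if "i \<le> k" "k < n" for k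
    using that I state by simp
  have mem_n: "mem s State n = mem st State n"
    using I i by simp
  have i_len: "i < len st State"
    using i len by simp
  define body where "body = (Rd ::= shift ;;
         Rq ::= Reg Ri [+] Reg Rd [div] Reg Rw ;;
         Rb ::= Reg Rd [mod] Reg Rw ;;
         If (Reg Rq [<] Reg Rn)
           (Racc ::= Reg Racc [xor] (Load State (Reg Rq) [shr] Reg Rb) ;; adjacent)
           Skip)"
  have inner: "runs W B (for_below Rj (Reg Rlen) body) s' (\<lambda>t g s''.
      t = 6 + (\<Sum>j<length ds. (ops shift + 15 +
        (let q = i + ds ! j div W in if q < n then 7 + \<alpha> q else 0)) + 8) \<and> g = 0 \<and>
      preserves (stage_regs - {Ri}) {} s' s'' \<and> regs s'' Racc = word W (z (length ds)) i)"
    if s': "preserves stage_regs {} s s'" "regs s' Ri = i" "regs s' Racc = word W y i" for s'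
  proof (rule runs_for_below[where N = "length ds" and
        I = "\<lambda>j s''. preserves (stage_regs - {Ri}) {} s' s'' \<and> regs s'' Racc = word W (z j) i"
        and \<tau> = "\<lambda>j. ops shift + 15 + (let q = i + ds ! j div W in if q < n then 7 + \<alpha> q else 0)"])
    fix j u
    assume j: "j < length ds" and Rj: "regs u Rj = j" and
      J: "preserves (stage_regs - {Ri}) {} s' u \<and> regs u Racc = word W (z j) i"
    define d where "d = ds ! j"
    define q where "q = i + d div W"
    have d: "d < m"
      using ds j by (simp add: d_def)
    have u: "preserves stage_regs {} s u"
      using preserves_trans[OF s'(1) J[THEN conjunct1]] by (simp add: insert_absorb insert_commute)
    then have st_u: "preserves stage_regs {State} st u"
      using preserves_trans[OF I[THEN conjunct1] u] by simp
    have Ri_u: "regs u Ri = i"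
      using J s'(2) by (simp add: preserves_def)
    have mem_u: "mem u State k = word W y k" if "i \<le> k" "k < n" for k
      using u mem that by (simp add: preserves_def)
    have z: "word W (z (Suc j)) i = word W (z j) i XOR (drop_bit (d mod W) (word W y q) XOR
        take_bit W (push_bit (W - d mod W) (word W y (q + 1))))"
      unfolding word_poly_shift[OF W_pos, of d y i, folded q_def, symmetric]
      by (simp add: z_def word_add d_def xor.assoc add.assoc[symmetric])
    have sh: "safe W B shift u" "val W shift u = d"
      using shift[OF st_u] Rj j by (auto simp: d_def)
    have "d div W < m"
      using d by (meson div_le_dividend le_less_trans)
    then have bounds: "q < B" "d div W < B" "d mod W < B" "Suc 0 < B" "0 < B"
      using i n_le_m m_pos W_pos mod_W_less_B
      by (auto intro!: less_B simp: q_def)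
    have Rlen_u: "regs u Rlen = length ds"
      using st_u regs by (simp add: preserves_def)
    have st_regs: "regs u Rw = W" "regs u Rn = n" "n \<le> len u State"
      using st_u regs len by (auto simp: preserves_def)
    show "runs W B body u (\<lambda>t g s''.
        t = ops shift + 15 + (let q = i + ds ! j div W in if q < n then 7 + \<alpha> q else 0) \<and>
        g = 0 \<and> regs s'' Rj = j \<and> regs s'' Rlen = length ds \<and>
        preserves (stage_regs - {Ri}) {} s' (s''\<lparr>regs := (regs s'')(Rj := Suc j)\<rparr>) \<and>
        regs (s''\<lparr>regs := (regs s'')(Rj := Suc j)\<rparr>) Racc = word W (z (Suc j)) i)"
    proof (cases "q < n")
      case False
      \<comment> \<open>Both words touched by the shift lie at index \<open>n\<close> or later and
        are zero, since \<open>y\<close> has degree below \<open>m\<close>.\<close>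
      then have "word W (z (Suc j)) i = word W (z j) i"
        using y by (simp add: z word_beyond)
      moreover have "runs W B body u Q \<longleftrightarrow> Q (ops shift + 15) 0
          (u\<lparr>regs := (regs u)(Rd := d, Rq := q, Rb := d mod W)\<rparr>)" for Q
        using False by (simp add: body_def runs_simps sh Ri_u st_regs bounds q_def[symmetric]
            numeral_eq_Suc)
      ultimately show ?thesis
        using False J Rj Rlen_u by (simp add: d_def[symmetric] q_def[symmetric] preserves_def)
    next
      case True
      define u' where "u' = u\<lparr>regs := (regs u)(Rd := d, Rq := q, Rb := d mod W,
          Racc := word W (z j) i XOR drop_bit (d mod W) (word W y q))\<rparr>"
      have "preserves stage_regs {State} st u'"
        using st_u by (simp add: u'_def preserves_def)
      moreover have "mem u' State n = mem st State n"
        using u mem_n by (simp add: u'_def preserves_def)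
      moreover have "regs u' Rq < n"
        using True by (simp add: u'_def)
      moreover have "regs u' Racc < 2 ^ W"
        by (simp add: u'_def xor_less drop_bit_less)
      ultimately have adj: "runs W B adjacent u' (\<lambda>t g s'. t = \<alpha> (regs u' Rq) \<and> g = 0 \<and>
        s' = u'\<lparr>regs := (regs u')(Racc := regs u' Racc XOR take_bit W (push_bit (W - regs u' Rb)
          (if regs u' Rq + 1 < n then mem u' State (regs u' Rq + 1) else 0)))\<rparr>)"
        by (rule adjacent)
      have next_word: "(if q + 1 < n then mem u State (q + 1) else 0) = word W y (q + 1)"
        using mem_u[of "q + 1"] y by (auto simp: word_beyond q_def)
      have mem_q: "mem u State q = word W y q"
        using mem_u True by (simp add: q_def)
      have less: "word W (z j) i XOR drop_bit (d mod W) (word W y q) < B"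
        "drop_bit (d mod W) (word W y q) < B"
        by (simp_all add: word_less_B xor_less drop_bit_less)
      have step: "runs W B body u Q \<longleftrightarrow>
          runs W B adjacent u' (\<lambda>t g s. Q (ops shift + 22 + t) g s)" for Q
        using True less_le_trans[OF True st_regs(3)]
        by (simp add: body_def runs_simps sh Ri_u st_regs J bounds q_def[symmetric] mem_q less u'_def
            numeral_eq_Suc)
      have "runs W B body u (\<lambda>t g s''. t = ops shift + 15 + (7 + \<alpha> q) \<and> g = 0 \<and>
          s'' = u'\<lparr>regs := (regs u')(Racc := word W (z (Suc j)) i)\<rparr>)"
        unfolding step using adj
      proof (rule runs_mono)
        fix t g s''
        assume h: "t = \<alpha> (regs u' Rq) \<and> g = 0 \<and>
          s'' = u'\<lparr>regs := (regs u')(Racc := regs u' Racc XOR take_bit W (push_bit (W - regs u' Rb)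
            (if regs u' Rq + 1 < n then mem u' State (regs u' Rq + 1) else 0)))\<rparr>"
        have e: "regs u' Rq = q" "regs u' Rb = d mod W" "mem u' = mem u"
          "regs u' Racc = word W (z j) i XOR drop_bit (d mod W) (word W y q)"
          by (simp_all add: u'_def)
        show "ops shift + 22 + t = ops shift + 15 + (7 + \<alpha> q) \<and> g = 0 \<and>
            s'' = u'\<lparr>regs := (regs u')(Racc := word W (z (Suc j)) i)\<rparr>"
          using h[unfolded e next_word] by (simp add: z xor.assoc)
      qed
      then show ?thesis
        by (rule runs_mono)
          (use True J Rj Rlen_u in \<open>simp add: u'_def preserves_def d_def[symmetric] q_def[symmetric]\<close>)
    qed
  qed (use that regs I len small_less_B in \<open>auto simp: preserves_def z_def\<close>)
  have w: "word W y i < B" "word W (z (length ds)) i < B"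
    by (simp_all add: word_less_B)
  show "runs W B
     (Racc ::= Load State (Reg Ri) ;;
      for_below Rj (Reg Rlen) body ;;
      Store State (Reg Ri) (Reg Racc)) s
     (\<lambda>t g s'. t = 12 + (\<Sum>j<length ds. (ops shift + 15 +
     (let q = i + ds ! j div W in if q < n then 7 + \<alpha> q else 0)) + 8) \<and> g = 0 \<and>
       regs s' Ri = i \<and> regs s' Rn = n \<and>
       preserves stage_regs {State} st (s'\<lparr>regs := (regs s')(Ri := Suc i)\<rparr>) \<and>
       (\<forall>i'. mem (s'\<lparr>regs := (regs s')(Ri := Suc i)\<rparr>) State i' =
          (if i' < Suc i then word W (y + (\<Sum>j<length ds. poly_shift (ds ! j) y)) i'
           else mem st State i')))"
    unfolding runs_Seq runs_Assign
  proof (intro conjI, goal_cases)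
    case 1
    show ?case
      using I Ri i_len by (simp add: preserves_def)
  next
    case 2
    define s' where "s' = s\<lparr>regs := (regs s)(Racc := val W (Load State (Reg Ri)) s)\<rparr>"
    have "preserves stage_regs {} s s'" "regs s' Ri = i" "regs s' Racc = word W y i"
      using Ri i mem by (simp_all add: s'_def preserves_def)
    note inner[OF this]
    then show ?case
      unfolding s'_def[symmetric]
    proof (rule runs_mono)
      fix t g :: nat and u
      assume u: "t = 6 + (\<Sum>j<length ds. (ops shift + 15 +
          (let q = i + ds ! j div W in if q < n then 7 + \<alpha> q else 0)) + 8) \<and> g = 0 \<and>
        preserves (stage_regs - {Ri}) {} s' u \<and> regs u Racc = word W (z (length ds)) i"
      have p: "preserves stage_regs {State} st s'"
        using I by (simp add: s'_def preserves_def)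
      have mem_u: "mem u State = mem s State" "regs u Ri = i"
        using u Ri by (simp_all add: preserves_def s'_def)
      show "runs W B (Store State (Reg Ri) (Reg Racc)) u (\<lambda>t2 g2 s'.
          ops (Load State (Reg Ri)) + 1 + (t + t2) = 12 + (\<Sum>j<length ds. (ops shift + 15 +
            (let q = i + ds ! j div W in if q < n then 7 + \<alpha> q else 0)) + 8) \<and> 0 + (g + g2) = 0 \<and>
          regs s' Ri = i \<and> regs s' Rn = n \<and>
          preserves stage_regs {State} st (s'\<lparr>regs := (regs s')(Ri := Suc i)\<rparr>) \<and>
          (\<forall>i'. mem (s'\<lparr>regs := (regs s')(Ri := Suc i)\<rparr>) State i' =
            (if i' < Suc i then word W (y + (\<Sum>j<length ds. poly_shift (ds ! j) y)) i'
             else mem st State i')))"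
        using u p mem_u i_len regs I
        by (auto simp: runs_simps preserves_def less_Suc_eq z_def packed_regions_def)
    qed
  qed
qed (use assms n_less_B small_less_B in \<open>auto simp: preserves_def stage_cost_def\<close>)

text \<open>18 operations per word for the read, the masked store and the inner loop, 21 per tap,
  and 9 and 13 for the two conditional reads. The region holding the exponents does not matter, so
  reading \<open>Taps\<close> or \<open>Assembly\<close> costs the same.\<close>

definition assemble_cost :: nat where
  "assemble_cost = 6 + (\<Sum>i<n. (18 + (\<Sum>j<length T. (21 +
     (if T ! j div W \<le> i then 9 else 0) + (if T ! j div W < i then 13 else 0)) + 8)) + 8)"

text \<open>The last input word may contain coefficients beyond \<open>m\<close>, and so may the
  products \<open>x^t * Y\<close>. Since the cutoff is additive, a single mask before the store
  removes both, and no term has to be reduced on its own.\<close>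

lemma runs_assemble:
  assumes regs: "regs st Rm = m" "regs st Rw = W" "regs st Rn = n" "regs st Rs = length T"
    and len: "n \<le> len st Input" "n \<le> len st State" "n \<le> len st Output" "length T \<le> len st a"
    and input: "\<And>i. i < n \<Longrightarrow> mem st Input i = word W A i"
    and state: "\<And>i. i < n \<Longrightarrow> mem st State i = word W Y i"
    and taps: "\<And>j. j < length T \<Longrightarrow> mem st a j = T ! j" and a: "a \<noteq> Output"
  shows "runs W B (assemble a) st (\<lambda>t g s. t = assemble_cost \<and> g = 0 \<and>
    preserves {Ri, Rj, Rd, Rq, Rb, Racc} {Output} st s \<and>
    (\<forall>i<n. mem s Output i =
       word W (poly_cutoff m (A + (\<Sum>j<length T. monom 1 (T ! j) * Y))) i))"
  unfolding assemble_def
proof (rule runs_for_below[where N = n and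
      I = "\<lambda>i s. preserves {Ri, Rj, Rd, Rq, Rb, Racc} {Output} st s \<and>
        (\<forall>i'<i. mem s Output i' =
           word W (poly_cutoff m (A + (\<Sum>j<length T. monom 1 (T ! j) * Y))) i')" and
      \<tau> = "\<lambda>i. 18 + (\<Sum>j<length T. (21 +
     (if T ! j div W \<le> i then 9 else 0) + (if T ! j div W < i then 13 else 0)) + 8)"])
  fix i s
  define z where "z j = A + (\<Sum>j<j. monom 1 (T ! j) * Y)" for j
  assume i: "i < n" and Ri: "regs s Ri = i" and
    I: "preserves {Ri, Rj, Rd, Rq, Rb, Racc} {Output} st s \<and>
        (\<forall>i'<i. mem s Output i' =
           word W (poly_cutoff m (A + (\<Sum>j<length T. monom 1 (T ! j) * Y))) i')"
  have iW: "i * W < m"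
    using i W_pos by (simp add: less_num_words_iff)
  have i_bounds: "i < B" "Suc i < B" "i * W < B" "m - i * W < B" "Suc 0 < B" "0 < B" "W < B"
    using i n_le_m iW W_pos by (auto intro!: less_B)
  have i_len: "i < len st Input" "i < len st Output" "i < len st State"
    using i len by simp_all
  define body where "body = (Rd ::= Load a (Reg Rj) ;;
         Rq ::= Reg Rd [div] Reg Rw ;;
         Rb ::= Reg Rd [mod] Reg Rw ;;
         If (Reg Rq [<] Reg Ri [+] Const 1)
           (Racc ::= Reg Racc [xor] (Load State (Reg Ri [-] Reg Rq) [shl] Reg Rb))
           Skip ;;
         If (Reg Rq [<] Reg Ri)
           (Racc ::= Reg Racc
              [xor] (Load State (Reg Ri [-] Reg Rq [-] Const 1) [shr] (Reg Rw [-] Reg Rb)))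
           Skip)"
  have inner: "runs W B (for_below Rj (Reg Rs) body) s' (\<lambda>t g s''.
      t = 6 + (\<Sum>j<length T. (21 + (if T ! j div W \<le> i then 9 else 0) +
        (if T ! j div W < i then 13 else 0)) + 8) \<and> g = 0 \<and>
      preserves {Rj, Rd, Rq, Rb, Racc} {} s' s'' \<and> regs s'' Racc = word W (z (length T)) i)"
    if s': "preserves {Ri, Rj, Rd, Rq, Rb, Racc} {} s s'" "regs s' Ri = i"
      "regs s' Racc = word W A i" for s'
  proof (rule runs_for_below[where N = "length T" and
        I = "\<lambda>j s''. preserves {Rj, Rd, Rq, Rb, Racc} {} s' s'' \<and> regs s'' Racc = word W (z j) i"
        and \<tau> = "\<lambda>j. 21 + (if T ! j div W \<le> i then 9 else 0) + (if T ! j div W < i then 13 else 0)"])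
    fix j u
    assume j: "j < length T" and Rj: "regs u Rj = j" and Rs: "regs u Rs = length T" and
      J: "preserves {Rj, Rd, Rq, Rb, Racc} {} s' u \<and> regs u Racc = word W (z j) i"
    define d where "d = T ! j"
    define q where "q = d div W"
    have Racc: "regs u Racc = word W (z j) i"
      using J by simp
    have u: "regs u Rm = m" "regs u Rw = W" "regs u Ri = i" "mem u State = mem st State"
      "mem u a j = d" "len u = len st"
      using I J s' regs a taps[OF j] by (simp_all add: preserves_def d_def)
    have z: "word W (z (Suc j)) i = word W (z j) i XOR
        ((if q \<le> i then take_bit W (push_bit (d mod W) (word W Y (i - q))) else 0) XOR
         (if q < i then drop_bit (W - d mod W) (word W Y (i - q - 1)) else 0))"
      unfolding word_monom_mult[OF W_pos, of d Y i, folded q_def, symmetric]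
      by (simp add: z_def word_add d_def add.assoc[symmetric])
    have "q \<le> d" "d < m"
      using nth_T_less[OF j] by (simp_all add: q_def d_def)
    then have bounds: "q < B" "d mod W < B" "W - d mod W < B"
      "i - q < B" "i - Suc q < B"
      using i n_le_m m_pos W_pos mod_W_less_B by (auto intro!: less_B)
    have words: "drop_bit k (word W Y k') < B" "take_bit W k < B"
       "word W p k' XOR take_bit W k < B" "word W p k' XOR drop_bit k (word W Y k'') < B"
       "word W p k' XOR take_bit W k XOR drop_bit l (word W Y k'') < B" for k k' k'' l p
      by (simp_all add: word_less_B drop_bit_less xor_less)
    have mem_u: "mem st State k = word W Y k" "k < len st State" if "k \<le> i" for k
      using that i len state by auto
    have j_len: "j < len st a"
      using j len by simp
    have "runs W B body u (\<lambda>t g s''.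
        t = 21 + (if q \<le> i then 9 else 0) + (if q < i then 13 else 0) \<and>
        g = 0 \<and> s'' = u\<lparr>regs := (regs u)(Rd := d, Rq := q, Rb := d mod W,
          Racc := word W (z (Suc j)) i)\<rparr>)"
    proof -
      \<comment> \<open>The cases decide which of the two conditional reads take place: none, the
        first only, or both.\<close>
      consider "i < q" | "i = q" | "q < i" by linarith
      then show ?thesis
      proof cases
        case 1
        then show ?thesis
          by (simp add: body_def runs_simps u Rj j_len bounds i_bounds q_def[symmetric] z Racc)
            (simp add: Racc[symmetric] fun_upd_idem)
      next
        case 2
        show ?thesis
          by (simp add: 2[symmetric] body_def runs_simps u Rj j_len bounds i_bounds q_def[symmetric] z Racc
              mem_u words)
      next
        case 3
        then show ?thesis
          by (simp add: body_def runs_simps u Rj j_len bounds i_bounds q_def[symmetric] z Racc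
              mem_u words xor.assoc)
      qed
    qed
    then show "runs W B body u (\<lambda>t g s''.
        t = 21 + (if T ! j div W \<le> i then 9 else 0) + (if T ! j div W < i then 13 else 0) \<and>
        g = 0 \<and> regs s'' Rj = j \<and> regs s'' Rs = length T \<and>
        preserves {Rj, Rd, Rq, Rb, Racc} {} s' (s''\<lparr>regs := (regs s'')(Rj := Suc j)\<rparr>) \<and>
        regs (s''\<lparr>regs := (regs s'')(Rj := Suc j)\<rparr>) Racc = word W (z (Suc j)) i)"
      by (rule runs_mono)
        (use J Rj Rs in \<open>simp add: preserves_def d_def[symmetric] q_def[symmetric]\<close>)
  qed (use that regs I length_T_less_B small_less_B in \<open>auto simp: preserves_def z_def\<close>)
  have w: "word W (z (length T)) i < B" "take_bit k (word W (z (length T)) i) < 2 ^ W"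
    "take_bit k (word W (z (length T)) i) < B" for k
    using le_less_trans[OF take_bit_nat_less_eq_self, of "word W (z (length T)) i" "2 ^ W" k]
    by (simp_all add: word_less_B)
  show "runs W B
     (Racc ::= Load Input (Reg Ri) ;;
      for_below Rj (Reg Rs) body ;;
      Store Output (Reg Ri) (Reg Racc [low] (Reg Rm [-] Reg Ri [*] Reg Rw))) s
     (\<lambda>t g s'. t = 18 + (\<Sum>j<length T. (21 +
     (if T ! j div W \<le> i then 9 else 0) + (if T ! j div W < i then 13 else 0)) + 8) \<and> g = 0 \<and>
       regs s' Ri = i \<and> regs s' Rn = n \<and>
       preserves {Ri, Rj, Rd, Rq, Rb, Racc} {Output} st (s'\<lparr>regs := (regs s')(Ri := Suc i)\<rparr>) \<and>
       (\<forall>i'<Suc i. mem (s'\<lparr>regs := (regs s')(Ri := Suc i)\<rparr>) Output i' =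
           word W (poly_cutoff m (A + (\<Sum>j<length T. monom 1 (T ! j) * Y))) i'))"
    unfolding runs_Seq runs_Assign
  proof (intro conjI, goal_cases)
    case 1
    show ?case
      using I Ri i_len by (simp add: preserves_def)
  next
    case 2
    define s' where "s' = s\<lparr>regs := (regs s)(Racc := val W (Load Input (Reg Ri)) s)\<rparr>"
    have "preserves {Ri, Rj, Rd, Rq, Rb, Racc} {} s s'" "regs s' Ri = i" "regs s' Racc = word W A i"
      using Ri i input I by (simp_all add: s'_def preserves_def)
    note inner[OF this]
    then show ?case
      unfolding s'_def[symmetric]
    proof (rule runs_mono)
      fix t g :: nat and u
      assume u: "t = 6 + (\<Sum>j<length T. (21 + (if T ! j div W \<le> i then 9 else 0) +
          (if T ! j div W < i then 13 else 0)) + 8) \<and> g = 0 \<and>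
        preserves {Rj, Rd, Rq, Rb, Racc} {} s' u \<and> regs u Racc = word W (z (length T)) i"
      have p: "preserves {Ri, Rj, Rd, Rq, Rb, Racc} {Output} st s'"
        using I by (simp add: s'_def preserves_def)
      have u_eqs: "mem u Output = mem s Output" "regs u Ri = i" "regs u Rm = m" "regs u Rw = W"
        "regs u Rn = n" "len u = len st" "regs u Racc = word W (z (length T)) i"
        using u p Ri regs by (simp_all add: preserves_def s'_def)
      have "runs W B (Store Output (Reg Ri) (Reg Racc [low] (Reg Rm [-] Reg Ri [*] Reg Rw))) u
          (\<lambda>t2 g2 s'. t2 = 9 \<and> g2 = 0 \<and> s' = u\<lparr>mem := (mem u)(Output := (mem u Output)(i :=
             word W (poly_cutoff m (A + (\<Sum>j<length T. monom 1 (T ! j) * Y))) i))\<rparr>)"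
        using i_len by (simp add: runs_simps u_eqs w i_bounds) (simp add: take_bit_word z_def)
      then show "runs W B (Store Output (Reg Ri) (Reg Racc [low] (Reg Rm [-] Reg Ri [*] Reg Rw))) u
          (\<lambda>t2 g2 s'.
          ops (Load Input (Reg Ri)) + 1 + (t + t2) = 18 + (\<Sum>j<length T. (21 +
            (if T ! j div W \<le> i then 9 else 0) + (if T ! j div W < i then 13 else 0)) + 8) \<and>
          0 + (g + g2) = 0 \<and>
          regs s' Ri = i \<and> regs s' Rn = n \<and>
          preserves {Ri, Rj, Rd, Rq, Rb, Racc} {Output} st (s'\<lparr>regs := (regs s')(Ri := Suc i)\<rparr>) \<and>
          (\<forall>i'<Suc i. mem (s'\<lparr>regs := (regs s')(Ri := Suc i)\<rparr>) Output i' =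
           word W (poly_cutoff m (A + (\<Sum>j<length T. monom 1 (T ! j) * Y))) i'))"
        by (rule runs_mono)
          (use u p I in \<open>simp add: u_eqs preserves_def less_Suc_eq s'_def\<close>)
    qed
  qed
qed (use assms n_less_B small_less_B in \<open>auto simp: preserves_def assemble_cost_def\<close>)

section \<open>The schedule of active taps\<close>

definition first_active :: "nat \<Rightarrow> nat" where
  "first_active k = length (takeWhile (\<lambda>t. \<not> 2 ^ k * (m - t) < m) T)"

text \<open>The distance \<open>m - t\<close> decreases along the sorted support, so activity is
  inherited by all later taps and the active ones form a suffix.\<close>

lemma active_drop:
  "filter (\<lambda>t. t \<in> active_taps m T k) T = drop (first_active k) T"
proof -
  have "filter (\<lambda>t. t \<in> active_taps m T k) T = filter (\<lambda>t. 2 ^ k * (m - t) < m) T"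
    by (rule filter_cong) (auto simp: active_taps_def)
  also have "\<dots> = drop (first_active k) T"
    unfolding first_active_def
  proof (rule takeWhile_filter_monotone)
    show "sorted_wrt (<) T"
      using support by (simp add: valid_support_def)
    show "2 ^ k * (m - u) < m" if "t < u" "2 ^ k * (m - t) < m" for t u
      using that by (meson diff_le_mono2 le_less_trans less_imp_le mult_le_mono2)
  qed
  finally show ?thesis .
qed

lemma first_active_le: "first_active k \<le> length T"
  by (simp add: first_active_def length_takeWhile_le)

lemma before_first_active:
  assumes "j < first_active k"
  shows "m \<le> 2 ^ k * (m - T ! j)"
proof -
  have "takeWhile (\<lambda>t. \<not> 2 ^ k * (m - t) < m) T ! j \<in>
      set (takeWhile (\<lambda>t. \<not> 2 ^ k * (m - t) < m) T)"
    using assms unfolding first_active_def by (rule nth_mem)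
  with assms show ?thesis
    by (auto simp: first_active_def takeWhile_nth dest: set_takeWhileD)
qed

lemma from_first_active:
  assumes "first_active k \<le> j" and "j < length T"
  shows "2 ^ k * (m - T ! j) < m"
proof -
  have "T ! j = drop (first_active k) T ! (j - first_active k)"
    using assms by simp
  also have "\<dots> \<in> set (drop (first_active k) T)"
    using assms by (intro nth_mem) simp
  finally have "T ! j \<in> active_taps m T k"
    by (simp flip: active_drop)
  then show ?thesis
    by (simp add: active_taps_def)
qed

lemma first_active_le_iff:
  assumes "l \<le> length T"
  shows "first_active k \<le> l \<longleftrightarrow> (\<forall>j. l \<le> j \<longrightarrow> j < length T \<longrightarrow> 2 ^ k * (m - T ! j) < m)"
proof
  assume r: "\<forall>j. l \<le> j \<longrightarrow> j < length T \<longrightarrow> 2 ^ k * (m - T ! j) < m"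
  show "first_active k \<le> l"
  proof (rule ccontr)
    assume "\<not> first_active k \<le> l"
    with r before_first_active[of l k] first_active_le[of k] show False
      by force
  qed
qed (use from_first_active in force)

lemma first_active_mono: "first_active k \<le> first_active (Suc k)"
proof -
  have "2 ^ k * (m - T ! j) < m" if "first_active (Suc k) \<le> j" "j < length T" for j
    using from_first_active[OF that] by simp
  then show ?thesis
    by (subst first_active_le_iff[OF first_active_le]) blast
qed

lemma card_active: "card (active_taps m T k) = length T - first_active k"
proof -
  have "card (active_taps m T k) = length (filter (\<lambda>t. t \<in> active_taps m T k) T)"
  proof -
    have "active_taps m T k = set (filter (\<lambda>t. t \<in> active_taps m T k) T)"
      by (auto simp: active_taps_def)
    moreover have "distinct (filter (\<lambda>t. t \<in> active_taps m T k) T)"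
      using support by (intro distinct_filter) (simp add: valid_support_def strict_sorted_iff)
    ultimately show ?thesis
      by (metis distinct_card)
  qed
  then show ?thesis
    by (simp add: active_drop)
qed

lemma stage_shifts_eq: "stage_shifts m T k = map (\<lambda>t. 2 ^ k * (m - t)) (drop (first_active k) T)"
  by (simp add: stage_shifts_def active_drop)

lemma length_stage_shifts: "length (stage_shifts m T k) = length T - first_active k"
  by (simp add: stage_shifts_eq)

lemma nth_stage_shifts:
  "j < length T - first_active k \<Longrightarrow>
    stage_shifts m T k ! j = 2 ^ k * (m - T ! (first_active k + j))"
  by (simp add: stage_shifts_eq)

lemma stage_shift_less: "d \<in> set (stage_shifts m T k) \<Longrightarrow> d < m"
  by (auto simp: stage_shifts_def active_taps_def)

lemma first_active_less_iff: "first_active k < length T \<longleftrightarrow> k < r"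
proof -
  have "first_active k < length T \<longleftrightarrow> card (active_taps m T k) \<noteq> 0"
    by (simp add: card_active not_le)
  also have "\<dots> \<longleftrightarrow> k < r"
    using active_taps_eq_empty_iff[OF m_pos support, of k] by auto
  finally show ?thesis .
qed

text \<open>A stage below \<open>r\<close> has an active tap, and its distance is at least 1. This
  bounds the register \<open>Rpow\<close>.\<close>

lemma power_less:
  assumes "k < r"
  shows "2 ^ k < m"
proof -
  have "first_active k < length T"
    using assms by (simp add: first_active_less_iff)
  from from_first_active[OF order_refl this] nth_T_less[OF this]
  show ?thesis
    by (metis le_less_trans mult_le_mono2 nat_mult_1_right Suc_leI zero_less_diff One_nat_def)
qed

text \<open>The form of the activity test in \<open>skip_inactive\<close>. For an inactive tap the
  product \<open>2 ^ k * d\<close> may leave the word range, whereas the quotient never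
  does.\<close>

lemma active_iff_le: "2 ^ k * d < m \<longleftrightarrow> d \<le> (m - 1) div 2 ^ k"
proof -
  have "2 ^ k * d < m \<longleftrightarrow> d * 2 ^ k \<le> m - 1"
    using m_pos by (auto simp: mult.commute)
  also have "\<dots> \<longleftrightarrow> d \<le> (m - 1) div 2 ^ k"
    by (simp add: less_eq_div_iff_mult_less_eq)
  finally show ?thesis .
qed

section \<open>The registers that walk through the stages\<close>

definition at_stage :: "nat \<Rightarrow> state \<Rightarrow> bool" where
  "at_stage k s \<longleftrightarrow>
     regs s Rlo = first_active k \<and> regs s Rpow = 2 ^ k \<and> regs s Rlim = (m - 1) div 2 ^ k"

lemma has_supportD:
  assumes "has_support m T W s"
  shows "regs s Rm = m" "regs s Rw = W" "regs s Rs = length T" "len s Taps = length T"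
    "\<And>j. j < length T \<Longrightarrow> mem s Taps j = T ! j"
proof -
  have c: "map (mem s Taps) [0..<len s Taps] = T"
    using assms by (simp add: has_support_def contents_def)
  then show l: "len s Taps = length T"
    by (metis length_map length_upt minus_nat.diff_0)
  show "mem s Taps j = T ! j" if "j < length T" for j
  proof -
    have "T ! j = map (mem s Taps) [0..<len s Taps] ! j"
      by (simp only: c)
    then show ?thesis
      using that l by simp
  qed
qed (use assms in \<open>simp_all add: has_support_def\<close>)

lemma has_support_preserves:
  assumes "has_support m T W s" and "preserves X R s s'" and "Rm \<notin> X" "Rw \<notin> X" "Rs \<notin> X" "Taps \<notin> R"
  shows "has_support m T W s'"
  using assms by (simp add: has_support_def preserves_def contents_def)

text \<open>A skipped tap costs 11 operations for the test and 4 for the increment, and the failing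
  test costs 11. The bound depends only on how far the position moves, so the costs of successive
  stages telescope to at most \<open>15 * length T\<close>.\<close>

lemma runs_skip_inactive:
  assumes s: "has_support m T W st" and lo: "regs st Rlo \<le> first_active k"
    and lim: "regs st Rlim = (m - 1) div 2 ^ k"
  shows "runs W B skip_inactive st (\<lambda>t g s. t = 15 * (first_active k - regs st Rlo) + 11 \<and>
    g = 0 \<and> preserves {Rlo} {} st s \<and> regs s Rlo = first_active k)"
  unfolding skip_inactive_def
proof (rule runs_While[where N = "first_active k - regs st Rlo" and
      I = "\<lambda>i t g s. t = 15 * i \<and> g = 0 \<and> preserves {Rlo} {} st s \<and> regs s Rlo = regs st Rlo + i"],
    goal_cases)
  case 1
  show ?case
    by (simp add: preserves_def)
next
  case (2 i t g s)
  define l where "l = regs st Rlo + i"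
  have l: "l < first_active k"
    using 2(1) by (simp add: l_def)
  have l': "l < length T"
    using l first_active_le[of k] by simp
  have s': "has_support m T W s"
    using has_support_preserves[OF s, of "{Rlo}" "{}" s] 2(2) by simp
  have regs: "regs s Rlo = l" "regs s Rlim = (m - 1) div 2 ^ k"
    using 2(2) lim by (simp_all add: preserves_def l_def)
  have "m - T ! l < B" "Suc l < B" "Suc 0 < B" "0 < B"
    using l' length_T_le m_pos by (auto intro!: less_B)
  moreover have "(m - 1) div 2 ^ k < m - T ! l"
    using before_first_active[OF l] active_iff_le[of k "m - T ! l"] by simp
  ultimately show ?case
    using 2(2) l' by (simp add: has_supportD[OF s'] regs runs_Assign l_def[symmetric])
      (simp add: preserves_def)
next
  case (3 t g s)
  define l where "l = first_active k"
  have s': "has_support m T W s"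
    using has_support_preserves[OF s, of "{Rlo}" "{}" s] 3 by simp
  have regs: "regs s Rlo = l" "regs s Rlim = (m - 1) div 2 ^ k"
    using 3 lim lo by (simp_all add: preserves_def l_def)
  have "m - T ! l < B" "Suc 0 < B" "0 < B"
    using m_pos by (auto intro!: less_B)
  \<comment> \<open>The scan stops at an active tap or at the end of the support; in the latter case
    \<open>AndAlso\<close> prevents the load.\<close>
  moreover have "l < length T \<Longrightarrow> m - T ! l \<le> (m - 1) div 2 ^ k"
    using from_first_active[of k l] active_iff_le[of k "m - T ! l"] by (simp add: l_def)
  ultimately show ?case
    using 3 by (auto simp: has_supportD[OF s'] regs l_def[symmetric])
qed

lemma runs_first_stage:
  assumes s: "has_support m T W st"
  shows "runs W B first_stage st (\<lambda>t g s. t = 19 + 15 * first_active 0 \<and> g = 0 \<and>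
    preserves {Rlo, Rpow, Rlim} {} st s \<and> at_stage 0 s)"
proof -
  define st' where "st' = st\<lparr>regs := (regs st)(Rlo := 0, Rpow := 1, Rlim := m - 1)\<rparr>"
  have s': "has_support m T W st'"
    using s by (simp add: st'_def has_support_def contents_def)
  have "0 < B" "Suc 0 < B" "m - Suc 0 < B"
    using m_pos by (auto intro!: less_B)
  then have "runs W B first_stage st Q \<longleftrightarrow>
      runs W B skip_inactive st' (\<lambda>t g s. Q (8 + t) g s)" for Q
    by (simp add: first_stage_def runs_simps has_supportD[OF s] st'_def numeral_eq_Suc)
  moreover have "runs W B skip_inactive st' (\<lambda>t g s.
      t = 15 * (first_active 0 - regs st' Rlo) + 11 \<and> g = 0 \<and> preserves {Rlo} {} st' s \<and>
      regs s Rlo = first_active 0)"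
    by (rule runs_skip_inactive[OF s']) (simp_all add: st'_def)
  ultimately show ?thesis
    by (auto elim!: runs_mono simp: st'_def at_stage_def preserves_def)
qed

text \<open>The hypothesis is \<open>k < r\<close> although stage \<open>k + 1\<close> may be empty:
  it gives \<open>2 ^ Suc k < 2 * m\<close>, which keeps the doubled power in range. Repeated
  halving of the limit agrees with one division by the power.\<close>

lemma runs_next_stage:
  assumes s: "has_support m T W st" and k: "at_stage k st" "k < r"
  shows "runs W B next_stage st (\<lambda>t g s.
    t = 19 + 15 * (first_active (Suc k) - first_active k) \<and> g = 0 \<and>
    preserves {Rlo, Rpow, Rlim} {} st s \<and> at_stage (Suc k) s)"
proof -
  define st' where "st' = st\<lparr>regs := (regs st)(Rpow := 2 ^ Suc k, Rlim := (m - 1) div 2 ^ Suc k)\<rparr>"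
  have s': "has_support m T W st'"
    using s by (simp add: st'_def has_support_def contents_def)
  have lim: "(m - Suc 0) div 2 ^ k div 2 = (m - Suc 0) div (2 * 2 ^ k)"
    by (metis div_mult2_eq mult.commute)
  have "(m - Suc 0) div (2 * 2 ^ k) \<le> m - Suc 0"
    by simp
  then have "2 < B" "(2::nat) ^ k + 2 ^ k < B" "2 * (2::nat) ^ k < B"
    "(m - Suc 0) div (2 * 2 ^ k) < B"
    using m_pos power_less[OF k(2)] by (auto intro!: less_B simp del: div_le_dividend)
  then have "runs W B next_stage st Q \<longleftrightarrow>
      runs W B skip_inactive st' (\<lambda>t g s. Q (8 + t) g s)" for Q
    using k(1) by (simp add: next_stage_def runs_simps at_stage_def lim st'_def mult_2
        fun_upd_twist) (simp add: numeral_eq_Suc)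
  moreover have "runs W B skip_inactive st' (\<lambda>t g s.
      t = 15 * (first_active (Suc k) - regs st' Rlo) + 11 \<and> g = 0 \<and> preserves {Rlo} {} st' s \<and>
      regs s Rlo = first_active (Suc k))"
    by (rule runs_skip_inactive[OF s'])
      (use k(1) first_active_mono in \<open>simp_all add: st'_def at_stage_def\<close>)
  ultimately show ?thesis
    using k(1) by (auto elim!: runs_mono simp: st'_def at_stage_def preserves_def)
qed

text \<open>The product is formed for active taps only, where it stays below \<open>m\<close> and
  hence within a word.\<close>

lemma tap_shift:
  assumes s: "has_support m T W st" and k: "at_stage k st" "k < r"
    and j: "regs st Rj < length (stage_shifts m T k)"
  shows "safe W B tap_shift st \<and> val W tap_shift st = stage_shifts m T k ! regs st Rj"
proof -
  define l where "l = first_active k + regs st Rj"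
  have l: "l < length T" "regs st Rj < length T - first_active k"
    using j by (simp_all add: l_def length_stage_shifts)
  have d: "2 ^ k * (m - T ! l) < m"
    using from_first_active[of k l] l by (simp add: l_def)
  have "l < B" "m - T ! l < B" "2 ^ k * (m - T ! l) < B"
    using l length_T_le m_pos d by (auto intro!: less_B)
  then show ?thesis
    using l k(1) by (simp add: has_supportD[OF s] at_stage_def l_def[symmetric]
        nth_stage_shifts mult.commute)
qed

section \<open>Positions of the stages in the flat array of shifts\<close>

definition offset :: "nat \<Rightarrow> nat" where
  "offset k = (\<Sum>i<k. length (stage_shifts m T i))"

lemma offset_simps [simp]:
  "offset 0 = 0" "offset (Suc k) = offset k + length (stage_shifts m T k)"
  by (simp_all add: offset_def)

lemma num_feedback_eq_offset: "num_feedback m T = offset r"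
  by (simp add: num_feedback_def offset_def length_stage_shifts card_active)

lemma offset_mono: "k \<le> l \<Longrightarrow> offset k \<le> offset l"
  unfolding offset_def by (rule sum_mono2) auto

text \<open>The distances of active taps are distinct positive integers bounded by the limit of the
  stage.\<close>

lemma length_stage_shifts_le: "length (stage_shifts m T k) \<le> (m - 1) div 2 ^ k"
proof -
  have "length (stage_shifts m T k) = card (active_taps m T k)"
    by (simp add: length_stage_shifts card_active)
  also have "\<dots> = card ((\<lambda>t. m - t) ` active_taps m T k)"
    using support by (intro card_image[symmetric] inj_onI)
      (auto simp: active_taps_def valid_support_def subset_iff)
  also have "\<dots> \<le> card {1..(m - 1) div 2 ^ k}"
    using support
    by (intro card_mono)
      (auto simp: active_taps_def valid_support_def active_iff_le subset_iff Suc_le_eq)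
  finally show ?thesis
    by simp
qed

text \<open>A potential argument. Let \<open>q\<close> be the limit of stage \<open>k\<close>; the
  stage adds at most \<open>q\<close> shifts, while the potential falls from \<open>2 * q\<close> to
  \<open>2 * (q div 2)\<close>, which is at most \<open>q\<close>.\<close>

lemma offset_bound: "offset k + 2 * ((m - 1) div 2 ^ k) \<le> 2 * (m - 1)"
proof (induction k)
  case (Suc k)
  have "(m - 1) div 2 ^ Suc k = (m - 1) div 2 ^ k div 2"
    by (metis div_mult2_eq mult.commute power_Suc)
  then show ?case
    using Suc length_stage_shifts_le[of k] by simp
qed simp

lemma offset_less_B: "offset k + i < B" if "i \<le> m"
  using offset_bound[of k] m_pos that by (intro less_B) simp

lemma stage_nonempty: "k < r \<Longrightarrow> 0 < length (stage_shifts m T k)"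
  using first_active_less_iff[of k] by (simp add: length_stage_shifts)

text \<open>Each stage before \<open>r\<close> has at least one shift. Thus \<open>r\<close> is
  bounded by the length of the schedule and stays in the word range without any estimate of the
  logarithm.\<close>

lemma le_offset: "k \<le> r \<Longrightarrow> k \<le> offset k"
proof (induction k)
  case (Suc k)
  then have "k \<le> offset k" "0 < length (stage_shifts m T k)"
    using stage_nonempty[of k] by simp_all
  then show ?case
    unfolding offset_simps by linarith
qed simp

lemma r_less_B: "r < B"
  using le_offset[OF order_refl] offset_less_B[of 0 r] by simp

lemma first_active_end: "first_active r = length T"
  using first_active_less_iff[of r] first_active_le[of r] by simp

lemma length_concat_stage_shifts:
  "length (concat (map (stage_shifts m T) [0..<k])) = offset k"
  by (induction k) simp_all

lemma nth_concat_stage_shifts: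
  assumes "k < l" and "j < length (stage_shifts m T k)"
  shows "concat (map (stage_shifts m T) [0..<l]) ! (offset k + j) = stage_shifts m T k ! j"
  using assms(1)
proof (induction l)
  case (Suc l)
  show ?case
  proof (cases "k = l")
    case True
    then show ?thesis
      by (simp add: nth_append length_concat_stage_shifts)
  next
    case False
    with Suc have "k < l"
      by simp
    moreover have "offset k + j < offset l"
      using offset_mono[of "Suc k" l] assms(2) \<open>k < l\<close> by simp
    ultimately show ?thesis
      using Suc by (simp add: nth_append length_concat_stage_shifts)
  qed
qed simp

lemma sum_stage_shifts:
  "(\<Sum>j<length (stage_shifts m T k). poly_shift (stage_shifts m T k ! j) y) =
    (\<Sum>t\<in>active_taps m T k. poly_shift (2 ^ k * (m - t)) y)"
proof -
  define xs where "xs = filter (\<lambda>t. t \<in> active_taps m T k) T"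
  have xs: "set xs = active_taps m T k" "distinct xs"
    using support by (auto simp: xs_def active_taps_def valid_support_def strict_sorted_iff)
  have "(\<Sum>j<length (stage_shifts m T k). poly_shift (stage_shifts m T k ! j) y) =
      (\<Sum>j<length xs. poly_shift (2 ^ k * (m - xs ! j)) y)"
    by (simp add: stage_shifts_def xs_def)
  also have "\<dots> = (\<Sum>t\<in>set xs. poly_shift (2 ^ k * (m - t)) y)"
    by (simp add: sum.distinct_set_conv_list[OF xs(2)] sum_list_sum_nth atLeast0LessThan)
  finally show ?thesis
    by (simp add: xs(1))
qed

lemma frob_state_Suc_stage_shifts:
  assumes "degree H < m"
  shows "frob_state m T H (Suc k) = frob_state m T H k +
    (\<Sum>j<length (stage_shifts m T k). poly_shift (stage_shifts m T k ! j) (frob_state m T H k))"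
  using degree_frob_state_less[OF assms, where k = k and T = T]
  by (simp add: sum_stage_shifts nil_shift_eq_poly_shift)

text \<open>The assembly adds the words of the whole input instead of those of \<open>L\<close>. The
  part \<open>x^m * H\<close> has no coefficient below \<open>m\<close> and disappears together with
  the overflow of the products.\<close>

lemma poly_cutoff_eq_frob_reduce:
  assumes "degree L < m"
  shows "poly_cutoff m (L + monom 1 m * H +
      (\<Sum>j<length T. monom 1 (T ! j) * frob_final_state m T H)) = frob_reduce m T L H"
proof -
  have "distinct T"
    using support by (simp add: valid_support_def strict_sorted_iff)
  then have "(\<Sum>t\<in>set T. monom 1 t * frob_final_state m T H) =
      (\<Sum>j<length T. monom 1 (T ! j) * frob_final_state m T H)"
    by (simp add: sum.distinct_set_conv_list sum_list_sum_nth atLeast0LessThan)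
  then show ?thesis
    using coeff_eq_0_degree_less[OF assms] unfolding frob_reduce_def low_fold_eq_poly_cutoff
    by (auto simp: poly_eq_iff coeff_poly_cutoff coeff_monom_mult simp del: add_bit_eq_xor)
qed

lemma runs_frob_stage:
  assumes "regs st Rw = W" "regs st Rn = n" "regs st Rlen = length (stage_shifts m T k)"
    and "n \<le> len st State" and H: "degree H < m"
    and "\<And>i. i < n \<Longrightarrow> mem st State i = word W (frob_state m T H k) i"
    and "\<And>s. preserves stage_regs {State} st s \<Longrightarrow> regs s Rj < length (stage_shifts m T k) \<Longrightarrow>
      safe W B shift s \<and> val W shift s = stage_shifts m T k ! regs s Rj"
    and "\<And>s. preserves stage_regs {State} st s \<Longrightarrow>
      mem s State n = mem st State n \<Longrightarrow> regs s Rq < n \<Longrightarrow> regs s Racc < 2 ^ W \<Longrightarrow>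
      runs W B adjacent s (\<lambda>t g s'. t = \<alpha> (regs s Rq) \<and> g = 0 \<and>
        s' = s\<lparr>regs := (regs s)(Racc := regs s Racc XOR take_bit W (push_bit (W - regs s Rb)
          (if regs s Rq + 1 < n then mem s State (regs s Rq + 1) else 0)))\<rparr>)"
  shows "runs W B (apply_stage shift adjacent) st (\<lambda>t g s.
    t = stage_cost shift \<alpha> (stage_shifts m T k) \<and> g = 0 \<and>
    preserves stage_regs {State} st s \<and>
    (\<forall>i<n. mem s State i = word W (frob_state m T H (Suc k)) i) \<and> mem s State n = mem st State n)"
proof -
  have "length (stage_shifts m T k) < B"
    using length_T_less_B by (simp add: length_stage_shifts)
  from runs_apply_stage[OF assms(1-4) this degree_frob_state_less[OF H] assms(6) stage_shift_less
      assms(7,8)]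
  show ?thesis
    by (rule runs_mono) (simp_all add: frob_state_Suc_stage_shifts[OF H] del: frob_state.simps)
qed

definition guarded_cost :: "nat \<Rightarrow> nat" where
  "guarded_cost q = 6 + (if q + 1 < n then 11 else 0)"

lemma runs_adjacent_word_guarded:
  assumes "regs s Rw = W" "regs s Rn = n" "n \<le> len s State" "regs s Rq < n" "regs s Racc < 2 ^ W"
  shows "runs W B adjacent_word_guarded s (\<lambda>t g s'. t = guarded_cost (regs s Rq) \<and> g = 0 \<and>
    s' = s\<lparr>regs := (regs s)(Racc := regs s Racc XOR take_bit W (push_bit (W - regs s Rb)
      (if regs s Rq + 1 < n then mem s State (regs s Rq + 1) else 0)))\<rparr>)"
proof -
  have "Suc (regs s Rq) < B" "Suc 0 < B" "0 < B" "W - regs s Rb < B"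
    using assms(4) n_le_m W_pos m_pos by (auto intro!: less_B)
  moreover have "take_bit W x < B" "regs s Racc XOR take_bit W x < B" for x
    using assms(5) by (simp_all add: word_less_B xor_less)
  \<comment> \<open>If the guard fails, the specified update is an exclusive or with zero and must
    be recognised as leaving the state unchanged.\<close>
  moreover have "s\<lparr>regs := (regs s)(Racc := regs s Racc)\<rparr> = s"
    by simp
  ultimately show ?thesis
    using assms(1-4)
    by (simp add: adjacent_word_guarded_def adjacent_word_def runs_simps guarded_cost_def
        del: fun_upd_triv)
qed

text \<open>For \<open>q = n - 1\<close> the unguarded read hits the sentinel, whose zero is the
  default value of the specification.\<close>

lemma runs_adjacent_word:
  assumes "regs s Rw = W" "n < len s State" "mem s State n = 0"
    "regs s Rq < n" "regs s Racc < 2 ^ W"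
  shows "runs W B adjacent_word s (\<lambda>t g s'. t = 11 \<and> g = 0 \<and>
    s' = s\<lparr>regs := (regs s)(Racc := regs s Racc XOR take_bit W (push_bit (W - regs s Rb)
      (if regs s Rq + 1 < n then mem s State (regs s Rq + 1) else 0)))\<rparr>)"
proof -
  have "Suc (regs s Rq) < B" "Suc 0 < B" "W - regs s Rb < B"
    using assms(4) n_le_m W_pos m_pos by (auto intro!: less_B)
  moreover have "take_bit W x < B" "regs s Racc XOR take_bit W x < B" for x
    using assms(5) by (simp_all add: word_less_B xor_less)
  moreover have "(if regs s Rq + 1 < n then mem s State (regs s Rq + 1) else 0) =
      mem s State (Suc (regs s Rq))"
  proof (cases "Suc (regs s Rq) < n")
    case False
    with assms(4) have "Suc (regs s Rq) = n"
      by simp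
    with assms(3) show ?thesis
      by simp
  qed simp
  ultimately show ?thesis
    using assms(1,2,4) by (simp add: adjacent_word_def runs_simps)
qed

section \<open>The reductions\<close>

abbreviation loop_regs :: "reg set" where
  "loop_regs \<equiv> insert Rlen (insert Rlo (insert Rpow (insert Rlim stage_regs)))"

lemma has_ioD:
  assumes "has_io m W A st"
  shows "len st Input = num_words W (2 * m)" "len st Output = n"
    "packs W (num_words W (2 * m)) (mem st Input) A"
    "\<And>i. i < n \<Longrightarrow> mem st Input i = word W A i" "n \<le> len st Input"
proof -
  have "n \<le> num_words W (2 * m)"
    by (rule num_words_mono[OF W_pos]) simp
  with assms show "\<And>i. i < n \<Longrightarrow> mem st Input i = word W A i" "n \<le> len st Input"
    by (simp_all add: has_io_def packs_iff_word)
qed (use assms in \<open>simp_all add: has_io_def\<close>)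

lemma degree_input_less:
  fixes L H :: "bit poly"
  assumes "degree L < m" and "degree H < m"
  shows "degree (L + monom 1 m * H) < 2 * m"
  using assms m_pos by (intro degree_lessI) (auto simp: coeff_monom_mult coeff_eq_0)

lemma poly_shift_input:
  fixes L H :: "bit poly"
  assumes "degree L < m"
  shows "poly_shift m (L + monom 1 m * H) = H"
  using assms by (simp add: poly_eq_iff coeff_poly_shift coeff_monom_mult coeff_eq_0)

lemma reducedI:
  assumes "\<And>i. i < n \<Longrightarrow> mem s State i = word W (frob_final_state m T H) i"
    and "\<And>i. i < n \<Longrightarrow> mem s Output i = word W (frob_reduce m T L H) i"
  shows "reduced m T W L H s"
  using assms by (simp add: reduced_def packs_iff_word)

lemma exec_load_high:
  assumes "regs st Rm = m" "regs st Rw = W" "regs st Rn = n"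
    and io: "has_io m W (L + monom 1 m * H) st" and deg: "degree L < m" "degree H < m"
    and len: "n \<le> len st State"
  obtains s where "exec W B load_high st load_cost 0 s"
    "preserves {Ri, Rd, Rq, Rb, Racc} {State} st s"
    "\<And>i. i < n \<Longrightarrow> mem s State i = word W H i"
proof (rule runsE[OF runs_load_high[OF assms(1-3) has_ioD(1,3)[OF io]
      degree_input_less[OF deg] len]])
  fix t g s
  assume "exec W B load_high st t g s" and "t = load_cost \<and> g = 0 \<and>
    preserves {Ri, Rd, Rq, Rb, Racc} {State} st s \<and>
    (\<forall>i<n. mem s State i = word W (poly_shift m (L + monom 1 m * H)) i)"
  then show thesis
    using that[of s] by (simp add: poly_shift_input[OF deg(1)])
qed

lemma exec_assemble:
  assumes "regs st Rm = m" "regs st Rw = W" "regs st Rn = n" "regs st Rs = length T"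
    and io: "has_io m W (L + monom 1 m * H) st" and L: "degree L < m"
    and "n \<le> len st State" "length T \<le> len st a"
    and state: "\<And>i. i < n \<Longrightarrow> mem st State i = word W (frob_final_state m T H) i"
    and taps: "\<And>j. j < length T \<Longrightarrow> mem st a j = T ! j" and a: "a \<noteq> Output"
  obtains s where "exec W B (assemble a) st assemble_cost 0 s"
    "preserves stage_regs {Output} st s" "reduced m T W L H s"
proof (rule runsE[OF runs_assemble[OF assms(1-4) has_ioD(5)[OF io] assms(7) _ assms(8)
      has_ioD(4)[OF io] state taps a]])
  show "n \<le> len st Output"
    by (simp add: has_ioD(2)[OF io])
  fix t g s
  assume "exec W B (assemble a) st t g s" and q: "t = assemble_cost \<and> g = 0 \<and>
    preserves stage_regs {Output} st s \<and>
    (\<forall>i<n. mem s Output i = word W (poly_cutoff m (L + monom 1 m * H +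
      (\<Sum>j<length T. monom 1 (T ! j) * frob_final_state m T H))) i)"
  moreover have "reduced m T W L H s"
    by (rule reducedI)
      (use q state in \<open>simp_all add: poly_cutoff_eq_frob_reduce[OF L] preserves_def\<close>)
  ultimately show thesis
    using that[of s] by simp
qed

lemma has_io_preserves:
  "has_io m W A s \<Longrightarrow> preserves X R s s' \<Longrightarrow> Input \<notin> R \<Longrightarrow> has_io m W A s'"
  by (simp add: has_io_def preserves_def)

section \<open>The in-place reduction with a state of \<open>n\<close> words\<close>

lemma runs_inplace_stages:
  assumes s: "has_support m T W st" "regs st Rn = n" "at_stage 0 st"
    and len: "n \<le> len st State" and H: "degree H < m"
    and state: "\<forall>i<n. mem st State i = word W H i"
  shows "runs W B
     (While more_stages
        (Rlen ::= Reg Rs [-] Reg Rlo ;;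
         apply_stage tap_shift adjacent_word_guarded ;;
         next_stage)) st
     (\<lambda>t g s. preserves loop_regs {State} st s \<and>
       (\<forall>i<n. mem s State i = word W (frob_final_state m T H) i))"
proof (rule runs_While[where N = r and I = "\<lambda>k t g s. preserves loop_regs {State} st s \<and>
      at_stage k s \<and> (\<forall>i<n. mem s State i = word W (frob_state m T H k) i)"], goal_cases)
  case 1
  show ?case
    using s state by (simp add: preserves_def)
next
  case (2 k t g s)
  then have k: "k < r" and p: "preserves loop_regs {State} st s" and at: "at_stage k s"
    and st: "\<And>i. i < n \<Longrightarrow> mem s State i = word W (frob_state m T H k) i"
    by auto
  have sup: "has_support m T W s"
    by (rule has_support_preserves[OF s(1) p]) auto
  define s1 where "s1 = s\<lparr>regs := (regs s)(Rlen := length (stage_shifts m T k))\<rparr>"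
  have lo: "regs s Rlo = first_active k"
    using at by (simp add: at_stage_def)
  have "length T - first_active k < B"
    using length_T_less_B by simp
  then have e1: "exec W B (Rlen ::= Reg Rs [-] Reg Rlo) s 4 0 s1"
    by (intro runs_eqD)
      (simp add: runs_Assign s1_def lo has_supportD[OF sup] length_stage_shifts)
  have p1: "preserves {Rlen} {} s s1"
    by (simp add: s1_def preserves_def)
  have sup1: "has_support m T W s1"
    by (rule has_support_preserves[OF sup p1]) auto
  have at1: "at_stage k s1"
    using at by (simp add: at_stage_def s1_def)
  have rn: "regs s1 Rn = n" "len s1 = len st"
    using p s(2) by (simp_all add: preserves_def s1_def)
  have "runs W B (apply_stage tap_shift adjacent_word_guarded) s1 (\<lambda>t g s2.
    t = stage_cost tap_shift guarded_cost (stage_shifts m T k) \<and> g = 0 \<and>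
    preserves stage_regs {State} s1 s2 \<and>
    (\<forall>i<n. mem s2 State i = word W (frob_state m T H (Suc k)) i) \<and> mem s2 State n = mem s1 State n)"
  proof (rule runs_frob_stage[OF _ rn(1) _ _ H])
    show "regs s1 Rw = W" "regs s1 Rlen = length (stage_shifts m T k)" "n \<le> len s1 State"
      using has_supportD[OF sup] len by (simp_all add: s1_def rn(2)[unfolded s1_def])
    show "mem s1 State i = word W (frob_state m T H k) i" if "i < n" for i
      using st that by (simp add: s1_def)
    fix u
    assume u: "preserves stage_regs {State} s1 u"
    have sup_u: "has_support m T W u"
      by (rule has_support_preserves[OF sup1 u]) auto
    have "at_stage k u"
      using at1 u by (simp add: at_stage_def preserves_def)
    then show "regs u Rj < length (stage_shifts m T k) \<Longrightarrow>
        safe W B tap_shift u \<and> val W tap_shift u = stage_shifts m T k ! regs u Rj"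
      using tap_shift[OF sup_u _ k] by simp
    show "runs W B adjacent_word_guarded u (\<lambda>t g s'. t = guarded_cost (regs u Rq) \<and> g = 0 \<and>
      s' = u\<lparr>regs := (regs u)(Racc := regs u Racc XOR take_bit W (push_bit (W - regs u Rb)
        (if regs u Rq + 1 < n then mem u State (regs u Rq + 1) else 0)))\<rparr>)"
      if "regs u Rq < n" "regs u Racc < 2 ^ W"
      using that u rn len has_supportD[OF sup_u]
      by (intro runs_adjacent_word_guarded) (auto simp: preserves_def)
  qed
  then obtain t2 g2 s2 where e2: "exec W B (apply_stage tap_shift adjacent_word_guarded) s1 t2 g2 s2"
    and q2: "preserves stage_regs {State} s1 s2"
      "\<forall>i<n. mem s2 State i = word W (frob_state m T H (Suc k)) i"
    by (rule runsE) blast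
  have sup2: "has_support m T W s2"
    by (rule has_support_preserves[OF sup1 q2(1)]) auto
  have at2: "at_stage k s2"
    using at1 q2(1) by (simp add: at_stage_def preserves_def)
  from runs_next_stage[OF sup2 at2 k] obtain t3 g3 s3 where e3: "exec W B next_stage s2 t3 g3 s3"
    and q3: "preserves {Rlo, Rpow, Rlim} {} s2 s3" "at_stage (Suc k) s3"
    by (rule runsE) blast
  have "preserves loop_regs {State} st s3"
    using p p1 q2(1) q3(1) by (simp add: preserves_def)
  moreover have "\<forall>i<n. mem s3 State i = word W (frob_state m T H (Suc k)) i"
    using q2(2) q3(1) by (simp add: preserves_def)
  ultimately have "runs W B (Rlen ::= Reg Rs [-] Reg Rlo ;;
         apply_stage tap_shift adjacent_word_guarded ;; next_stage) s
     (\<lambda>t' g' s'. preserves loop_regs {State} st s' \<and> at_stage (Suc k) s' \<and>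
       (\<forall>i<n. mem s' State i = word W (frob_state m T H (Suc k)) i))"
    using q3(2) by (intro runs_Seq_exec[OF e1] runs_Seq_exec[OF e2] runsI[OF e3]) blast
  moreover have "first_active k < length T" "0 < B" "Suc 0 < B"
    using k small_less_B by (simp_all add: first_active_less_iff)
  ultimately show ?case
    by (simp add: lo has_supportD[OF sup] del: frob_state.simps)
next
  case (3 t g s)
  then have p: "preserves loop_regs {State} st s" and "at_stage r s"
    by auto
  have "has_support m T W s"
    by (rule has_support_preserves[OF s(1) p]) auto
  note sup = has_supportD[OF this]
  have "regs s Rlo = length T" "0 < B"
    using \<open>at_stage r s\<close> small_less_B by (simp_all add: at_stage_def first_active_end)
  with 3 show ?case
    by (simp add: sup frob_final_state_def)
qed

lemma inplace_reduction_correct: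
  assumes deg: "degree L < m" "degree H < m" and s: "has_support m T W st"
    and io: "has_io m W (L + monom 1 m * H) st" and empty: "no_workspace st"
  shows "\<exists>st' t g. exec W B inplace_reduction st t g st' \<and> reduced m T W L H st' \<and>
    len st' State = n \<and> workspace st' = n"
proof -
  have len0: "\<And>a. a \<in> workspace_regions \<Longrightarrow> len st a = 0"
    using empty by (simp add: no_workspace_def)
  from runs_count_words[OF has_supportD(1,2)[OF s]] obtain t1 g1 s1
    where e1: "exec W B count_words st t1 g1 s1"
    and q1: "preserves {Rn} {} st s1" "regs s1 Rn = n"
    by (rule runsE) blast
  define s2 where "s2 = s1\<lparr>len := (len s1)(State := n)\<rparr>"
  have "len s1 State = 0"
    using q1(1) len0 by (simp add: preserves_def workspace_regions_def)
  then have e2: "exec W B (Alloc State (Reg Rn)) s1 2 0 s2"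
    by (intro runs_eqD) (simp add: runs_Alloc s2_def q1 workspace_regions_def)
  have sup2: "has_support m T W s2"
    using has_support_preserves[OF s q1(1)] by (simp add: s2_def has_support_def contents_def)
  have io2: "has_io m W (L + monom 1 m * H) s2"
    using has_io_preserves[OF io q1(1)] by (simp add: s2_def has_io_def)
  have r2: "regs s2 Rn = n" "n \<le> len s2 State"
    using q1(2) by (simp_all add: s2_def)
  obtain s3 where e3: "exec W B load_high s2 load_cost 0 s3"
    and q3: "preserves {Ri, Rd, Rq, Rb, Racc} {State} s2 s3"
      "\<And>i. i < n \<Longrightarrow> mem s3 State i = word W H i"
    by (rule exec_load_high[OF has_supportD(1,2)[OF sup2] r2(1) io2 deg r2(2)]) blast
  have sup3: "has_support m T W s3"
    by (rule has_support_preserves[OF sup2 q3(1)]) auto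
  from runs_first_stage[OF sup3] obtain t4 g4 s4
    where e4: "exec W B first_stage s3 t4 g4 s4"
    and q4: "preserves {Rlo, Rpow, Rlim} {} s3 s4" "at_stage 0 s4"
    by (rule runsE) blast
  have sup4: "has_support m T W s4"
    by (rule has_support_preserves[OF sup3 q4(1)]) auto
  have r4: "regs s4 Rn = n" "n \<le> len s4 State" "\<forall>i<n. mem s4 State i = word W H i"
    using q4(1) q3 r2 by (simp_all add: preserves_def)
  from runs_inplace_stages[OF sup4 r4(1) q4(2) r4(2) deg(2) r4(3)] obtain t5 g5 s5
    where e5: "exec W B (While more_stages
        (Rlen ::= Reg Rs [-] Reg Rlo ;;
         apply_stage tap_shift adjacent_word_guarded ;;
         next_stage)) s4 t5 g5 s5"
    and q5: "preserves loop_regs {State} s4 s5"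
      "\<forall>i<n. mem s5 State i = word W (frob_final_state m T H) i"
    by (rule runsE) blast
  have sup5: "has_support m T W s5"
    by (rule has_support_preserves[OF sup4 q5(1)]) auto
  have io5: "has_io m W (L + monom 1 m * H) s5"
    by (rule has_io_preserves[OF has_io_preserves[OF has_io_preserves[OF io2 q3(1)] q4(1)] q5(1)])
      auto
  have r5: "regs s5 Rn = n" "n \<le> len s5 State"
    using q5(1) r4 by (simp_all add: preserves_def)
  obtain s6 where e6: "exec W B (assemble Taps) s5 assemble_cost 0 s6"
    and q6: "preserves stage_regs {Output} s5 s6" "reduced m T W L H s6"
    by (rule exec_assemble[OF has_supportD(1,2)[OF sup5] r5(1) has_supportD(3)[OF sup5] io5 deg(1)
          r5(2), where a = Taps]) (use q5(2) has_supportD(4,5)[OF sup5] in auto)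
  have "len s6 = (len st)(State := n)"
    using q6(1) q5(1) q4(1) q3(1) q1(1) by (simp add: preserves_def s2_def)
  then have "len s6 State = n \<and> workspace s6 = n"
    using len0 by (simp add: workspace_def workspace_regions_def)
  moreover have "\<exists>t g. exec W B inplace_reduction st t g s6"
    using exec.Seq[OF e1 exec.Seq[OF e2 exec.Seq[OF e3 exec.Seq[OF e4 exec.Seq[OF e5 e6]]]]]
    unfolding inplace_reduction_def by blast
  ultimately show ?thesis
    using q6(2) by blast
qed

text \<open>Used with \<open>base = 0\<close> for the descriptor array, which every stage
  overwrites, and with \<open>base = offset k\<close> for the plan, where the cells below
  \<open>base\<close> hold earlier stages and must survive. Per shift, the store takes
  \<open>9 + ops e\<close> operations and the loop 8.\<close>

lemma exec_store_shifts:
  assumes s: "has_support m T W st" and at: "at_stage k st" "k < r"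
    and l: "regs st Rlen = length (stage_shifts m T k)"
    and len: "base + length (stage_shifts m T k) \<le> len st a"
    and a: "a \<in> {Descr, Feedback}"
    and e: "\<And>s. preserves {Rj} {a} st s \<Longrightarrow> regs s Rj < length (stage_shifts m T k) \<Longrightarrow>
      safe W B e s \<and> val W e s = base + regs s Rj"
  obtains s where "exec W B (for_below Rj (Reg Rlen) (Store a e tap_shift)) st
      (6 + (17 + ops e) * length (stage_shifts m T k)) 0 s"
    "preserves {Rj} {a} st s"
    "\<And>p. p < base \<Longrightarrow> mem s a p = mem st a p"
    "\<And>j. j < length (stage_shifts m T k) \<Longrightarrow> mem s a (base + j) = stage_shifts m T k ! j"
proof -
  let ?ds = "stage_shifts m T k"
  have "runs W B (for_below Rj (Reg Rlen) (Store a e tap_shift)) st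
    (\<lambda>t g s. t = 6 + (17 + ops e) * length ?ds \<and> g = 0 \<and> preserves {Rj} {a} st s \<and>
      (\<forall>p<base. mem s a p = mem st a p) \<and> (\<forall>j<length ?ds. mem s a (base + j) = ?ds ! j))"
  proof (rule runs_for_below[where N = "length ?ds" and \<tau> = "\<lambda>_. 9 + ops e" and
        I = "\<lambda>j s. preserves {Rj} {a} st s \<and> (\<forall>p<base. mem s a p = mem st a p) \<and>
          (\<forall>i<j. mem s a (base + i) = ?ds ! i)"], goal_cases)
    case (6 j s)
    then have p: "preserves {Rj} {a} st s"
      by simp
    have sup: "has_support m T W s"
      by (rule has_support_preserves[OF s p]) (use a in auto)
    have "at_stage k s"
      using at(1) p by (simp add: at_stage_def preserves_def)
    then have shift: "safe W B tap_shift s" "val W tap_shift s = ?ds ! j"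
      using tap_shift[OF sup _ at(2)] 6(1,3) by simp_all
    have e': "safe W B e s" "val W e s = base + j"
      using e[OF p] 6(1,3) by simp_all
    have "base + j < len s a"
      using p 6(1) len by (simp add: preserves_def)
    then have "exec W B (Store a e tap_shift) s (9 + ops e) 0
        (s\<lparr>mem := (mem s)(a := (mem s a)(base + j := ?ds ! j))\<rparr>)"
      using shift e' a
      by (intro runs_eqD) (unfold runs_Store, auto simp: packed_regions_def)
    then show ?case
      by (rule runsI) (use 6 in \<open>simp add: preserves_def less_Suc_eq\<close>)
  qed (use l length_T_less_B small_less_B in
      \<open>auto simp: preserves_def length_stage_shifts algebra_simps\<close>)
  then show thesis
    by (rule runsE) (use that in blast)
qed

section \<open>Stages that read their shifts from a table\<close>

lemma stage_cost_cong: "ops e = ops e' \<Longrightarrow> stage_cost e \<alpha> ds = stage_cost e' \<alpha> ds"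
  by (simp add: stage_cost_def)

text \<open>Stated for \<open>Descr\<close>, but equally the cost with \<open>Feedback\<close>,
  since the two loads have the same number of operations. The constant 11 is the unguarded read of
  the adjacent word.\<close>

abbreviation table_cost :: "nat \<Rightarrow> nat" where
  "table_cost k \<equiv> stage_cost (Load Descr (Reg Rbase [+] Reg Rj)) (\<lambda>_. 11) (stage_shifts m T k)"

lemma exec_table_stage:
  assumes regs: "regs st Rw = W" "regs st Rn = n" "regs st Rlen = length (stage_shifts m T k)"
    and len: "n < len st State" and H: "degree H < m" and sentinel: "mem st State n = 0"
    and state: "\<And>i. i < n \<Longrightarrow> mem st State i = word W (frob_state m T H k) i"
    and base: "regs st Rbase + length (stage_shifts m T k) \<le> len st a"
      "regs st Rbase + length (stage_shifts m T k) \<le> 2 * m"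
    and table: "\<And>j. j < length (stage_shifts m T k) \<Longrightarrow>
      mem st a (regs st Rbase + j) = stage_shifts m T k ! j"
    and a: "a \<noteq> State"
  obtains s where
    "exec W B (apply_stage (Load a (Reg Rbase [+] Reg Rj)) adjacent_word) st (table_cost k) 0 s"
    "preserves stage_regs {State} st s" "mem s State n = 0"
    "\<And>i. i < n \<Longrightarrow> mem s State i = word W (frob_state m T H (Suc k)) i"
proof -
  have "runs W B (apply_stage (Load a (Reg Rbase [+] Reg Rj)) adjacent_word) st (\<lambda>t g s.
    t = stage_cost (Load a (Reg Rbase [+] Reg Rj)) (\<lambda>_. 11) (stage_shifts m T k) \<and> g = 0 \<and>
    preserves stage_regs {State} st s \<and>
    (\<forall>i<n. mem s State i = word W (frob_state m T H (Suc k)) i) \<and> mem s State n = mem st State n)"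
  proof (rule runs_frob_stage[OF regs _ H state])
    show "n \<le> len st State"
      using len by simp
    fix u
    assume u: "preserves stage_regs {State} st u"
    show "safe W B (Load a (Reg Rbase [+] Reg Rj)) u \<and>
        val W (Load a (Reg Rbase [+] Reg Rj)) u = stage_shifts m T k ! regs u Rj"
      if "regs u Rj < length (stage_shifts m T k)"
    proof -
      have "regs st Rbase + regs u Rj < B"
        using base(2) that W_pos by (intro less_B) simp
      then show ?thesis
        using u that base(1) table a by (simp add: preserves_def)
    qed
    show "runs W B adjacent_word u (\<lambda>t g s'. t = 11 \<and> g = 0 \<and>
      s' = u\<lparr>regs := (regs u)(Racc := regs u Racc XOR take_bit W (push_bit (W - regs u Rb)
        (if regs u Rq + 1 < n then mem u State (regs u Rq + 1) else 0)))\<rparr>)"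
      if "mem u State n = mem st State n" "regs u Rq < n" "regs u Racc < 2 ^ W"
      using that u regs(1) len sentinel
      by (intro runs_adjacent_word) (auto simp: preserves_def)
  qed
  moreover have "stage_cost (Load a (Reg Rbase [+] Reg Rj)) (\<lambda>_. 11) (stage_shifts m T k) = table_cost k"
    by (rule stage_cost_cong) simp
  ultimately show thesis
    using sentinel by (elim runsE) (use that in auto)
qed

text \<open>The fixed 33 operations of a stage are 4 for the loop test, 4 for the number of shifts,
  6 for the filling loop and 19 for advancing; only the test lies outside \<open>Generate\<close>,
  which leaves 29. A shift costs 18 to write, and the multiples of 15 come from the telescoping
  scan.\<close>

lemma runs_online_stages:
  assumes s: "has_support m T W st" "regs st Rn = n" "at_stage 0 st" "regs st Rbase = 0"
    and len: "n < len st State" "length T \<le> len st Descr" and H: "degree H < m"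
    and state: "\<forall>i<n. mem st State i = word W H i" and sentinel: "mem st State n = 0"
  shows "runs W B
     (While more_stages
        (Generate
           (Rlen ::= Reg Rs [-] Reg Rlo ;;
            for_below Rj (Reg Rlen) (Store Descr (Reg Rj) tap_shift)) ;;
         apply_stage (Load Descr (Reg Rbase [+] Reg Rj)) adjacent_word ;;
         Generate next_stage)) st
     (\<lambda>t g s. preserves loop_regs {State, Descr} st s \<and>
       (\<forall>i<n. mem s State i = word W (frob_final_state m T H) i) \<and> mem s State n = 0 \<and>
       t \<le> (\<Sum>i<r. table_cost i) + 33 * r + 18 * offset r + 15 * length T + 4 \<and>
       g \<le> 29 * r + 18 * offset r + 15 * length T)"
proof (rule runs_While[where N = r and I = "\<lambda>k t g s. preserves loop_regs {State, Descr} st s \<and>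
      at_stage k s \<and> mem s State n = 0 \<and>
      (\<forall>i<n. mem s State i = word W (frob_state m T H k) i) \<and>
      t \<le> (\<Sum>i<k. table_cost i) + 33 * k + 18 * offset k + 15 * first_active k \<and>
      g \<le> 29 * k + 18 * offset k + 15 * first_active k"], goal_cases)
  case 1
  show ?case
    using s state sentinel by (simp add: preserves_def)
next
  case (2 k t g s)
  then have k: "k < r" and p: "preserves loop_regs {State, Descr} st s" and at: "at_stage k s"
    and s0: "mem s State n = 0"
    and st: "\<And>i. i < n \<Longrightarrow> mem s State i = word W (frob_state m T H k) i"
    and t: "t \<le> (\<Sum>i<k. table_cost i) + 33 * k + 18 * offset k + 15 * first_active k"
      "g \<le> 29 * k + 18 * offset k + 15 * first_active k"
    by auto
  let ?l = "length (stage_shifts m T k)"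
  have sup: "has_support m T W s"
    by (rule has_support_preserves[OF s(1) p]) auto
  define s1 where "s1 = s\<lparr>regs := (regs s)(Rlen := ?l)\<rparr>"
  have lo: "regs s Rlo = first_active k"
    using at by (simp add: at_stage_def)
  have "length T - first_active k < B"
    using length_T_less_B by simp
  then have e1: "exec W B (Rlen ::= Reg Rs [-] Reg Rlo) s 4 0 s1"
    by (intro runs_eqD)
      (simp add: runs_Assign s1_def lo has_supportD[OF sup] length_stage_shifts)
  have p1: "preserves {Rlen} {} s s1"
    by (simp add: s1_def preserves_def)
  have sup1: "has_support m T W s1"
    by (rule has_support_preserves[OF sup p1]) auto
  have at1: "at_stage k s1"
    using at by (simp add: at_stage_def s1_def)
  have l: "?l \<le> length T" "?l \<le> m"
    using length_T_le by (simp_all add: length_stage_shifts)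
  have r1: "regs s1 Rlen = ?l" "?l \<le> len s1 Descr"
    using p len(2) l by (simp_all add: preserves_def s1_def)
  obtain s2 where e2: "exec W B (for_below Rj (Reg Rlen) (Store Descr (Reg Rj) tap_shift)) s1
      (6 + 18 * ?l) 0 s2"
    and q2: "preserves {Rj} {Descr} s1 s2"
      "\<And>j. j < ?l \<Longrightarrow> mem s2 Descr j = stage_shifts m T k ! j"
    by (rule exec_store_shifts[OF sup1 at1 k r1(1), where a = Descr and base = 0 and e = "Reg Rj"])
      (use r1(2) in auto)
  have sup2: "has_support m T W s2"
    by (rule has_support_preserves[OF sup1 q2(1)]) auto
  have r2: "regs s2 Rw = W" "regs s2 Rn = n" "regs s2 Rlen = ?l" "n < len s2 State"
    "mem s2 State n = 0" "\<And>i. i < n \<Longrightarrow> mem s2 State i = word W (frob_state m T H k) i"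
    "regs s2 Rbase + ?l \<le> len s2 Descr" "regs s2 Rbase + ?l \<le> 2 * m"
    "\<And>j. j < ?l \<Longrightarrow> mem s2 Descr (regs s2 Rbase + j) = stage_shifts m T k ! j"
    using q2 p s(2,4) len st s0 l has_supportD[OF sup2] by (simp_all add: preserves_def s1_def)
  obtain s3 where e3: "exec W B (apply_stage (Load Descr (Reg Rbase [+] Reg Rj)) adjacent_word) s2
      (table_cost k) 0 s3"
    and q3: "preserves stage_regs {State} s2 s3" "mem s3 State n = 0"
      "\<And>i. i < n \<Longrightarrow> mem s3 State i = word W (frob_state m T H (Suc k)) i"
    by (rule exec_table_stage[OF r2(1-4) H r2(5-9)]) auto
  have sup3: "has_support m T W s3"
    by (rule has_support_preserves[OF sup2 q3(1)]) auto
  have at3: "at_stage k s3"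
    using at1 q2(1) q3(1) by (simp add: at_stage_def preserves_def)
  from runs_next_stage[OF sup3 at3 k] obtain t4 g4 s4 where e4: "exec W B next_stage s3 t4 g4 s4"
    and q4: "preserves {Rlo, Rpow, Rlim} {} s3 s4" "at_stage (Suc k) s4"
      "t4 = 19 + 15 * (first_active (Suc k) - first_active k)"
    by (rule runsE) blast
  have p4: "preserves loop_regs {State, Descr} st s4"
    using p p1 q2(1) q3(1) q4(1) by (simp add: preserves_def)
  have st4: "mem s4 State n = 0" "\<forall>i<n. mem s4 State i = word W (frob_state m T H (Suc k)) i"
    using q3(2,3) q4(1) by (simp_all add: preserves_def)
  let ?body = "Generate
           (Rlen ::= Reg Rs [-] Reg Rlo ;;
            for_below Rj (Reg Rlen) (Store Descr (Reg Rj) tap_shift)) ;;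
         apply_stage (Load Descr (Reg Rbase [+] Reg Rj)) adjacent_word ;;
         Generate next_stage"
  have "exec W B ?body s (4 + (6 + 18 * ?l) + (table_cost k + t4))
      (4 + (6 + 18 * ?l) + (0 + t4)) s4"
    by (rule exec.Seq[OF exec.Generate[OF exec.Seq[OF e1 e2]]
        exec.Seq[OF e3 exec.Generate[OF e4]]])
  moreover have "t + (ops more_stages + 1 + (4 + (6 + 18 * ?l) + (table_cost k + t4))) \<le>
      (\<Sum>i<Suc k. table_cost i) + 33 * Suc k + 18 * offset (Suc k) + 15 * first_active (Suc k)"
    "g + (4 + (6 + 18 * ?l) + (0 + t4)) \<le>
      29 * Suc k + 18 * offset (Suc k) + 15 * first_active (Suc k)"
    using t first_active_mono[of k] by (simp_all add: q4(3))
  ultimately have "runs W B ?body s (\<lambda>t' g' s'. preserves loop_regs {State, Descr} st s' \<and>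
      at_stage (Suc k) s' \<and> mem s' State n = 0 \<and>
      (\<forall>i<n. mem s' State i = word W (frob_state m T H (Suc k)) i) \<and>
      t + (ops more_stages + 1 + t') \<le> (\<Sum>i<Suc k. table_cost i) + 33 * Suc k +
        18 * offset (Suc k) + 15 * first_active (Suc k) \<and>
      g + g' \<le> 29 * Suc k + 18 * offset (Suc k) + 15 * first_active (Suc k))"
    using p4 q4(2) st4 by (intro runsI) blast+
  moreover have "first_active k < length T" "0 < B" "Suc 0 < B"
    using k small_less_B by (simp_all add: first_active_less_iff)
  then have "safe W B more_stages s \<and> val W more_stages s \<noteq> 0"
    by (simp add: lo has_supportD[OF sup])
  ultimately show ?case
    by blast
next
  case (3 t g s)
  then have p: "preserves loop_regs {State, Descr} st s" and "at_stage r s"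
    by auto
  have "has_support m T W s"
    by (rule has_support_preserves[OF s(1) p]) auto
  note sup = has_supportD[OF this]
  have "regs s Rlo = length T" "0 < B"
    using \<open>at_stage r s\<close> small_less_B by (simp_all add: at_stage_def first_active_end)
  with 3 show ?case
    by (simp add: sup frob_final_state_def first_active_end)
qed

text \<open>The first three terms of the time bound recur in the lower bound for the planned
  reduction; only the bracket remains as excess. Its 30 per tap are 15 for the initial scan and 15
  for the scans between stages.\<close>

lemma online_reduction_correct:
  assumes deg: "degree L < m" "degree H < m" and s: "has_support m T W st"
    and io: "has_io m W (L + monom 1 m * H) st" and empty: "no_workspace st"
  obtains s t g where "exec W B online_reduction st t g s" "reduced m T W L H s"
    "mem s State n = 0" "len s = (len st)(State := n + 1, Descr := length T)"
    "t \<le> load_cost + (\<Sum>i<r. table_cost i) + assemble_cost +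
       (42 + 33 * r + 18 * offset r + 30 * length T)"
    "g \<le> 23 + 29 * r + 18 * offset r + 30 * length T"
proof -
  have len0: "\<And>a. a \<in> workspace_regions \<Longrightarrow> len st a = 0"
    using empty by (simp add: no_workspace_def)
  from runs_count_words[OF has_supportD(1,2)[OF s]] obtain t1 g1 s1
    where e1: "exec W B count_words st t1 g1 s1" and t1: "t1 = 8" "g1 = 0"
    and q1: "preserves {Rn} {} st s1" "regs s1 Rn = n"
    by (rule runsE) blast
  define s2 where "s2 = s1\<lparr>len := (len s1)(State := n + 1)\<rparr>"
  have "len s1 State = 0"
    using q1(1) len0 by (simp add: preserves_def workspace_regions_def)
  moreover have bounds: "Suc n < B" "Suc 0 < B" "0 < B"
    using n_le_m m_pos by (auto intro!: less_B)
  ultimately have e2: "exec W B (Alloc State (Reg Rn [+] Const 1)) s1 4 0 s2"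
    by (intro runs_eqD) (simp add: runs_Alloc s2_def q1 workspace_regions_def)
  have sup2: "has_support m T W s2"
    using has_support_preserves[OF s q1(1)] by (simp add: s2_def has_support_def contents_def)
  have io2: "has_io m W (L + monom 1 m * H) s2"
    using has_io_preserves[OF io q1(1)] by (simp add: s2_def has_io_def)
  have r2: "regs s2 Rn = n" "n \<le> len s2 State"
    using q1(2) by (simp_all add: s2_def)
  obtain s3 where e3: "exec W B load_high s2 load_cost 0 s3"
    and q3: "preserves {Ri, Rd, Rq, Rb, Racc} {State} s2 s3"
      "\<And>i. i < n \<Longrightarrow> mem s3 State i = word W H i"
    by (rule exec_load_high[OF has_supportD(1,2)[OF sup2] r2(1) io2 deg r2(2)]) blast
  define s4 where "s4 = s3\<lparr>mem := (mem s3)(State := (mem s3 State)(n := 0))\<rparr>"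
  have r3: "regs s3 Rn = n" "n < len s3 State"
    using q3(1) r2 by (simp_all add: preserves_def s2_def)
  then have e4: "exec W B (Store State (Reg Rn) (Const 0)) s3 3 0 s4"
    by (intro runs_eqD) (simp add: runs_Store s4_def bounds)
  have p4: "preserves {} {State} s3 s4"
    by (simp add: s4_def preserves_def)
  have sup4: "has_support m T W s4"
    by (rule has_support_preserves[OF has_support_preserves[OF sup2 q3(1)] p4]) auto
  define s5 where "s5 = s4\<lparr>regs := (regs s4)(Rbase := 0),
    len := (len s4)(Descr := length T)\<rparr>"
  have "len s4 Descr = 0"
    using q1(1) q3(1) p4 len0 by (simp add: preserves_def s2_def workspace_regions_def)
  then have e5: "exec W B (Alloc Descr (Reg Rs)) s4 2 0
      (s4\<lparr>len := (len s4)(Descr := length T)\<rparr>)"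
    by (intro runs_eqD) (simp add: runs_Alloc has_supportD[OF sup4] workspace_regions_def)
  have e6: "exec W B (Rbase ::= Const 0) (s4\<lparr>len := (len s4)(Descr := length T)\<rparr>) 2 0 s5"
    by (intro runs_eqD) (simp add: runs_Assign bounds s5_def)
  have sup5: "has_support m T W s5"
    using sup4 by (simp add: s5_def has_support_def contents_def)
  from runs_first_stage[OF sup5] obtain t7 g7 s7
    where e7: "exec W B first_stage s5 t7 g7 s7" and t7: "t7 = 19 + 15 * first_active 0"
    and q7: "preserves {Rlo, Rpow, Rlim} {} s5 s7" "at_stage 0 s7"
    by (rule runsE) blast
  have e567: "exec W B (Generate (Alloc Descr (Reg Rs) ;; Rbase ::= Const 0 ;; first_stage)) s4
      (2 + (2 + t7)) (2 + (2 + t7)) s7"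
    by (intro exec.Generate[OF exec.Seq[OF e5 exec.Seq[OF e6 e7]]])
  have sup7: "has_support m T W s7"
    by (rule has_support_preserves[OF sup5 q7(1)]) auto
  have r7: "regs s7 Rn = n" "regs s7 Rbase = 0" "n < len s7 State" "length T \<le> len s7 Descr"
    "\<forall>i<n. mem s7 State i = word W H i" "mem s7 State n = 0"
    using q7(1) q3 r3 by (simp_all add: preserves_def s5_def s4_def)
  from runs_online_stages[OF sup7 r7(1) q7(2) r7(2-4) deg(2) r7(5,6)] obtain t8 g8 s8
    where e8: "exec W B
     (While more_stages
        (Generate
           (Rlen ::= Reg Rs [-] Reg Rlo ;;
            for_below Rj (Reg Rlen) (Store Descr (Reg Rj) tap_shift)) ;;
         apply_stage (Load Descr (Reg Rbase [+] Reg Rj)) adjacent_word ;;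
         Generate next_stage)) s7 t8 g8 s8"
    and q8: "preserves loop_regs {State, Descr} s7 s8"
      "\<forall>i<n. mem s8 State i = word W (frob_final_state m T H) i" "mem s8 State n = 0"
    and t8: "t8 \<le> (\<Sum>i<r. table_cost i) + 33 * r + 18 * offset r + 15 * length T + 4"
      "g8 \<le> 29 * r + 18 * offset r + 15 * length T"
    by (rule runsE) blast
  have sup8: "has_support m T W s8"
    by (rule has_support_preserves[OF sup7 q8(1)]) auto
  have "has_io m W (L + monom 1 m * H) s4"
    by (rule has_io_preserves[OF has_io_preserves[OF io2 q3(1)] p4]) auto
  then have "has_io m W (L + monom 1 m * H) s5"
    by (simp add: s5_def has_io_def)
  then have io8: "has_io m W (L + monom 1 m * H) s8"
    by (rule has_io_preserves[OF has_io_preserves[OF _ q7(1)] q8(1)]) auto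
  have r8: "regs s8 Rn = n" "n \<le> len s8 State"
    using q8(1) r7 by (simp_all add: preserves_def)
  obtain s9 where e9: "exec W B (assemble Taps) s8 assemble_cost 0 s9"
    and q9: "preserves stage_regs {Output} s8 s9" "reduced m T W L H s9"
    by (rule exec_assemble[OF has_supportD(1,2)[OF sup8] r8(1) has_supportD(3)[OF sup8] io8 deg(1)
          r8(2), where a = Taps]) (use q8(2) has_supportD(4,5)[OF sup8] in auto)
  have "exec W B online_reduction st
    (t1 + (4 + (load_cost + (3 + (2 + (2 + t7) + (t8 + assemble_cost))))))
    (g1 + (0 + (0 + (0 + (2 + (2 + t7) + (g8 + 0)))))) s9"
    unfolding online_reduction_def
    by (rule exec.Seq[OF e1 exec.Seq[OF e2 exec.Seq[OF e3 exec.Seq[OF e4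
        exec.Seq[OF e567 exec.Seq[OF e8 e9]]]]]])
  moreover have "mem s9 State n = 0"
    using q8(3) q9(1) by (simp add: preserves_def)
  moreover have "len s9 = (len st)(State := n + 1, Descr := length T)"
    using q9(1) q8(1) q7(1) q3(1) q1(1) by (simp add: preserves_def s5_def s4_def s2_def)
  ultimately show thesis
    using q9(2) t8 first_active_le[of 0] by (intro that) (simp_all add: t1 t7, linarith+)
qed

section \<open>The reduction with a stored plan\<close>

lemma holds_planD:
  assumes "holds_plan m T W st"
  shows "len st Meta = 5" "mem st Meta 0 = m" "mem st Meta 1 = W" "mem st Meta 2 = n"
    "mem st Meta 3 = length T" "mem st Meta 4 = r"
    "len st Stages = r" "\<And>k. k < r \<Longrightarrow> mem st Stages k = length (stage_shifts m T k)"
    "len st Feedback = offset r"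
    "\<And>k j. k < r \<Longrightarrow> j < length (stage_shifts m T k) \<Longrightarrow>
      mem st Feedback (offset k + j) = stage_shifts m T k ! j"
    "len st Assembly = length T" "\<And>j. j < length T \<Longrightarrow> mem st Assembly j = T ! j"
    "len st State = n + 1"
proof -
  have Meta: "len st Meta = 5" "\<And>i. i < 5 \<Longrightarrow> mem st Meta i = [m, W, n, length T, r] ! i"
    using assms by (simp_all add: holds_plan_def contents_eq_iff)
  show "len st Meta = 5" "mem st Meta 0 = m" "mem st Meta 1 = W" "mem st Meta 2 = n"
    "mem st Meta 3 = length T" "mem st Meta 4 = r"
    using Meta(1) Meta(2)[of 0] Meta(2)[of 1] Meta(2)[of 2] Meta(2)[of 3] Meta(2)[of 4]
    by (simp_all add: numeral_eq_Suc)
  have Feedback: "len st Feedback = offset r"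
    "\<And>p. p < offset r \<Longrightarrow> mem st Feedback p = concat (map (stage_shifts m T) [0..<r]) ! p"
    using assms by (auto simp: holds_plan_def contents_eq_iff length_concat_stage_shifts
        simp del: length_concat)
  show "len st Feedback = offset r"
    by (rule Feedback)
  show "mem st Feedback (offset k + j) = stage_shifts m T k ! j"
    if "k < r" "j < length (stage_shifts m T k)" for k j
  proof -
    have "offset k + j < offset r"
      using offset_mono[of "Suc k" r] that by simp
    then show ?thesis
      using Feedback(2) nth_concat_stage_shifts[OF that] by simp
  qed
qed (use assms in \<open>simp_all add: holds_plan_def contents_eq_iff length_stage_shifts card_active\<close>)

lemma holds_plan_preserves:
  assumes "holds_plan m T W s" and "preserves X R s s'"
    and "Meta \<notin> R" "Stages \<notin> R" "Feedback \<notin> R" "Assembly \<notin> R"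
  shows "holds_plan m T W s'"
  using assms by (simp add: holds_plan_def preserves_def contents_def)

abbreviation plan_regs :: "reg set" where
  "plan_regs \<equiv> insert Rlen (insert Rbase (insert Rk stage_regs))"

text \<open>The time is bounded from below, since the planned reduction is the reference against
  which the online one is compared.\<close>

lemma runs_planned_stages:
  assumes plan: "holds_plan m T W st" and regs: "regs st Rw = W" "regs st Rn = n" "regs st Rr = r"
    "regs st Rbase = 0"
    and H: "degree H < m"
    and state: "\<forall>i<n. mem st State i = word W H i" and sentinel: "mem st State n = 0"
  shows "runs W B
     (for_below Rk (Reg Rr)
        (Rlen ::= Load Stages (Reg Rk) ;;
         apply_stage (Load Feedback (Reg Rbase [+] Reg Rj)) adjacent_word ;;
         Rbase ::= Reg Rbase [+] Reg Rlen)) st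
     (\<lambda>t g s. preserves plan_regs {State} st s \<and>
       (\<forall>i<n. mem s State i = word W (frob_final_state m T H) i) \<and> mem s State n = 0 \<and>
       (\<Sum>i<r. table_cost i) \<le> t)"
proof (rule runs_for_below[where N = r and \<tau> = "\<lambda>k. 7 + table_cost k" and
      I = "\<lambda>k s. preserves plan_regs {State} st s \<and> regs s Rbase = offset k \<and>
        mem s State n = 0 \<and> (\<forall>i<n. mem s State i = word W (frob_state m T H k) i)"], goal_cases)
  case 5
  show ?case
    using regs state sentinel by (simp add: preserves_def)
next
  case (6 k s)
  then have k: "k < r" and p: "preserves plan_regs {State} st s" and base: "regs s Rbase = offset k"
    and s0: "mem s State n = 0" and Rk: "regs s Rk = k"
    and st: "\<And>i. i < n \<Longrightarrow> mem s State i = word W (frob_state m T H k) i"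
    by auto
  let ?l = "length (stage_shifts m T k)"
  have plan_s: "holds_plan m T W s"
    by (rule holds_plan_preserves[OF plan p]) auto
  define s1 where "s1 = s\<lparr>regs := (regs s)(Rlen := ?l)\<rparr>"
  have e1: "exec W B (Rlen ::= Load Stages (Reg Rk)) s 3 0 s1"
    by (intro runs_eqD) (simp add: runs_Assign s1_def holds_planD[OF plan_s] Rk k)
  have bounds: "offset k + ?l \<le> offset r" "offset k + ?l \<le> 2 * m" "offset k + ?l < B"
    using offset_mono[of "Suc k" r] offset_bound[of "Suc k"] k offset_less_B[of 0 "Suc k"]
    by simp_all
  have r1: "regs s1 Rw = W" "regs s1 Rn = n" "regs s1 Rlen = ?l" "n < len s1 State"
    "mem s1 State n = 0" "\<And>i. i < n \<Longrightarrow> mem s1 State i = word W (frob_state m T H k) i"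
    "regs s1 Rbase + ?l \<le> len s1 Feedback" "regs s1 Rbase + ?l \<le> 2 * m"
    "\<And>j. j < ?l \<Longrightarrow> mem s1 Feedback (regs s1 Rbase + j) = stage_shifts m T k ! j"
    using p regs st s0 base bounds holds_planD[OF plan_s] k by (simp_all add: preserves_def s1_def)
  obtain s2 where e2: "exec W B (apply_stage (Load Feedback (Reg Rbase [+] Reg Rj)) adjacent_word)
      s1 (table_cost k) 0 s2"
    and q2: "preserves stage_regs {State} s1 s2" "mem s2 State n = 0"
      "\<And>i. i < n \<Longrightarrow> mem s2 State i = word W (frob_state m T H (Suc k)) i"
    by (rule exec_table_stage[OF r1(1-4) H r1(5-9)]) auto
  define s3 where "s3 = s2\<lparr>regs := (regs s2)(Rbase := offset (Suc k))\<rparr>"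
  have "regs s2 Rbase = offset k" "regs s2 Rlen = ?l"
    using q2(1) base by (simp_all add: preserves_def s1_def)
  then have e3: "exec W B (Rbase ::= Reg Rbase [+] Reg Rlen) s2 4 0 s3"
    using bounds(3) by (intro runs_eqD) (simp add: runs_Assign s3_def)
  have "preserves plan_regs {State} st s3" "regs s3 Rk = k" "regs s3 Rr = r"
    using p q2(1) Rk regs by (simp_all add: preserves_def s1_def s3_def)
  then show ?case
    using q2(2,3)
    by (intro runsI[OF exec.Seq[OF e1 exec.Seq[OF e2 e3]]]) (simp add: preserves_def s3_def)
next
  case (7 s)
  have "(\<Sum>i<r. table_cost i) \<le> (\<Sum>i<r. 7 + table_cost i + 8)"
    by (rule sum_mono) simp
  with 7 show ?case
    by (simp add: frob_final_state_def)
qed (use regs r_less_B small_less_B in simp_all)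

lemma planned_reduction_correct:
  assumes deg: "degree L < m" "degree H < m" and plan: "holds_plan m T W st"
    and io: "has_io m W (L + monom 1 m * H) st"
  obtains s t g where "exec W B planned_reduction st t g s" "reduced m T W L H s"
    "mem s State n = 0" "len s = len st" "holds_plan m T W s"
    "load_cost + (\<Sum>i<r. table_cost i) + assemble_cost \<le> t"
proof -
  define s1 where "s1 = st\<lparr>regs := (regs st)(Rm := m, Rw := W, Rn := n, Rs := length T, Rr := r)\<rparr>"
  have cs: "0 < B" "Suc 0 < B" "2 < B" "3 < B" "4 < B"
    using small_less_B by simp_all
  have load_meta: "runs W B
      (Rm ::= Load Meta (Const 0) ;;
      Rw ::= Load Meta (Const 1) ;;
      Rn ::= Load Meta (Const 2) ;;
      Rs ::= Load Meta (Const 3) ;;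
      Rr ::= Load Meta (Const 4) ;; c) st Q \<longleftrightarrow> runs W B c s1 (\<lambda>t g s. Q (15 + t) g s)" for c Q
    using holds_planD(1-6)[OF plan]
    by (simp add: runs_Seq runs_Assign s1_def cs) (simp add: numeral_eq_Suc)
  have p1: "preserves {Rm, Rw, Rn, Rs, Rr} {} st s1"
    by (simp add: s1_def preserves_def)
  have io1: "has_io m W (L + monom 1 m * H) s1"
    by (rule has_io_preserves[OF io p1]) auto
  have r1: "regs s1 Rm = m" "regs s1 Rw = W" "regs s1 Rn = n" "n \<le> len s1 State"
    using holds_planD(13)[OF plan] by (simp_all add: s1_def)
  obtain s2 where e2: "exec W B load_high s1 load_cost 0 s2"
    and q2: "preserves {Ri, Rd, Rq, Rb, Racc} {State} s1 s2"
      "\<And>i. i < n \<Longrightarrow> mem s2 State i = word W H i"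
    by (rule exec_load_high[OF r1(1-3) io1 deg r1(4)]) blast
  \<comment> \<open>\<open>holds_plan\<close> fixes the length of the state array but not its
    contents, so the sentinel is written anew in every run.\<close>
  define s3 where "s3 = s2\<lparr>mem := (mem s2)(State := (mem s2 State)(n := 0))\<rparr>"
  have "regs s2 Rn = n" "n < len s2 State"
    using q2(1) r1 holds_planD(13)[OF plan] p1 by (simp_all add: preserves_def)
  then have e3: "exec W B (Store State (Reg Rn) (Const 0)) s2 3 0 s3"
    by (intro runs_eqD) (simp add: runs_Store s3_def cs)
  define s4 where "s4 = s3\<lparr>regs := (regs s3)(Rbase := 0)\<rparr>"
  have e4: "exec W B (Rbase ::= Const 0) s3 2 0 s4"
    by (intro runs_eqD) (simp add: runs_Assign s4_def cs)
  have p4: "preserves (insert Rm (insert Rw (insert Rn (insert Rs (insert Rr plan_regs))))) {State} st s4"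
    using p1 q2(1) by (simp add: preserves_def s4_def s3_def)
  have plan4: "holds_plan m T W s4"
    by (rule holds_plan_preserves[OF plan p4]) auto
  have io4: "has_io m W (L + monom 1 m * H) s4"
    by (rule has_io_preserves[OF io p4]) auto
  have r4: "regs s4 Rm = m" "regs s4 Rw = W" "regs s4 Rn = n" "regs s4 Rs = length T" "regs s4 Rr = r"
    "regs s4 Rbase = 0" "\<forall>i<n. mem s4 State i = word W H i" "mem s4 State n = 0"
    using q2 by (simp_all add: preserves_def s4_def s3_def s1_def)
  from runs_planned_stages[OF plan4 r4(2,3,5,6) deg(2) r4(7,8)] obtain t5 g5 s5
    where e5: "exec W B
     (for_below Rk (Reg Rr)
        (Rlen ::= Load Stages (Reg Rk) ;;
         apply_stage (Load Feedback (Reg Rbase [+] Reg Rj)) adjacent_word ;;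
         Rbase ::= Reg Rbase [+] Reg Rlen)) s4 t5 g5 s5"
    and q5: "preserves plan_regs {State} s4 s5"
      "\<forall>i<n. mem s5 State i = word W (frob_final_state m T H) i" "mem s5 State n = 0"
    and t5: "(\<Sum>i<r. table_cost i) \<le> t5"
    by (rule runsE) blast
  have plan5: "holds_plan m T W s5"
    by (rule holds_plan_preserves[OF plan4 q5(1)]) auto
  have io5: "has_io m W (L + monom 1 m * H) s5"
    by (rule has_io_preserves[OF io4 q5(1)]) auto
  have r5: "regs s5 Rm = m" "regs s5 Rw = W" "regs s5 Rn = n" "regs s5 Rs = length T"
    "n \<le> len s5 State"
    using q5(1) r4 holds_planD(13)[OF plan5] by (simp_all add: preserves_def)
  obtain s6 where e6: "exec W B (assemble Assembly) s5 assemble_cost 0 s6"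
    and q6: "preserves stage_regs {Output} s5 s6" "reduced m T W L H s6"
    by (rule exec_assemble[OF r5(1-4) io5 deg(1) r5(5), where a = Assembly])
      (use q5(2) holds_planD(11,12)[OF plan5] in auto)
  have "runs W B planned_reduction st (\<lambda>t g s. s = s6 \<and>
      t = 15 + (load_cost + (3 + (2 + (t5 + assemble_cost)))))"
    unfolding planned_reduction_def load_meta
    by (rule runsI[OF exec.Seq[OF e2 exec.Seq[OF e3 exec.Seq[OF e4 exec.Seq[OF e5 e6]]]]]) simp
  then obtain g where "exec W B planned_reduction st
      (15 + (load_cost + (3 + (2 + (t5 + assemble_cost))))) g s6"
    by (rule runsE) blast
  moreover have "mem s6 State n = 0" "len s6 = len st"
    using q5(1,3) q6(1) p4 by (simp_all add: preserves_def)
  moreover have "holds_plan m T W s6"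
    by (rule holds_plan_preserves[OF plan5 q6(1)]) auto
  ultimately show thesis
    using q6(2) t5 by (intro that) (simp_all, linarith)
qed

section \<open>Plan construction\<close>

text \<open>A region can be allocated only once, so \<open>r\<close> and the total number of shifts
  have to be known before the plan is filled.\<close>

lemma runs_count_stages:
  assumes s: "has_support m T W st" "at_stage 0 st" "regs st Rr = 0" "regs st Rbase = 0"
  shows "runs W B
     (While more_stages
        (Rbase ::= Reg Rbase [+] (Reg Rs [-] Reg Rlo) ;;
         Rr ::= Reg Rr [+] Const 1 ;;
         next_stage)) st
     (\<lambda>t g s. preserves {Rbase, Rr, Rlo, Rpow, Rlim} {} st s \<and> regs s Rr = r \<and>
       regs s Rbase = offset r \<and> t \<le> 33 * r + 15 * length T + 4)"
proof (rule runs_While[where N = r and I = "\<lambda>k t g s.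
      preserves {Rbase, Rr, Rlo, Rpow, Rlim} {} st s \<and>
      at_stage k s \<and> regs s Rr = k \<and> regs s Rbase = offset k \<and>
      t \<le> 33 * k + 15 * first_active k"], goal_cases)
  case 1
  show ?case
    using s by (simp add: preserves_def)
next
  case (2 k t g s)
  then have k: "k < r" and p: "preserves {Rbase, Rr, Rlo, Rpow, Rlim} {} st s"
    and at: "at_stage k s" and regs: "regs s Rr = k" "regs s Rbase = offset k"
    and t: "t \<le> 33 * k + 15 * first_active k"
    by auto
  have sup: "has_support m T W s"
    by (rule has_support_preserves[OF s(1) p]) auto
  have lo: "regs s Rlo = first_active k"
    using at by (simp add: at_stage_def)
  define s1 where "s1 = s\<lparr>regs := (regs s)(Rbase := offset (Suc k))\<rparr>"
  have bounds: "length T - first_active k < B" "offset k + (length T - first_active k) < B"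
    "Suc k < B" "Suc 0 < B" "0 < B"
    using length_T_less_B offset_less_B[of 0 "Suc k"] le_less_trans[OF _ r_less_B, of "Suc k"] k
      small_less_B
    by (simp_all add: length_stage_shifts)
  have e1: "exec W B (Rbase ::= Reg Rbase [+] (Reg Rs [-] Reg Rlo)) s 6 0 s1"
    by (intro runs_eqD) (simp add: runs_Assign s1_def lo has_supportD[OF sup] regs bounds
        length_stage_shifts)
  define s2 where "s2 = s1\<lparr>regs := (regs s1)(Rr := Suc k)\<rparr>"
  have e2: "exec W B (Rr ::= Reg Rr [+] Const 1) s1 4 0 s2"
    by (intro runs_eqD) (simp add: runs_Assign s2_def s1_def regs bounds)
  have p2: "preserves {Rbase, Rr} {} s s2"
    by (simp add: s1_def s2_def preserves_def)
  have sup2: "has_support m T W s2"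
    by (rule has_support_preserves[OF sup p2]) auto
  have at2: "at_stage k s2"
    using at by (simp add: at_stage_def s1_def s2_def)
  from runs_next_stage[OF sup2 at2 k] obtain t3 g3 s3 where e3: "exec W B next_stage s2 t3 g3 s3"
    and q3: "preserves {Rlo, Rpow, Rlim} {} s2 s3" "at_stage (Suc k) s3"
      "t3 = 19 + 15 * (first_active (Suc k) - first_active k)"
    by (rule runsE) blast
  have "preserves {Rbase, Rr, Rlo, Rpow, Rlim} {} st s3" "regs s3 Rr = Suc k"
    "regs s3 Rbase = offset (Suc k)"
    using p p2 q3(1) by (simp_all add: preserves_def s2_def s1_def)
  moreover have "t + (ops more_stages + 1 + (6 + (4 + t3))) \<le> 33 * Suc k + 15 * first_active (Suc k)"
    using t first_active_mono[of k] by (simp add: q3(3))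
  ultimately have "runs W B (Rbase ::= Reg Rbase [+] (Reg Rs [-] Reg Rlo) ;;
         Rr ::= Reg Rr [+] Const 1 ;; next_stage) s
     (\<lambda>t' g' s'. preserves {Rbase, Rr, Rlo, Rpow, Rlim} {} st s' \<and> at_stage (Suc k) s' \<and>
       regs s' Rr = Suc k \<and> regs s' Rbase = offset (Suc k) \<and>
       t + (ops more_stages + 1 + t') \<le> 33 * Suc k + 15 * first_active (Suc k))"
    using q3(2) by (intro runsI[OF exec.Seq[OF e1 exec.Seq[OF e2 e3]]]) blast
  moreover have "safe W B more_stages s \<and> val W more_stages s \<noteq> 0"
    using k bounds by (simp add: lo has_supportD[OF sup] first_active_less_iff)
  ultimately show ?case
    by blast
next
  case (3 t g s)
  then have p: "preserves {Rbase, Rr, Rlo, Rpow, Rlim} {} st s" and "at_stage r s"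
    by auto
  have "has_support m T W s"
    by (rule has_support_preserves[OF s(1) p]) auto
  note sup = has_supportD[OF this]
  have "regs s Rlo = length T" "0 < B"
    using \<open>at_stage r s\<close> small_less_B by (simp_all add: at_stage_def first_active_end)
  with 3 show ?case
    by (simp add: sup first_active_end)
qed

abbreviation build_regs :: "reg set" where
  "build_regs \<equiv> {Rlen, Rbase, Rk, Rj, Rlo, Rpow, Rlim}"

text \<open>A stage costs 44 fixed operations, including 19 for advancing and 4 for the loop test. A
  shift costs 20, two more than online, because its address is the sum of a base and an
  index.\<close>

lemma runs_fill_stages:
  assumes s: "has_support m T W st" "at_stage 0 st" "regs st Rk = 0" "regs st Rbase = 0"
    and len: "len st Stages = r" "len st Feedback = offset r"
  shows "runs W B
     (While more_stages
        (Rlen ::= Reg Rs [-] Reg Rlo ;;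
         Store Stages (Reg Rk) (Reg Rlen) ;;
         for_below Rj (Reg Rlen) (Store Feedback (Reg Rbase [+] Reg Rj) tap_shift) ;;
         Rbase ::= Reg Rbase [+] Reg Rlen ;;
         Rk ::= Reg Rk [+] Const 1 ;;
         next_stage)) st
     (\<lambda>t g s. preserves build_regs {Stages, Feedback} st s \<and>
       (\<forall>i<r. mem s Stages i = length (stage_shifts m T i)) \<and>
       (\<forall>p<offset r. mem s Feedback p = concat (map (stage_shifts m T) [0..<r]) ! p) \<and>
       t \<le> 44 * r + 20 * offset r + 15 * length T + 4)"
proof (rule runs_While[where N = r and I = "\<lambda>k t g s.
      preserves build_regs {Stages, Feedback} st s \<and>
      at_stage k s \<and> regs s Rk = k \<and> regs s Rbase = offset k \<and>
      (\<forall>i<k. mem s Stages i = length (stage_shifts m T i)) \<and>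
      (\<forall>p<offset k. mem s Feedback p = concat (map (stage_shifts m T) [0..<r]) ! p) \<and>
      t \<le> 44 * k + 20 * offset k + 15 * first_active k"], goal_cases)
  case 1
  show ?case
    using s by (simp add: preserves_def)
next
  case (2 k t g s)
  let ?l = "length (stage_shifts m T k)"
  let ?F = "concat (map (stage_shifts m T) [0..<r])"
  from 2 have k: "k < r" and p: "preserves build_regs {Stages, Feedback} st s"
    and at: "at_stage k s" and regs: "regs s Rk = k" "regs s Rbase = offset k"
    and St: "\<forall>i<k. mem s Stages i = length (stage_shifts m T i)"
    and Fb: "\<forall>p<offset k. mem s Feedback p = ?F ! p"
    and t: "t \<le> 44 * k + 20 * offset k + 15 * first_active k"
    by auto
  have sup: "has_support m T W s"
    by (rule has_support_preserves[OF s(1) p]) auto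
  have lo: "regs s Rlo = first_active k"
    using at by (simp add: at_stage_def)
  have bounds: "length T - first_active k < B" "offset k + ?l < B"
    "Suc k < B" "Suc 0 < B" "0 < B"
    using length_T_less_B offset_less_B[of 0 "Suc k"] le_less_trans[OF _ r_less_B, of "Suc k"] k
      small_less_B
    by simp_all
  define s1 where "s1 = s\<lparr>regs := (regs s)(Rlen := ?l)\<rparr>"
  have e1: "exec W B (Rlen ::= Reg Rs [-] Reg Rlo) s 4 0 s1"
    using bounds(1) by (intro runs_eqD)
      (simp add: runs_Assign s1_def lo has_supportD[OF sup] length_stage_shifts)
  define s2 where "s2 = s1\<lparr>mem := (mem s1)(Stages := (mem s1 Stages)(k := ?l))\<rparr>"
  have "k < len s1 Stages"
    using p k len(1) by (simp add: preserves_def s1_def)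
  then have e2: "exec W B (Store Stages (Reg Rk) (Reg Rlen)) s1 3 0 s2"
    by (intro runs_eqD) (simp add: runs_Store s2_def s1_def regs packed_regions_def)
  have p2: "preserves {Rlen} {Stages} s s2"
    by (simp add: s1_def s2_def preserves_def)
  have sup2: "has_support m T W s2"
    by (rule has_support_preserves[OF sup p2]) auto
  have at2: "at_stage k s2"
    using at by (simp add: at_stage_def s1_def s2_def)
  have "offset k + ?l \<le> offset r"
    using offset_mono[of "Suc k" r] k by simp
  then have r2: "regs s2 Rlen = ?l" "offset k + ?l \<le> len s2 Feedback" "regs s2 Rbase = offset k"
    using p len(2) regs by (simp_all add: s2_def s1_def preserves_def)
  obtain s3 where e3: "exec W B (for_below Rj (Reg Rlen)
      (Store Feedback (Reg Rbase [+] Reg Rj) tap_shift)) s2 (6 + 20 * ?l) 0 s3"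
    and q3: "preserves {Rj} {Feedback} s2 s3"
      "\<And>p. p < offset k \<Longrightarrow> mem s3 Feedback p = mem s2 Feedback p"
      "\<And>j. j < ?l \<Longrightarrow> mem s3 Feedback (offset k + j) = stage_shifts m T k ! j"
  proof (rule exec_store_shifts[OF sup2 at2 k r2(1,2), where e = "Reg Rbase [+] Reg Rj"])
    show "safe W B (Reg Rbase [+] Reg Rj) u \<and>
        val W (Reg Rbase [+] Reg Rj) u = offset k + regs u Rj"
      if "preserves {Rj} {Feedback} s2 u" "regs u Rj < ?l" for u
      using that r2(3) bounds(2) by (simp add: preserves_def)
  qed auto
  define s4 where "s4 = s3\<lparr>regs := (regs s3)(Rbase := offset (Suc k))\<rparr>"
  have "regs s3 Rbase = offset k" "regs s3 Rlen = ?l"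
    using q3(1) r2 by (simp_all add: preserves_def)
  then have e4: "exec W B (Rbase ::= Reg Rbase [+] Reg Rlen) s3 4 0 s4"
    using bounds(2) by (intro runs_eqD) (simp add: runs_Assign s4_def)
  define s5 where "s5 = s4\<lparr>regs := (regs s4)(Rk := Suc k)\<rparr>"
  have "regs s4 Rk = k"
    using q3(1) regs by (simp add: preserves_def s4_def s2_def s1_def)
  then have e5: "exec W B (Rk ::= Reg Rk [+] Const 1) s4 4 0 s5"
    by (intro runs_eqD) (simp add: runs_Assign s5_def bounds)
  have p5: "preserves {Rlen, Rbase, Rk, Rj} {Stages, Feedback} s s5"
    using q3(1) by (simp add: preserves_def s5_def s4_def s2_def s1_def)
  have sup5: "has_support m T W s5"
    by (rule has_support_preserves[OF sup p5]) auto
  have at5: "at_stage k s5"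
    using at p5 by (simp add: at_stage_def preserves_def)
  from runs_next_stage[OF sup5 at5 k] obtain t6 g6 s6 where e6: "exec W B next_stage s5 t6 g6 s6"
    and q6: "preserves {Rlo, Rpow, Rlim} {} s5 s6" "at_stage (Suc k) s6"
      "t6 = 19 + 15 * (first_active (Suc k) - first_active k)"
    by (rule runsE) blast
  have p6: "preserves build_regs {Stages, Feedback} st s6" "regs s6 Rk = Suc k"
    "regs s6 Rbase = offset (Suc k)"
    using p p5 q6(1) by (simp_all add: preserves_def s5_def s4_def)
  have St6: "\<forall>i<Suc k. mem s6 Stages i = length (stage_shifts m T i)"
    using St q3(1) q6(1) by (simp add: preserves_def s5_def s4_def s2_def s1_def less_Suc_eq)
  \<comment> \<open>A position is either in the prefix left by earlier stages or in the block just
    written, where it has the form \<open>offset k + j\<close>.\<close>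
  have Fb6: "\<forall>p<offset (Suc k). mem s6 Feedback p = ?F ! p"
  proof (intro allI impI)
    fix p assume p: "p < offset (Suc k)"
    have eq: "mem s6 Feedback = mem s3 Feedback"
      using q6(1) by (simp add: preserves_def s5_def s4_def)
    show "mem s6 Feedback p = ?F ! p"
    proof (cases "p < offset k")
      case True
      then show ?thesis
        using Fb q3(2) by (simp add: eq s2_def s1_def)
    next
      case False
      then obtain j where j: "p = offset k + j"
        using le_Suc_ex[of "offset k" p] by auto
      with p have "j < ?l"
        by simp
      then show ?thesis
        using q3(3) nth_concat_stage_shifts[OF k] by (simp add: eq j)
    qed
  qed
  have "t + (ops more_stages + 1 + (4 + (3 + ((6 + 20 * ?l) + (4 + (4 + t6)))))) \<le>
      44 * Suc k + 20 * offset (Suc k) + 15 * first_active (Suc k)"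
    using t first_active_mono[of k] by (simp add: q6(3))
  with p6 St6 Fb6 q6(2) have "runs W B (Rlen ::= Reg Rs [-] Reg Rlo ;;
         Store Stages (Reg Rk) (Reg Rlen) ;;
         for_below Rj (Reg Rlen) (Store Feedback (Reg Rbase [+] Reg Rj) tap_shift) ;;
         Rbase ::= Reg Rbase [+] Reg Rlen ;;
         Rk ::= Reg Rk [+] Const 1 ;;
         next_stage) s
     (\<lambda>t' g' s'. preserves build_regs {Stages, Feedback} st s' \<and>
      at_stage (Suc k) s' \<and> regs s' Rk = Suc k \<and> regs s' Rbase = offset (Suc k) \<and>
      (\<forall>i<Suc k. mem s' Stages i = length (stage_shifts m T i)) \<and>
      (\<forall>p<offset (Suc k). mem s' Feedback p = ?F ! p) \<and>
       t + (ops more_stages + 1 + t') \<le>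
         44 * Suc k + 20 * offset (Suc k) + 15 * first_active (Suc k))"
    by (intro runsI[OF exec.Seq[OF e1 exec.Seq[OF e2 exec.Seq[OF e3 exec.Seq[OF e4
            exec.Seq[OF e5 e6]]]]]]) blast
  moreover have "safe W B more_stages s \<and> val W more_stages s \<noteq> 0"
    using k bounds by (simp add: lo has_supportD[OF sup] first_active_less_iff)
  ultimately show ?case
    by blast
next
  case (3 t g s)
  then have p: "preserves build_regs {Stages, Feedback} st s" and "at_stage r s"
    by auto
  have "has_support m T W s"
    by (rule has_support_preserves[OF s(1) p]) auto
  note sup = has_supportD[OF this]
  have "regs s Rlo = length T" "0 < B"
    using \<open>at_stage r s\<close> small_less_B by (simp_all add: at_stage_def first_active_end)
  with 3 show ?case
    by (simp add: sup first_active_end del: length_concat)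
qed

lemma exec_store_taps:
  assumes s: "has_support m T W st" and len: "len st Assembly = length T"
  obtains s where
    "exec W B (for_below Rj (Reg Rs) (Store Assembly (Reg Rj) (Load Taps (Reg Rj)))) st
      (6 + 12 * length T) 0 s"
    "preserves {Rj} {Assembly} st s" "\<And>j. j < length T \<Longrightarrow> mem s Assembly j = T ! j"
proof -
  have "runs W B (for_below Rj (Reg Rs) (Store Assembly (Reg Rj) (Load Taps (Reg Rj)))) st
    (\<lambda>t g s. t = 6 + 12 * length T \<and> g = 0 \<and> preserves {Rj} {Assembly} st s \<and>
      (\<forall>j<length T. mem s Assembly j = T ! j))"
  proof (rule runs_for_below[where N = "length T" and \<tau> = "\<lambda>_. 4" and
        I = "\<lambda>j s. preserves {Rj} {Assembly} st s \<and> (\<forall>i<j. mem s Assembly i = T ! i)"], goal_cases)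
    case (6 j s)
    then have p: "preserves {Rj} {Assembly} st s"
      by simp
    have sup: "has_support m T W s"
      by (rule has_support_preserves[OF s p]) auto
    have "j < len s Assembly"
      using p 6(1) len by (simp add: preserves_def)
    then have "exec W B (Store Assembly (Reg Rj) (Load Taps (Reg Rj))) s 4 0
        (s\<lparr>mem := (mem s)(Assembly := (mem s Assembly)(j := T ! j))\<rparr>)"
      using 6(1,3) by (intro runs_eqD)
        (simp add: runs_Store packed_regions_def has_supportD[OF sup])
    then show ?case
      by (rule runsI) (use 6 in \<open>simp add: preserves_def less_Suc_eq\<close>)
  qed (use length_T_less_B small_less_B has_supportD(3)[OF s] in \<open>auto simp: preserves_def\<close>)
  then show thesis
    by (rule runsE) (use that in blast)
qed

text \<open>The 77 per stage are 33 for counting and 44 for filling. The 72 per tap are four scans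
  of the support at 15 each, two in either pass, and 12 for copying the exponent.\<close>

lemma build_plan_correct:
  assumes s: "has_support m T W st" and empty: "no_workspace st"
  obtains s t g where "exec W B build_plan st t g s" "holds_plan m T W s"
    "len s = (len st)(Meta := 5, Stages := r, Feedback := offset r, Assembly := length T,
      State := n + 1)"
    "t \<le> 95 + 77 * r + 20 * offset r + 72 * length T"
proof -
  have len0: "\<And>a. a \<in> workspace_regions \<Longrightarrow> len st a = 0"
    using empty by (simp add: no_workspace_def)
  have cs: "0 < B" "Suc 0 < B" "2 < B" "3 < B" "4 < B" "5 < B" "Suc n < B"
    using small_less_B n_le_m m_pos by (auto intro: less_B)
  from runs_count_words[OF has_supportD(1,2)[OF s]] obtain t1 g1 s1
    where e1: "exec W B count_words st t1 g1 s1" and t1: "t1 = 8"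
    and q1: "preserves {Rn} {} st s1" "regs s1 Rn = n"
    by (rule runsE) blast
  have sup1: "has_support m T W s1"
    by (rule has_support_preserves[OF s q1(1)]) auto
  from runs_first_stage[OF sup1] obtain t2 g2 s2
    where e2: "exec W B first_stage s1 t2 g2 s2" and t2: "t2 = 19 + 15 * first_active 0"
    and q2: "preserves {Rlo, Rpow, Rlim} {} s1 s2" "at_stage 0 s2"
    by (rule runsE) blast
  define s3 where "s3 = s2\<lparr>regs := (regs s2)(Rr := 0, Rbase := 0)\<rparr>"
  have e3: "exec W B (Rr ::= Const 0) s2 2 0 (s2\<lparr>regs := (regs s2)(Rr := 0)\<rparr>)"
    by (intro runs_eqD) (simp add: runs_Assign cs)
  have e3': "exec W B (Rbase ::= Const 0) (s2\<lparr>regs := (regs s2)(Rr := 0)\<rparr>) 2 0 s3"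
    by (intro runs_eqD) (simp add: runs_Assign cs s3_def)
  have p3: "preserves {Rlo, Rpow, Rlim, Rr, Rbase} {} s1 s3" "at_stage 0 s3"
    using q2 by (simp_all add: preserves_def s3_def at_stage_def)
  have sup3: "has_support m T W s3"
    by (rule has_support_preserves[OF sup1 p3(1)]) auto
  from runs_count_stages[OF sup3 p3(2)] obtain t4 g4 s4
    where e4: "exec W B (While more_stages
        (Rbase ::= Reg Rbase [+] (Reg Rs [-] Reg Rlo) ;;
         Rr ::= Reg Rr [+] Const 1 ;;
         next_stage)) s3 t4 g4 s4" and t4: "t4 \<le> 33 * r + 15 * length T + 4"
    and q4: "preserves {Rbase, Rr, Rlo, Rpow, Rlim} {} s3 s4" "regs s4 Rr = r"
      "regs s4 Rbase = offset r"
    by (rule runsE) (auto simp: s3_def)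
  have sup4: "has_support m T W s4"
    by (rule has_support_preserves[OF sup3 q4(1)]) auto
  have r4: "regs s4 Rn = n" "len s4 = len st"
    using q4(1) p3(1) q1 by (simp_all add: preserves_def)
  define s5 where "s5 = s4\<lparr>len := (len s4)(Meta := 5, Stages := r, Feedback := offset r,
      Assembly := length T, State := n + 1),
    mem := (mem s4)(Meta := (mem s4 Meta)(0 := m, 1 := W, 2 := n, 3 := length T, 4 := r))\<rparr>"
  have alloc: "runs W B
     (Alloc Meta (Const 5) ;;
      Alloc Stages (Reg Rr) ;;
      Alloc Feedback (Reg Rbase) ;;
      Alloc Assembly (Reg Rs) ;;
      Alloc State (Reg Rn [+] Const 1) ;;
      Store Meta (Const 0) (Reg Rm) ;;
      Store Meta (Const 1) (Reg Rw) ;;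
      Store Meta (Const 2) (Reg Rn) ;;
      Store Meta (Const 3) (Reg Rs) ;;
      Store Meta (Const 4) (Reg Rr) ;; c) s4 Q \<longleftrightarrow> runs W B c s5 (\<lambda>t g s. Q (27 + t) g s)" for c Q
    using len0
    by (simp add: runs_Seq runs_Alloc runs_Store s5_def cs r4 q4 has_supportD(1-3)[OF sup4]
        workspace_regions_def packed_regions_def) (simp add: numeral_eq_Suc)
  have sup5: "has_support m T W s5"
    using sup4 by (simp add: s5_def has_support_def contents_def)
  from runs_first_stage[OF sup5] obtain t6 g6 s6
    where e6: "exec W B first_stage s5 t6 g6 s6" and t6: "t6 = 19 + 15 * first_active 0"
    and q6: "preserves {Rlo, Rpow, Rlim} {} s5 s6" "at_stage 0 s6"
    by (rule runsE) blast
  define s7 where "s7 = s6\<lparr>regs := (regs s6)(Rk := 0, Rbase := 0)\<rparr>"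
  have e7: "exec W B (Rk ::= Const 0) s6 2 0 (s6\<lparr>regs := (regs s6)(Rk := 0)\<rparr>)"
    by (intro runs_eqD) (simp add: runs_Assign cs)
  have e7': "exec W B (Rbase ::= Const 0) (s6\<lparr>regs := (regs s6)(Rk := 0)\<rparr>) 2 0 s7"
    by (intro runs_eqD) (simp add: runs_Assign cs s7_def)
  have p7: "preserves build_regs {} s5 s7" "at_stage 0 s7"
    using q6 by (simp_all add: preserves_def s7_def at_stage_def)
  have sup7: "has_support m T W s7"
    by (rule has_support_preserves[OF sup5 p7(1)]) auto
  have r7: "regs s7 Rk = 0" "regs s7 Rbase = 0" "len s7 Stages = r" "len s7 Feedback = offset r"
    using p7(1) by (simp_all add: preserves_def s7_def s5_def)
  from runs_fill_stages[OF sup7 p7(2) r7] obtain t8 g8 s8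
    where e8: "exec W B (While more_stages
        (Rlen ::= Reg Rs [-] Reg Rlo ;;
         Store Stages (Reg Rk) (Reg Rlen) ;;
         for_below Rj (Reg Rlen) (Store Feedback (Reg Rbase [+] Reg Rj) tap_shift) ;;
         Rbase ::= Reg Rbase [+] Reg Rlen ;;
         Rk ::= Reg Rk [+] Const 1 ;;
         next_stage)) s7 t8 g8 s8"
    and q8: "preserves build_regs {Stages, Feedback} s7 s8"
       "\<forall>i<r. mem s8 Stages i = length (stage_shifts m T i)"
       "\<forall>p<offset r. mem s8 Feedback p = concat (map (stage_shifts m T) [0..<r]) ! p"
    and t8: "t8 \<le> 44 * r + 20 * offset r + 15 * length T + 4"
    by (rule runsE) blast
  have sup8: "has_support m T W s8"
    by (rule has_support_preserves[OF sup7 q8(1)]) auto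
  have "len s8 Assembly = length T"
    using q8(1) p7(1) by (simp add: preserves_def s5_def)
  then obtain s9 where
    e9: "exec W B (for_below Rj (Reg Rs) (Store Assembly (Reg Rj) (Load Taps (Reg Rj)))) s8
      (6 + 12 * length T) 0 s9"
    and q9: "preserves {Rj} {Assembly} s8 s9" "\<And>j. j < length T \<Longrightarrow> mem s9 Assembly j = T ! j"
    by (rule exec_store_taps[OF sup8]) blast
  have p9: "preserves build_regs {Stages, Feedback, Assembly} s5 s9"
    using p7(1) q8(1) q9(1) by (simp add: preserves_def)
  then have len9: "len s9 = (len st)(Meta := 5, Stages := r, Feedback := offset r,
      Assembly := length T, State := n + 1)"
    by (simp add: preserves_def s5_def r4)
  have "contents s9 Meta = [m, W, n, length T, r]"
    using p9 by (auto simp: contents_eq_iff preserves_def s5_def less_Suc_eq numeral_eq_Suc)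
  moreover have "mem s9 Stages = mem s8 Stages" "mem s9 Feedback = mem s8 Feedback"
    using q9(1) by (simp_all add: preserves_def)
  then have "contents s9 Stages = map (\<lambda>k. card (active_taps m T k)) [0..<r]"
    "contents s9 Feedback = concat (map (stage_shifts m T) [0..<r])"
    "contents s9 Assembly = T"
    using q8(2,3) q9(2)
    by (simp_all add: contents_eq_iff len9 card_active length_stage_shifts
        length_concat_stage_shifts del: length_concat)
  ultimately have "holds_plan m T W s9"
    by (simp add: holds_plan_def len9)
  moreover have "runs W B build_plan st (\<lambda>t g s. s = s9 \<and>
      t = t1 + (t2 + (2 + (2 + (t4 + (27 + (t6 + (2 + (2 + (t8 + (6 + 12 * length T)))))))))))"
    unfolding build_plan_def
    by (rule runs_Seq_exec[OF e1], rule runs_Seq_exec[OF e2], rule runs_Seq_exec[OF e3],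
        rule runs_Seq_exec[OF e3'], rule runs_Seq_exec[OF e4], unfold alloc,
        rule runsI[OF exec.Seq[OF e6 exec.Seq[OF e7 exec.Seq[OF e7' exec.Seq[OF e8 e9]]]]]) simp
  then obtain g where "exec W B build_plan st
      (t1 + (t2 + (2 + (2 + (t4 + (27 + (t6 + (2 + (2 + (t8 + (6 + 12 * length T))))))))))) g s9"
    by (rule runsE) blast
  moreover have "t1 + (t2 + (2 + (2 + (t4 + (27 + (t6 + (2 + (2 + (t8 + (6 + 12 * length T)))))))))) \<le>
      95 + 77 * r + 20 * offset r + 72 * length T"
    using t4 t8 first_active_le[of 0] unfolding t1 t2 t6 by linarith
  ultimately show thesis
    using len9 that by blast
qed

end

theorem proposition5p4:
  "\<exists>C::nat. \<forall>(m::nat) (T::nat list) (W::nat).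
     m \<ge> 1 \<longrightarrow> valid_support m T \<longrightarrow> W \<ge> 1 \<longrightarrow>
     (let n = num_words W m;
          s = length T;
          r = num_stages m T;
          S = num_feedback m T;
          work = max 1 (s + r + S);
          B = word_range m W;
          input = (\<lambda>L H. L + monom 1 m * H)
      in
        \<comment> \<open>the algorithm reduces modulo \<open>g\<close>\<close>
        (\<forall>L H. degree L < m \<longrightarrow> degree H < m \<longrightarrow>
           frob_reduce m T L H = input L H mod modulus m T) \<and>
        \<comment> \<open>one packed \<open>m\<close>-bit state suffices\<close>
        (\<forall>L H st. degree L < m \<longrightarrow> degree H < m \<longrightarrow>
           has_support m T W st \<longrightarrow> has_io m W (input L H) st \<longrightarrow> no_workspace st \<longrightarrow>
           (\<exists>st' t g. exec W B inplace_reduction st t g st' \<and> reduced m T W L H st' \<and>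
              len st' State = n \<and> workspace st' = n)) \<and>
        \<comment> \<open>construction and size of the reusable plan\<close>
        (\<forall>st. has_support m T W st \<longrightarrow> no_workspace st \<longrightarrow>
           (\<exists>st' t g. exec W B build_plan st t g st' \<and> holds_plan m T W st' \<and>
              len st' State = n + 1 \<and>
              len st' Stages = r \<and> len st' Feedback = S \<and> len st' Assembly = s \<and>
              len st' Meta \<le> C \<and> len st' Descr = 0 \<and>
              t \<le> C * work \<and>
              len st' Stages + len st' Feedback + len st' Assembly + len st' Meta \<le> C * work)) \<and>
        \<comment> \<open>reductions using the plan: no further storage, and the plan stays intact\<close>
        (\<forall>L H st. degree L < m \<longrightarrow> degree H < m \<longrightarrow>
           holds_plan m T W st \<longrightarrow> has_io m W (input L H) st \<longrightarrow>
           (\<exists>st' t g. exec W B planned_reduction st t g st' \<and> reduced m T W L H st' \<and>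
              mem st' State n = 0 \<and> len st' = len st \<and> holds_plan m T W st')) \<and>
        \<comment> \<open>online generation\<close>
        (\<forall>L H st. degree L < m \<longrightarrow> degree H < m \<longrightarrow>
           has_support m T W st \<longrightarrow> has_io m W (input L H) st \<longrightarrow> no_workspace st \<longrightarrow>
           (\<exists>st' t g. exec W B online_reduction st t g st' \<and> reduced m T W L H st' \<and>
              mem st' State n = 0 \<and>
              len st' State = n + 1 \<and> len st' Descr = s \<and>
              len st' Stages = 0 \<and> len st' Feedback = 0 \<and> len st' Assembly = 0 \<and>
              len st' Meta = 0 \<and>
              workspace st' \<le> C * (n + s) \<and>
              g \<le> C * work \<and>
              (\<forall>pst pst' pt pg. holds_plan m T W pst \<longrightarrow> has_io m W (input L H) pst \<longrightarrow>
                 exec W B planned_reduction pst pt pg pst' \<longrightarrow> t \<le> pt + C * work))))"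
\<comment> \<open>A round constant: both 1 and \<open>length T + r + offset r\<close> are at most
  \<open>work\<close>, so the largest cost, that of building the plan, is at most
  \<open>(95 + 77) * work\<close>.\<close>
proof (intro exI[of _ 200] allI impI, goal_cases)
  case (1 m T W)
  then interpret reduction m T W
    by unfold_locales
  define work where "work = max 1 (length T + r + offset r)"
  have "1 \<le> work" "length T + r + offset r \<le> work"
    by (simp_all add: work_def)
  then have work: "95 + 77 * r + 20 * offset r + 72 * length T \<le> 200 * work"
    "r + offset r + length T + 5 \<le> 200 * work"
    "23 + 29 * r + 18 * offset r + 30 * length T \<le> 200 * work"
    "42 + 33 * r + 18 * offset r + 30 * length T \<le> 200 * work"
    by linarith+
  show ?case
    unfolding Let_def num_feedback_eq_offset work_def[symmetric]
  proof (intro conjI allI impI, goal_cases)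
    case (1 L H)
    then show ?case
      by (rule frob_reduce_eq_mod[OF m_pos support])
  next
    case (2 L H st)
    then show ?case
      by (rule inplace_reduction_correct)
  next
    case (3 st)
    then obtain s t g where "exec W B build_plan st t g s" "holds_plan m T W s"
      "len s = (len st)(Meta := 5, Stages := r, Feedback := offset r, Assembly := length T,
        State := n + 1)"
      "t \<le> 95 + 77 * r + 20 * offset r + 72 * length T"
      by (rule build_plan_correct)
    moreover have "len st Descr = 0"
      using 3(2) by (simp add: no_workspace_def workspace_regions_def)
    ultimately show ?case
      using work(1,2) by (intro exI[of _ s] exI[of _ t] exI[of _ g]) simp
  next
    case (4 L H st)
    then obtain s t g where "exec W B planned_reduction st t g s" "reduced m T W L H s"
      "mem s State n = 0" "len s = len st" "holds_plan m T W s"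
      by (rule planned_reduction_correct)
    then show ?case
      by blast
  next
    case (5 L H st)
    then obtain s t g where e: "exec W B online_reduction st t g s" "reduced m T W L H s"
      "mem s State n = 0" and len: "len s = (len st)(State := n + 1, Descr := length T)"
      and t: "t \<le> load_cost + (\<Sum>i<r. table_cost i) + assemble_cost +
         (42 + 33 * r + 18 * offset r + 30 * length T)"
      and g: "g \<le> 23 + 29 * r + 18 * offset r + 30 * length T"
      by (rule online_reduction_correct)
    have "\<And>a. a \<in> workspace_regions \<Longrightarrow> len st a = 0"
      using 5(5) by (simp add: no_workspace_def)
    then have lens: "len s State = n + 1" "len s Descr = length T" "len s Stages = 0"
      "len s Feedback = 0" "len s Assembly = 0" "len s Meta = 0"
      by (simp_all add: len workspace_regions_def)
    then have "workspace s \<le> 200 * (n + length T)"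
      using n_pos by (simp add: workspace_def workspace_regions_def)
    \<comment> \<open>The planned run is arbitrary. Determinism identifies it with the one from
      \<open>planned_reduction_correct\<close>, and the common leading terms of the two bounds drop
      out.\<close>
    moreover have "t \<le> pt + 200 * work"
      if plan: "holds_plan m T W pst" "has_io m W (L + monom 1 m * H) pst"
        and p: "exec W B planned_reduction pst pt pg pst'" for pst pst' pt pg
    proof -
      from planned_reduction_correct[OF 5(1,2) plan] obtain t' g' s' where
        "exec W B planned_reduction pst t' g' s'"
        "load_cost + (\<Sum>i<r. table_cost i) + assemble_cost \<le> t'"
        by blast
      with exec_deterministic[OF p] t work(4) show ?thesis
        by fastforce
    qed
    ultimately show ?case
      using e lens g work(3) by (intro exI[of _ s] exI[of _ t] exI[of _ g]) auto
  qed
qed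

end
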